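(* Let $u$ be the weak solution of the heat equation with forcing $f$, and assume $u_{ttt},\ \Delta u_{tt},\ f_{tt}\in L^2(0,T;L^2(\Omega))$. Consider the Crank–Nicolson POD Galerkin reduced order model (CN POD-G-ROM), with POD basis built from the snapshots and their difference quotients, and let $e^k=u^k-u_r^k$ and $\phi_r^0=u_r^0-R_r(u^0)$. Then there is a constant $C>0$, independent of the discretization parameters ($N$, $\Delta t=T/N$, $r$) and of the ROM initial value $u_r^0\in X^r$, such that the following hold for all $N\ge1$ and $1\le r\le s$. When the $L^2$ POD basis is used ($\mathcal H=L^2(\Omega)$): $$\max_{1\le k\le N}\|\nabla e^k\|_{L^2}^2\le C\Big(\sum_{i=r+1}^s\lambda_i^{DQ}\big(\|\varphi_i-R_r(\varphi_i)\|_{L^2}^2+\|\nabla(\varphi_i-R_r(\varphi_i))\|_{L^2}^2\big)+\|\nabla\phi_r^0\|_{L^2}^2+\Delta t^4I(u,f)\Big).$$ When the $H^1_0$ POD basis is used ($\mathcal H=H^1_0(\Omega)$): $$\max_{1\le k\le N}\|\nabla e^k\|_{L^2}^2\le C\Big(\sum_{i=r+1}^s\lambda_i^{DQ}(1+\|\varphi_i\|_{L^2}^2)+\|\nabla\phi_r^0\|_{L^2}^2+\Delta t^4I(u,f)\Big).$$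
   Context: $\Omega\subset\mathbb R^d$ ($d\in\{1,2,3\}$) is a bounded open domain with Lipschitz boundary, $X=H^1_0(\Omega)$ with inner product $(u,v)_{H^1_0}=(\nabla u,\nabla v)_{L^2}$, $\nu>0$, $T>0$. $u(\cdot,t)\in X$, $t\in[0,T]$, satisfies $(\partial_tu,v)_{L^2}+\nu(\nabla u,\nabla v)_{L^2}=(f,v)_{L^2}$ for all $v\in X$, at every $t\in[0,T]$. The regularity hypothesis is understood to mean that $u$ and $f$ are regular enough in time that all quantities are well defined: $u\in H^3(0,T;L^2(\Omega))$, $\Delta u\in H^2(0,T;L^2(\Omega))$, $f\in H^2(0,T;L^2(\Omega))$ (continuous representatives in time). Set $$I(u,f)=\|u_{ttt}\|_{L^2(0,T;L^2)}^2+\|\Delta u_{tt}\|_{L^2(0,T;L^2)}^2+\|f_{tt}\|_{L^2(0,T;L^2)}^2.$$ Time grid: $\Delta t=T/N$, $t_n=n\Delta t$, $u^n=u(t_n)$. For any discrete or continuous time function $z$, $z^{n+1/2}:=\frac12(z^{n+1}+z^n)$ (an average, not a midpoint value), and $\partial z^{n+1}=(z^{n+1}-z^n)/\Delta t$. POD with difference quotients in the Hilbert space $\mathcal H$ ($\mathcal H=L^2(\Omega)$ or $\mathcal H=H^1_0(\Omega)$): let $v^n=u^n$ ($0\le n\le N$), $v^{N+n}=\partial u^n$ ($1\le n\le N$), and $K_{mn}=\frac1{2N+1}(v^m,v^n)_{\mathcal H}$, $0\le m,n\le 2N$, with eigenvalues $\lambda_1^{DQ}\ge\lambda_2^{DQ}\ge\dots\ge0$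 and orthonormal eigenvectors $\mathbf z_i$; $s$ is the number of positive eigenvalues; the POD modes are $\varphi_i=(\lambda_i^{DQ})^{-1/2}(2N+1)^{-1/2}\sum_{m=0}^{2N}(\mathbf z_i)^mv^m$, $1\le i\le s$, which lie in $X$. $X^r=\mathrm{span}\{\varphi_1,\dots,\varphi_r\}$. Ritz projection $R_r:X\to X^r$: $(\nabla(w-R_r(w)),\nabla v_r)_{L^2}=0$ for all $v_r\in X^r$. CN POD-G-ROM: given $u_r^0\in X^r$, find $u_r^{n+1}\in X^r$, $n=0,\dots,N-1$, with $$(\partial u_r^{n+1},v_r)_{L^2}+\nu(\nabla u_r^{n+1/2},\nabla v_r)_{L^2}=(f^{n+1/2},v_r)_{L^2}\quad\forall v_r\in X^r.$$ *)

theory Defs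
  imports "HOL-Analysis.Analysis"
begin

section \<open>The space of square-integrable functions\<close>

text \<open>
  The library has no \<open>L\<^sup>2\<close> type. Elements of \<open>L\<^sup>2(\<real>\<^sup>d)\<close> are classes of Borel functions modulo
  equality almost everywhere; the class instances below (a separable inner product space) make
  the Bochner integral of the library available for functions of time with values in it.
\<close>

definition sq_int :: "('a::euclidean_space \<Rightarrow> real) \<Rightarrow> bool" where
  "sq_int f \<longleftrightarrow> f \<in> borel_measurable lborel \<and> integrable lborel (\<lambda>x. (f x)\<^sup>2)"

definition l2_rel :: "('a::euclidean_space \<Rightarrow> real) \<Rightarrow> ('a \<Rightarrow> real) \<Rightarrow> bool" where
  "l2_rel f g \<longleftrightarrow> sq_int f \<and> sq_int g \<and> (AE x in lborel. f x = g x)"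

lemma sq_int_measurable [dest]: "sq_int f \<Longrightarrow> f \<in> borel_measurable lborel"
  by (simp add: sq_int_def)

lemma sq_int_zero [simp]: "sq_int (\<lambda>_. 0)"
  by (simp add: sq_int_def)

lemma sq_int_mult:
  assumes "sq_int f" "sq_int g"
  shows "integrable lborel (\<lambda>x. f x * g x)"
proof (rule Bochner_Integration.integrable_bound)
  show "integrable lborel (\<lambda>x. (f x)\<^sup>2 + (g x)\<^sup>2)"
    using assms by (simp add: sq_int_def)
  show "(\<lambda>x. f x * g x) \<in> borel_measurable lborel"
    using assms by (auto simp: sq_int_def intro!: borel_measurable_times)
  have "\<bar>a * b\<bar> \<le> a\<^sup>2 + b\<^sup>2" for a b :: real
  proof -
    have "2 * (\<bar>a\<bar> * \<bar>b\<bar>) \<le> a\<^sup>2 + b\<^sup>2"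
      using sum_squares_bound[of "\<bar>a\<bar>" "\<bar>b\<bar>"] by (simp add: mult.assoc)
    moreover have "0 \<le> \<bar>a\<bar> * \<bar>b\<bar>" by simp
    ultimately show ?thesis unfolding abs_mult by linarith
  qed
  then show "AE x in lborel. norm (f x * g x) \<le> norm ((f x)\<^sup>2 + (g x)\<^sup>2)"
    by (intro AE_I2) (simp add: order_trans[OF _ abs_ge_self])
qed

lemma sq_int_scale: "sq_int f \<Longrightarrow> sq_int (\<lambda>x. c * f x)"
  by (auto simp: sq_int_def power_mult_distrib)

lemma sq_int_add:
  assumes "sq_int f" "sq_int g"
  shows "sq_int (\<lambda>x. f x + g x)"
proof -
  have "integrable lborel (\<lambda>x. (f x)\<^sup>2 + (g x)\<^sup>2 + 2 * (f x * g x))"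
    using assms sq_int_mult[OF assms] by (auto simp: sq_int_def)
  then show ?thesis
    using assms by (auto simp: sq_int_def power2_sum mult.assoc)
qed

lemma sq_int_uminus: "sq_int f \<Longrightarrow> sq_int (\<lambda>x. - f x)"
  using sq_int_scale[of f "-1"] by simp

lemma sq_int_diff: "sq_int f \<Longrightarrow> sq_int g \<Longrightarrow> sq_int (\<lambda>x. f x - g x)"
  using sq_int_add[of f "\<lambda>x. - g x"] sq_int_uminus[of g] by simp

quotient_type (overloaded) 'a l2 = "'a::euclidean_space \<Rightarrow> real" / partial: l2_rel
proof (rule part_equivpI)
  show "\<exists>f::'a \<Rightarrow> real. l2_rel f f"
    by (intro exI[of _ "\<lambda>_. 0"]) (simp add: l2_rel_def)
  show "symp (l2_rel :: ('a \<Rightarrow> real) \<Rightarrow> _)"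
    by (auto simp: symp_def l2_rel_def)
  show "transp (l2_rel :: ('a \<Rightarrow> real) \<Rightarrow> _)"
    unfolding transp_def l2_rel_def by (auto elim: eventually_elim2)
qed

lemma abs_rep_l2: "abs_l2 (rep_l2 u) = u"
  by (rule Quotient3_abs_rep[OF Quotient3_l2])

lemma sq_int_rep_l2: "sq_int (rep_l2 u)"
  using Quotient3_rep_reflp[OF Quotient3_l2, of u] by (simp add: l2_rel_def)

instantiation l2 :: (euclidean_space) real_inner
begin

lift_definition zero_l2 :: "'a l2" is "\<lambda>_. 0"
  by (simp add: l2_rel_def)

lift_definition plus_l2 :: "'a l2 \<Rightarrow> 'a l2 \<Rightarrow> 'a l2" is "\<lambda>f g x. f x + g x"
  by (auto simp: l2_rel_def intro!: sq_int_add elim: eventually_elim2)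

lift_definition minus_l2 :: "'a l2 \<Rightarrow> 'a l2 \<Rightarrow> 'a l2" is "\<lambda>f g x. f x - g x"
  by (auto simp: l2_rel_def intro!: sq_int_diff elim: eventually_elim2)

lift_definition uminus_l2 :: "'a l2 \<Rightarrow> 'a l2" is "\<lambda>f x. - f x"
  by (auto simp: l2_rel_def intro!: sq_int_uminus)

lift_definition scaleR_l2 :: "real \<Rightarrow> 'a l2 \<Rightarrow> 'a l2" is "\<lambda>c f x. c * f x"
  by (auto simp: l2_rel_def intro!: sq_int_scale)

lift_definition inner_l2 :: "'a l2 \<Rightarrow> 'a l2 \<Rightarrow> real" is "\<lambda>f g. \<integral>x. f x * g x \<partial>lborel"
proof -
  fix f f' g g' :: "'a \<Rightarrow> real"
  assume "l2_rel f f'" "l2_rel g g'"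
  then have sq: "sq_int f" "sq_int f'" "sq_int g" "sq_int g'"
    and ae: "AE x in lborel. f x = f' x" "AE x in lborel. g x = g' x"
    by (auto simp: l2_rel_def)
  show "(\<integral>x. f x * g x \<partial>lborel) = (\<integral>x. f' x * g' x \<partial>lborel)"
  proof (rule integral_cong_AE)
    show "AE x in lborel. f x * g x = f' x * g' x"
      using ae by eventually_elim simp
  qed (use sq in \<open>auto intro!: borel_measurable_times\<close>)
qed

definition norm_l2 :: "'a l2 \<Rightarrow> real" where
  "norm_l2 f = sqrt (f \<bullet> f)"

definition dist_l2 :: "'a l2 \<Rightarrow> 'a l2 \<Rightarrow> real" where
  "dist_l2 f g = norm (f - g)"

definition sgn_l2 :: "'a l2 \<Rightarrow> 'a l2" where
  "sgn_l2 f = inverse (norm f) *\<^sub>R f"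

definition uniformity_l2 :: "('a l2 \<times> 'a l2) filter" where
  "uniformity_l2 = (INF e\<in>{0<..}. principal {(f, g). dist f g < e})"

definition open_l2 :: "'a l2 set \<Rightarrow> bool" where
  "open_l2 U \<longleftrightarrow> (\<forall>f\<in>U. \<forall>\<^sub>F (f', g) in uniformity. f' = f \<longrightarrow> g \<in> U)"

instance
proof
  fix f g h :: "'a l2" and a b :: real and U :: "'a l2 set"
  show "f + g + h = f + (g + h)"
    by transfer (auto simp: l2_rel_def add.assoc intro!: sq_int_add)
  show "f + g = g + f"
    by transfer (auto simp: l2_rel_def add.commute intro!: sq_int_add)
  show "0 + f = f"
    by transfer (simp add: l2_rel_def)
  show "- f + f = 0"
    by transfer (simp add: l2_rel_def)
  show "f - g = f + - g"
    by transfer (auto simp: l2_rel_def intro!: sq_int_add sq_int_diff sq_int_uminus)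
  show "a *\<^sub>R (f + g) = a *\<^sub>R f + a *\<^sub>R g"
    by transfer (auto simp: l2_rel_def distrib_left intro!: sq_int_add sq_int_scale)
  show "(a + b) *\<^sub>R f = a *\<^sub>R f + b *\<^sub>R f"
    by transfer (auto simp: l2_rel_def distrib_right intro!: sq_int_add sq_int_scale)
  show "a *\<^sub>R b *\<^sub>R f = (a * b) *\<^sub>R f"
    by transfer (auto simp: l2_rel_def mult.assoc intro!: sq_int_scale)
  show "1 *\<^sub>R f = f"
    by transfer (simp add: l2_rel_def)
  show "f \<bullet> g = g \<bullet> f"
    by transfer (simp add: mult.commute)
  show "(f + g) \<bullet> h = f \<bullet> h + g \<bullet> h"
    by transfer (simp add: l2_rel_def distrib_right sq_int_mult)
  show "(a *\<^sub>R f) \<bullet> g = a * (f \<bullet> g)"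
    by transfer (simp add: mult.assoc)
  show "0 \<le> f \<bullet> f"
    by transfer simp
  show "f \<bullet> f = 0 \<longleftrightarrow> f = 0"
  proof transfer
    fix f :: "'a \<Rightarrow> real"
    assume "l2_rel f f"
    then have "integrable lborel (\<lambda>x. f x * f x)"
      by (simp add: l2_rel_def sq_int_mult)
    then have "(\<integral>x. f x * f x \<partial>lborel) = 0 \<longleftrightarrow> (AE x in lborel. f x * f x = 0)"
      by (intro integral_nonneg_eq_0_iff_AE) auto
    then show "(\<integral>x. f x * f x \<partial>lborel) = 0 \<longleftrightarrow> l2_rel f (\<lambda>_. 0)"
      using \<open>l2_rel f f\<close> by (simp add: l2_rel_def)
  qed
qed (auto simp: norm_l2_def dist_l2_def sgn_l2_def uniformity_l2_def open_l2_def)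

end

lemma abs_l2_add: "sq_int f \<Longrightarrow> sq_int g \<Longrightarrow> abs_l2 (\<lambda>x. f x + g x) = abs_l2 f + abs_l2 g"
  by (simp add: plus_l2.abs_eq l2_rel_def)

lemma abs_l2_diff: "sq_int f \<Longrightarrow> sq_int g \<Longrightarrow> abs_l2 (\<lambda>x. f x - g x) = abs_l2 f - abs_l2 g"
  by (simp add: minus_l2.abs_eq l2_rel_def)

lemma abs_l2_scale: "sq_int f \<Longrightarrow> abs_l2 (\<lambda>x. c * f x) = c *\<^sub>R abs_l2 f"
  by (simp add: scaleR_l2.abs_eq l2_rel_def)

lemma abs_l2_zero: "abs_l2 (\<lambda>_. 0) = 0"
  by (simp add: zero_l2_def)

lemma abs_l2_sum:
  assumes "finite I" "\<And>i. sq_int (h i)"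
  shows "abs_l2 (\<lambda>x. \<Sum>i\<in>I. h i x) = (\<Sum>i\<in>I. abs_l2 (h i))"
proof -
  have "sq_int (\<lambda>x. \<Sum>i\<in>I. h i x) \<and> abs_l2 (\<lambda>x. \<Sum>i\<in>I. h i x) = (\<Sum>i\<in>I. abs_l2 (h i))"
    using assms(1)
    by (induction I rule: finite_induct) (simp_all add: abs_l2_zero abs_l2_add sq_int_add assms(2))
  then show ?thesis ..
qed

lemma norm_abs_l2: "sq_int f \<Longrightarrow> norm (abs_l2 f) = sqrt (\<integral>x. (f x)\<^sup>2 \<partial>lborel)"
  by (simp add: norm_l2_def inner_l2.abs_eq l2_rel_def power2_eq_square)

lemma abs_l2_dominated_convergence:
  assumes f: "\<And>k. f k \<in> borel_measurable lborel" and F: "F \<in> borel_measurable lborel"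
    and g: "sq_int g"
    and lim: "\<And>x. (\<lambda>k. f k x) \<longlonglongrightarrow> F x" and bound: "\<And>k x. \<bar>f k x\<bar> \<le> g x"
  shows "sq_int F" "sq_int (f k)" "(\<lambda>k. abs_l2 (f k)) \<longlonglongrightarrow> abs_l2 F"
proof -
  have le: "\<bar>F x\<bar> \<le> g x" for x
    by (rule LIMSEQ_le_const2[OF tendsto_rabs[OF lim[of x]]]) (simp add: bound)
  have sq: "sq_int h" if "h \<in> borel_measurable lborel" "\<And>x. \<bar>h x\<bar> \<le> g x" for h
  proof -
    have "integrable lborel (\<lambda>x. (h x)\<^sup>2)"
    proof (rule Bochner_Integration.integrable_bound)
      show "integrable lborel (\<lambda>x. (g x)\<^sup>2)" using g by (simp add: sq_int_def)
      show "(\<lambda>x. (h x)\<^sup>2) \<in> borel_measurable lborel" using that(1) by simp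
      show "AE x in lborel. norm ((h x)\<^sup>2) \<le> norm ((g x)\<^sup>2)"
      proof (rule AE_I2)
        fix x
        show "norm ((h x)\<^sup>2) \<le> norm ((g x)\<^sup>2)"
          using power_mono[OF that(2)[of x], of 2] by simp
      qed
    qed
    then show ?thesis using that(1) by (simp add: sq_int_def)
  qed
  show sF: "sq_int F" by (rule sq[OF F le])
  show sf: "sq_int (f k)" for k by (rule sq[OF f bound])
  have "(\<lambda>k. \<integral>x. (f k x - F x)\<^sup>2 \<partial>lborel) \<longlonglongrightarrow> (\<integral>x. 0 \<partial>(lborel :: 'a measure))"
  proof (rule integral_dominated_convergence)
    show "integrable lborel (\<lambda>x. 4 * (g x)\<^sup>2)" using g by (simp add: sq_int_def)
    show "AE x in lborel. (\<lambda>k. (f k x - F x)\<^sup>2) \<longlonglongrightarrow> 0"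
    proof (rule AE_I2)
      fix x
      have "(\<lambda>k. (f k x - F x)\<^sup>2) \<longlonglongrightarrow> (F x - F x)\<^sup>2"
        by (intro tendsto_power tendsto_diff lim tendsto_const)
      then show "(\<lambda>k. (f k x - F x)\<^sup>2) \<longlonglongrightarrow> 0" by simp
    qed
    fix k
    show "AE x in lborel. norm ((f k x - F x)\<^sup>2) \<le> 4 * (g x)\<^sup>2"
    proof (rule AE_I2)
      fix x
      have "\<bar>f k x - F x\<bar> \<le> 2 * g x" using bound[of k x] le[of x] by linarith
      then have "(f k x - F x)\<^sup>2 \<le> (2 * g x)\<^sup>2"
        using power_mono[of "\<bar>f k x - F x\<bar>" "2 * g x" 2] by simp
      then show "norm ((f k x - F x)\<^sup>2) \<le> 4 * (g x)\<^sup>2" by (simp add: power_mult_distrib)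
    qed
  qed (use f F in auto)
  then have "(\<lambda>k. sqrt (\<integral>x. (f k x - F x)\<^sup>2 \<partial>lborel)) \<longlonglongrightarrow> sqrt 0"
    by (intro tendsto_real_sqrt) simp
  moreover have "norm (abs_l2 (f k) - abs_l2 F) = sqrt (\<integral>x. (f k x - F x)\<^sup>2 \<partial>lborel)" for k
    unfolding abs_l2_diff[OF sf sF, symmetric] by (rule norm_abs_l2[OF sq_int_diff[OF sf sF]])
  ultimately have "(\<lambda>k. norm (abs_l2 (f k) - abs_l2 F)) \<longlonglongrightarrow> 0"
    by simp
  then show "(\<lambda>k. abs_l2 (f k)) \<longlonglongrightarrow> abs_l2 F"
    by (rule LIM_zero_cancel[OF tendsto_norm_zero_cancel])
qed

lemma second_countable_of_dense:
  fixes D :: "'b::metric_space set"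
  assumes "countable D" "closure D = UNIV"
  shows "\<exists>B::'b set set. countable B \<and> open = generate_topology B"
proof -
  let ?B = "(\<lambda>(x, n). ball x (1 / Suc n)) ` (D \<times> (UNIV :: nat set))"
  have "topological_basis ?B"
  proof (rule topological_basisI)
    fix U :: "'b set" and x assume "open U" "x \<in> U"
    then obtain e where e: "e > 0" "ball x e \<subseteq> U" by (auto simp: open_contains_ball)
    then obtain n where n: "1 / real (Suc n) < e / 2"
      using nat_approx_posE[of "e/2"] by (metis half_gt_zero)
    have "x \<in> closure D" using assms by simp
    then obtain y where y: "y \<in> D" "dist y x < 1 / Suc n"
      unfolding closure_approachable by (metis divide_pos_pos of_nat_0_less_iff zero_less_Suc zero_less_one)
    have "ball y (1 / Suc n) \<subseteq> ball x e"
    proof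
      fix w assume "w \<in> ball y (1 / Suc n)"
      then have "dist x w < 1 / Suc n + 1 / Suc n"
        using y dist_triangle[of x w y] by (simp add: dist_commute)
      then show "w \<in> ball x e" using n by simp
    qed
    then show "\<exists>B'\<in>?B. x \<in> B' \<and> B' \<subseteq> U"
      using y e by (intro bexI[of _ "ball y (1 / Suc n)"]) auto
  qed auto
  moreover have "countable ?B" using assms by auto
  ultimately show ?thesis
    using topological_basis_imp_subbasis by blast
qed

instance l2 :: (euclidean_space) second_countable_topology
proof
  obtain B :: "'a set set" where B: "countable B" "topological_basis B"
    using ex_countable_basis by blast
  define G where "G = Inter ` {F. finite F \<and> F \<subseteq> B}"
  define Q where "Q n = cbox (- real n *\<^sub>R One) (real n *\<^sub>R One :: 'a)" for n :: nat
  have cG: "countable G"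
    unfolding G_def using B(1) by (intro countable_image countable_Collect_finite_subset)
  have openG: "open A" if "A \<in> G" for A
    using that topological_basis_open[OF B(2)] unfolding G_def by (auto intro!: open_Inter)
  have IntG: "Int_stable G"
    unfolding Int_stable_def G_def
  proof safe
    fix F F' assume "finite F" "F \<subseteq> B" "finite F'" "F' \<subseteq> B"
    then show "\<Inter> F \<inter> \<Inter> F' \<in> Inter ` {F. finite F \<and> F \<subseteq> B}"
      by (intro image_eqI[of _ _ "F \<union> F'"]) auto
  qed
  have UG: "UNIV \<in> G" unfolding G_def by (intro image_eqI[of _ _ "{}"]) auto
  have "B \<subseteq> G" unfolding G_def
  proof
    fix A assume "A \<in> B"
    then show "A \<in> Inter ` {F. finite F \<and> F \<subseteq> B}" by (intro image_eqI[of _ _ "{A}"]) auto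
  qed
  have setsG: "sigma_sets UNIV G = sets borel"
  proof
    show "sigma_sets UNIV G \<subseteq> sets borel"
      using sets.sigma_sets_subset[of G borel] openG by (metis borel_open space_borel subsetI)
    have "sets borel = sigma_sets UNIV B"
      by (subst borel_eq_countable_basis[OF B]) (simp add: sets_measure_of)
    also have "\<dots> \<subseteq> sigma_sets UNIV G"
      using \<open>B \<subseteq> G\<close> by (rule sigma_sets_subseteq)
    finally show "sets borel \<subseteq> sigma_sets UNIV G" .
  qed
  define ind where "ind n A = abs_l2 (indicat_real (A \<inter> Q n))" for n A
  have sqA: "sq_int (indicat_real (A \<inter> Q n))" if "A \<in> sets borel" for A n
  proof -
    have "emeasure lborel (A \<inter> Q n) \<le> emeasure lborel (Q n)"
      using that by (intro emeasure_mono) (auto simp: Q_def)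
    also have "\<dots> < \<infinity>" by (simp add: Q_def emeasure_lborel_cbox_finite)
    finally have "integrable lborel (indicat_real (A \<inter> Q n))"
      using that by (intro integrable_real_indicator) (auto simp: Q_def)
    moreover have "(\<lambda>x. (indicat_real (A \<inter> Q n) x)\<^sup>2) = indicat_real (A \<inter> Q n)"
      by (auto simp: fun_eq_iff indicator_def)
    ultimately show ?thesis
      unfolding sq_int_def using borel_measurable_integrable by (simp add: borel_measurable_integrable)
  qed
  define E where "E = (\<lambda>(n, A). ind n A) ` (UNIV \<times> G)"
  have cE: "countable E" unfolding E_def using cG by auto
  define C where "C = (\<lambda>xs. \<Sum>(q, e)\<leftarrow>xs. of_rat q *\<^sub>R e) ` lists (UNIV \<times> E)"
  have cC: "countable C"
    unfolding C_def using cE by (intro countable_image countable_lists countable_SIGMA) auto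
  have C_add: "x + y \<in> C" if xy: "x \<in> C" "y \<in> C" for x y
  proof -
    obtain xs ys where "xs \<in> lists (UNIV \<times> E)" "ys \<in> lists (UNIV \<times> E)"
        "x = (\<Sum>(q, e)\<leftarrow>xs. of_rat q *\<^sub>R e)" "y = (\<Sum>(q, e)\<leftarrow>ys. of_rat q *\<^sub>R e)"
      using xy unfolding C_def by blast
    then show ?thesis unfolding C_def by (intro image_eqI[of _ _ "xs @ ys"]) auto
  qed
  have C_scale: "of_rat p *\<^sub>R x \<in> C" if x: "x \<in> C" for x p
  proof -
    obtain xs where xs: "xs \<in> lists (UNIV \<times> E)" "x = (\<Sum>(q, e)\<leftarrow>xs. of_rat q *\<^sub>R e)"
      using x unfolding C_def by blast
    have "of_rat p *\<^sub>R (\<Sum>(q, e)\<leftarrow>xs. of_rat q *\<^sub>R e)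
        = (\<Sum>(q, e)\<leftarrow>map (\<lambda>(q, e). (p * q, e)) xs. of_rat q *\<^sub>R e)"
      by (induction xs) (auto simp: scaleR_add_right of_rat_mult)
    moreover have "map (\<lambda>(q, e). (p * q, e)) xs \<in> lists (UNIV \<times> E)"
      using xs(1) by (induction xs) auto
    ultimately show ?thesis unfolding C_def xs(2) by (metis image_eqI)
  qed
  define S where "S = closure C"
  have S_lim: "x \<in> S" if "\<And>k. y k \<in> S" "y \<longlonglongrightarrow> x" for x and y :: "nat \<Rightarrow> 'a l2"
    using that closed_sequentially[of S y x] unfolding S_def by auto
  have S_add: "x + y \<in> S" if xy: "x \<in> S" "y \<in> S" for x y
  proof -
    obtain xs ys where *: "\<And>k. xs k \<in> C" "xs \<longlonglongrightarrow> x" "\<And>k. ys k \<in> C" "ys \<longlonglongrightarrow> y"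
      using xy unfolding S_def closure_sequential by metis
    have "\<And>k. xs k + ys k \<in> S" using * C_add closure_subset unfolding S_def by blast
    then show ?thesis by (rule S_lim[OF _ tendsto_add[OF *(2) *(4)]])
  qed
  have S_scale: "c *\<^sub>R x \<in> S" if x: "x \<in> S" for c x
  proof -
    obtain xs where *: "\<And>k. xs k \<in> C" "xs \<longlonglongrightarrow> x"
      using x unfolding S_def closure_sequential by metis
    have "c \<in> closure \<rat>" using Rats_closure_real by simp
    then obtain cs where cs: "\<And>k. cs k \<in> \<rat>" "cs \<longlonglongrightarrow> c"
      unfolding closure_sequential by metis
    have "cs k *\<^sub>R xs k \<in> S" for k
      using cs(1)[of k] C_scale[OF *(1)[of k]] unfolding S_def
      by (auto elim!: Rats_cases intro!: subsetD[OF closure_subset])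
    then show ?thesis by (rule S_lim[OF _ tendsto_scaleR[OF cs(2) *(2)]])
  qed
  have E_S: "e \<in> S" if "e \<in> E" for e
  proof -
    have "e \<in> C" unfolding C_def using that by (intro image_eqI[of _ _ "[(1, e)]"]) auto
    then show ?thesis using closure_subset unfolding S_def by blast
  qed
  have ind_empty: "ind n {} = 0" for n
  proof -
    have "indicat_real ({} \<inter> Q n) = (\<lambda>_. 0)" by (auto simp: fun_eq_iff)
    then show ?thesis unfolding ind_def by (simp only: abs_l2_zero)
  qed
  have zero_S: "0 \<in> S"
  proof -
    have "0 \<in> C" unfolding C_def by (intro image_eqI[of _ _ "[]"]) auto
    then show ?thesis using closure_subset unfolding S_def by blast
  qed
  have S_sum: "(\<Sum>i\<in>I. x i) \<in> S" if "finite I" "\<And>i. i \<in> I \<Longrightarrow> x i \<in> S" for x and I :: "'i set"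
    using that by (induction I rule: finite_induct) (auto intro: zero_S S_add)
  have ind_UNIV: "ind n UNIV \<in> S" for n
    using UG by (intro E_S) (auto simp: E_def)
  have ind_S: "ind n A \<in> S" if A: "A \<in> sigma_sets UNIV G" for n A
  proof (rule sigma_sets_induct_disjoint[OF IntG _ A, where P = "\<lambda>A. ind n A \<in> S"])
    show "G \<subseteq> Pow UNIV" by simp
    show "ind n A \<in> S" if "A \<in> G" for A
      using that by (intro E_S) (auto simp: E_def)
    show "ind n {} \<in> S"
      by (simp add: ind_empty zero_S)
    show "ind n (UNIV - A) \<in> S" if "A \<in> sigma_sets UNIV G" "ind n A \<in> S" for A
    proof -
      have "indicat_real ((UNIV - A) \<inter> Q n)
          = (\<lambda>x. indicat_real (UNIV \<inter> Q n) x - indicat_real (A \<inter> Q n) x)"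
        by (auto simp: fun_eq_iff indicator_def)
      then have "ind n (UNIV - A) = ind n UNIV - ind n A"
        using abs_l2_diff[OF sqA sqA, of UNIV A n n] that(1) setsG by (simp only: ind_def) simp
      also have "\<dots> = ind n UNIV + (-1) *\<^sub>R ind n A" by simp
      finally show ?thesis
        using S_add[OF ind_UNIV S_scale[OF that(2), of "-1"], of n] by (simp only:)
    qed
    show "ind n (\<Union> (range A)) \<in> S"
      if dis: "disjoint_family A" and rA: "range A \<subseteq> sigma_sets UNIV G"
        and AS: "\<And>i. ind n (A i) \<in> S" for A :: "nat \<Rightarrow> 'a set"
    proof (rule S_lim)
      have mA: "A i \<in> sets borel" for i using rA setsG by auto
      have *: "ind n (\<Union>i<k. A i) = (\<Sum>i<k. ind n (A i))" for k
      proof (induction k)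
        case (Suc k)
        have "A k \<inter> (\<Union>i<k. A i) = {}"
          using dis unfolding disjoint_family_on_def by (fastforce dest: less_imp_neq)
        then have "indicat_real ((\<Union>i<Suc k. A i) \<inter> Q n)
            = (\<lambda>x. indicat_real ((\<Union>i<k. A i) \<inter> Q n) x + indicat_real (A k \<inter> Q n) x)"
          by (auto simp: fun_eq_iff indicator_def lessThan_Suc)
        then have "ind n (\<Union>i<Suc k. A i) = ind n (\<Union>i<k. A i) + ind n (A k)"
          using mA unfolding ind_def by (simp add: abs_l2_add[symmetric] sqA)
        then show ?case using Suc by simp
      qed (simp add: ind_empty)
      show "ind n (\<Union>i<k. A i) \<in> S" for k
        unfolding * using AS by (intro S_sum) auto
      show "(\<lambda>k. ind n (\<Union>i<k. A i)) \<longlonglongrightarrow> ind n (\<Union> (range A))"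
        unfolding ind_def
      proof (rule abs_l2_dominated_convergence(3))
        show "sq_int (indicat_real (UNIV \<inter> Q n))" by (rule sqA) simp
        fix x
        show "(\<lambda>k. indicat_real ((\<Union>i<k. A i) \<inter> Q n) x) \<longlonglongrightarrow> indicat_real (\<Union> (range A) \<inter> Q n) x"
        proof (cases "x \<in> \<Union> (range A) \<inter> Q n")
          case True
          then obtain i where "x \<in> A i" by auto
          have "eventually (\<lambda>k. indicat_real ((\<Union>i<k. A i) \<inter> Q n) x = 1) sequentially"
            using eventually_gt_at_top[of i]
            by eventually_elim (use True \<open>x \<in> A i\<close> in \<open>auto simp: indicator_def\<close>)
          then show ?thesis using True by (simp add: tendsto_eventually)
        next
          case False
          then have "indicat_real ((\<Union>i<k. A i) \<inter> Q n) x = 0" for k by (auto simp: indicator_def)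
          then show ?thesis using False by simp
        qed
      qed (use mA in \<open>auto simp: Q_def indicator_def\<close>)
    qed
  qed
  have "x \<in> S" for x
  proof -
    define f where "f = rep_l2 x"
    have f: "sq_int f" and x: "x = abs_l2 f"
      unfolding f_def by (simp_all add: sq_int_rep_l2 abs_rep_l2)
    then have fm: "f \<in> borel_measurable lborel" by blast
    obtain F where F: "\<And>i. simple_function lborel (F i)" "\<And>x. (\<lambda>i. F i x) \<longlonglongrightarrow> f x"
        "\<And>i x. dist (F i x) 0 \<le> 2 * dist (f x) 0"
      using borel_measurable_implies_sequence_metric[OF fm, of 0] by auto
    let ?g = "\<lambda>x. 2 * \<bar>f x\<bar>"
    let ?F = "\<lambda>k x. F k x * indicat_real (Q k) x"
    have g: "sq_int ?g" using f by (auto simp: sq_int_def power_mult_distrib)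
    have Fm: "F k \<in> borel_measurable lborel" for k
      using F(1) borel_measurable_simple_function by blast
    have Qm: "Q k \<in> sets borel" for k by (simp add: Q_def)
    have QI: "eventually (\<lambda>k. x \<in> Q k) sequentially" for x
    proof -
      obtain m :: nat where m: "norm x \<le> real m" using real_arch_simple by blast
      show ?thesis
        using eventually_ge_at_top[of m]
      proof eventually_elim
        case (elim k)
        have "\<bar>x \<bullet> b\<bar> \<le> real k" if "b \<in> Basis" for b
          using Basis_le_norm[OF that, of x] m elim by linarith
        then show ?case
          by (force simp: Q_def mem_box abs_le_iff)
      qed
    qed
    have Flim: "(\<lambda>k. ?F k x) \<longlonglongrightarrow> f x" for x
    proof (rule Lim_transform_eventually[OF F(2)])
      show "eventually (\<lambda>k. F k x = ?F k x) sequentially"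
        using QI[of x] by eventually_elim simp
    qed
    show ?thesis
      unfolding x
    proof (rule S_lim)
      show "(\<lambda>k. abs_l2 (?F k)) \<longlonglongrightarrow> abs_l2 f"
      proof (rule abs_l2_dominated_convergence(3)[OF _ fm g Flim])
        show "?F k \<in> borel_measurable lborel" for k
          using Fm[of k] Qm[of k] by (intro borel_measurable_times borel_measurable_indicator) auto
        show "\<bar>?F k x\<bar> \<le> 2 * \<bar>f x\<bar>" for k x
          using F(3)[of k x] by (auto simp: indicator_def)
      qed
      fix k
      have fin: "finite (range (F k))"
        using F(1)[of k] by (simp add: simple_function_def)
      have lev: "F k -` {y} \<in> sets borel" for y
        using measurable_sets[OF Fm[of k], of "{y}"] by simp
      have sqs: "sq_int (\<lambda>x. y * indicat_real (F k -` {y} \<inter> Q k) x)" for y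
        by (intro sq_int_scale sqA lev)
      have "?F k x = (\<Sum>y\<in>range (F k). y * indicat_real (F k -` {y} \<inter> Q k) x)" for x
      proof -
        have "(\<Sum>y\<in>range (F k). y * indicat_real (F k -` {y} \<inter> Q k) x)
            = (\<Sum>y\<in>range (F k). if y = F k x then ?F k x else 0)"
          by (intro sum.cong) (auto simp: indicator_def)
        then show ?thesis using fin by simp
      qed
      then have "abs_l2 (?F k)
          = abs_l2 (\<lambda>x. \<Sum>y\<in>range (F k). y * indicat_real (F k -` {y} \<inter> Q k) x)"
        by presburger
      also have "\<dots> = (\<Sum>y\<in>range (F k). abs_l2 (\<lambda>x. y * indicat_real (F k -` {y} \<inter> Q k) x))"
        by (rule abs_l2_sum[OF fin sqs])
      also have "\<dots> = (\<Sum>y\<in>range (F k). y *\<^sub>R ind k (F k -` {y}))"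
        unfolding ind_def by (intro sum.cong refl abs_l2_scale sqA lev)
      also have "\<dots> \<in> S"
        using fin lev setsG by (intro S_sum S_scale ind_S) auto
      finally show "abs_l2 (?F k) \<in> S" .
    qed
  qed
  then have "closure C = UNIV" unfolding S_def by blast
  then show "\<exists>B::'a l2 set set. countable B \<and> open = generate_topology B"
    using second_countable_of_dense[OF cC] by blast
qed

text \<open>\<open>L\<^sup>2(\<Omega>)\<close>, identified by zero extension with a subspace of \<open>L\<^sup>2(\<real>\<^sup>d)\<close>. On this subspace the
  norm and the inner product of \<^typ>\<open>'a l2\<close> are those of \<open>L\<^sup>2(\<Omega>)\<close>.\<close>

definition L2 :: "'a::euclidean_space set \<Rightarrow> 'a l2 set" where
  "L2 \<Omega> = {u. AE x in lborel. x \<notin> \<Omega> \<longrightarrow> rep_l2 u x = 0}"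


section \<open>Test functions and Lipschitz domains\<close>

definition partial_deriv :: "'a::euclidean_space \<Rightarrow> ('a \<Rightarrow> real) \<Rightarrow> 'a \<Rightarrow> real" where
  "partial_deriv b \<phi> = (\<lambda>x. frechet_derivative \<phi> (at x) b)"

definition smooth :: "('a::euclidean_space \<Rightarrow> real) \<Rightarrow> bool" where
  "smooth \<phi> \<longleftrightarrow> (\<forall>bs\<in>lists Basis. \<forall>x. foldr partial_deriv bs \<phi> differentiable (at x))"

definition test_functions :: "'a::euclidean_space set \<Rightarrow> ('a \<Rightarrow> real) set" where
  "test_functions \<Omega> = {\<phi>. smooth \<phi> \<and> compact (closure {x. \<phi> x \<noteq> 0}) \<and> closure {x. \<phi> x \<noteq> 0} \<subseteq> \<Omega>}"

text \<open>Near every boundary point, \<open>\<Omega>\<close> is the part of a ball lying above the graph of a Lipschitz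
  function \<open>\<gamma>\<close> over the hyperplane orthogonal to the unit vector \<open>e\<close>.\<close>

definition lipschitz_boundary :: "'a::euclidean_space set \<Rightarrow> bool" where
  "lipschitz_boundary \<Omega> \<longleftrightarrow>
    (\<forall>p\<in>frontier \<Omega>. \<exists>\<rho>>0. \<exists>e. norm e = 1 \<and>
      (\<exists>L \<gamma>. L-lipschitz_on {y. y \<bullet> e = 0} \<gamma> \<and>
        \<Omega> \<inter> ball p \<rho> = {x \<in> ball p \<rho>. \<gamma> (x - (x \<bullet> e) *\<^sub>R e) < x \<bullet> e}))"

definition lipschitz_domain :: "'a::euclidean_space set \<Rightarrow> bool" where
  "lipschitz_domain \<Omega> \<longleftrightarrow>
    open \<Omega> \<and> connected \<Omega> \<and> \<Omega> \<noteq> {} \<and> bounded \<Omega> \<and> lipschitz_boundary \<Omega>"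


section \<open>Sobolev spaces in the space variable\<close>

definition weak_partial_deriv :: "'a::euclidean_space set \<Rightarrow> 'a \<Rightarrow> 'a l2 \<Rightarrow> 'a l2 \<Rightarrow> bool" where
  "weak_partial_deriv \<Omega> b u g \<longleftrightarrow> u \<in> L2 \<Omega> \<and> g \<in> L2 \<Omega> \<and>
    (\<forall>\<phi>\<in>test_functions \<Omega>.
      (LINT x:\<Omega>|lborel. rep_l2 u x * partial_deriv b \<phi> x) = - (LINT x:\<Omega>|lborel. rep_l2 g x * \<phi> x))"

definition weak_grad :: "'a::euclidean_space set \<Rightarrow> 'a \<Rightarrow> 'a l2 \<Rightarrow> 'a l2" where
  "weak_grad \<Omega> b u = (THE g. weak_partial_deriv \<Omega> b u g)"

definition H1 :: "'a::euclidean_space set \<Rightarrow> 'a l2 set" where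
  "H1 \<Omega> = {u \<in> L2 \<Omega>. \<forall>b\<in>Basis. \<exists>g. weak_partial_deriv \<Omega> b u g}"

definition grad_inner :: "'a::euclidean_space set \<Rightarrow> 'a l2 \<Rightarrow> 'a l2 \<Rightarrow> real" where
  "grad_inner \<Omega> u v = (\<Sum>b\<in>Basis. weak_grad \<Omega> b u \<bullet> weak_grad \<Omega> b v)"

definition grad_norm :: "'a::euclidean_space set \<Rightarrow> 'a l2 \<Rightarrow> real" where
  "grad_norm \<Omega> u = sqrt (grad_inner \<Omega> u u)"

definition H1_norm :: "'a::euclidean_space set \<Rightarrow> 'a l2 \<Rightarrow> real" where
  "H1_norm \<Omega> u = sqrt ((norm u)\<^sup>2 + (grad_norm \<Omega> u)\<^sup>2)"

definition H10 :: "'a::euclidean_space set \<Rightarrow> 'a l2 set" where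
  "H10 \<Omega> = {u \<in> H1 \<Omega>. \<exists>\<phi>. (\<forall>k. \<phi> k \<in> test_functions \<Omega>) \<and>
                        (\<lambda>k::nat. H1_norm \<Omega> (u - abs_l2 (\<phi> k))) \<longlonglongrightarrow> 0}"

definition weak_laplacian :: "'a::euclidean_space set \<Rightarrow> 'a l2 \<Rightarrow> 'a l2 \<Rightarrow> bool" where
  "weak_laplacian \<Omega> u g \<longleftrightarrow> u \<in> L2 \<Omega> \<and> g \<in> L2 \<Omega> \<and>
    (\<forall>\<phi>\<in>test_functions \<Omega>.
      (LINT x:\<Omega>|lborel. rep_l2 u x * (\<Sum>b\<in>Basis. partial_deriv b (partial_deriv b \<phi>) x))
        = (LINT x:\<Omega>|lborel. rep_l2 g x * \<phi> x))"


section \<open>Sobolev spaces in the time variable\<close>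

definition L2_time :: "real \<Rightarrow> 'a::euclidean_space l2 set \<Rightarrow> (real \<Rightarrow> 'a l2) \<Rightarrow> bool" where
  "L2_time T V w \<longleftrightarrow> set_borel_measurable lborel {0<..<T} w \<and>
    (AE t in lborel. t \<in> {0<..<T} \<longrightarrow> w t \<in> V) \<and>
    set_integrable lborel {0<..<T} (\<lambda>t. (norm (w t))\<^sup>2)"

definition L2_time_norm :: "real \<Rightarrow> (real \<Rightarrow> 'a::euclidean_space l2) \<Rightarrow> real" where
  "L2_time_norm T w = sqrt (LINT t:{0<..<T}|lborel. (norm (w t))\<^sup>2)"

definition weak_time_deriv ::
    "real \<Rightarrow> (real \<Rightarrow> 'a::euclidean_space l2) \<Rightarrow> (real \<Rightarrow> 'a l2) \<Rightarrow> bool" where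
  "weak_time_deriv T w g \<longleftrightarrow>
    (\<forall>\<psi>\<in>test_functions {0<..<T}.
      (LINT t:{0<..<T}|lborel. deriv \<psi> t *\<^sub>R w t) = - (LINT t:{0<..<T}|lborel. \<psi> t *\<^sub>R g t))"

text \<open>\<open>w \<in> H\<^sup>k(0,T;V)\<close> with weak time derivatives \<open>w = d 0, d 1, \<dots>, d k\<close>, where \<open>d j\<close> for \<open>j < k\<close>
  is the continuous representative on \<open>[0,T]\<close>, so that its point values are meaningful.
  Only the class modulo null sets of \<open>d k\<close> is determined.\<close>

definition H_time ::
    "nat \<Rightarrow> real \<Rightarrow> 'a::euclidean_space l2 set \<Rightarrow> (real \<Rightarrow> 'a l2) \<Rightarrow> (nat \<Rightarrow> real \<Rightarrow> 'a l2) \<Rightarrow> bool"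
where
  "H_time k T V w d \<longleftrightarrow> d 0 = w \<and>
    (\<forall>j\<le>k. L2_time T V (d j)) \<and>
    (\<forall>j<k. continuous_on {0..T} (d j) \<and> weak_time_deriv T (d j) (d (Suc j)))"


section \<open>The heat equation\<close>

text \<open>The equation is required at every time of \<open>[0,T]\<close>; \<open>ut\<close> stands for the continuous
  representative of the weak time derivative of \<open>u\<close>.\<close>

definition heat_weak_solution ::
  "'a::euclidean_space set \<Rightarrow> real \<Rightarrow> real \<Rightarrow> (real \<Rightarrow> 'a l2) \<Rightarrow> (real \<Rightarrow> 'a l2) \<Rightarrow> (real \<Rightarrow> 'a l2) \<Rightarrow> bool"
where
  "heat_weak_solution \<Omega> \<nu> T f u ut \<longleftrightarrow>
    (\<forall>t\<in>{0..T}. u t \<in> H10 \<Omega> \<and>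
      (\<forall>v\<in>H10 \<Omega>. ut t \<bullet> v + \<nu> * grad_inner \<Omega> (u t) v = f t \<bullet> v))"


text \<open>\<open>I(u,f)\<close>; the arguments are \<open>u\<^sub>t\<^sub>t\<^sub>t\<close>, \<open>\<Delta>u\<^sub>t\<^sub>t\<close> and \<open>f\<^sub>t\<^sub>t\<close>.\<close>

definition data_functional ::
  "real \<Rightarrow> (real \<Rightarrow> 'a::euclidean_space l2) \<Rightarrow> (real \<Rightarrow> 'a l2) \<Rightarrow> (real \<Rightarrow> 'a l2) \<Rightarrow> real"
where
  "data_functional T uttt Lutt ftt =
    (L2_time_norm T uttt)\<^sup>2 + (L2_time_norm T Lutt)\<^sup>2 + (L2_time_norm T ftt)\<^sup>2"


section \<open>Proper orthogonal decomposition with difference quotients\<close>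

definition time_grid :: "real \<Rightarrow> nat \<Rightarrow> nat \<Rightarrow> real" where
  "time_grid T N n = real n * (T / real N)"

definition dq_snapshots :: "real \<Rightarrow> nat \<Rightarrow> (real \<Rightarrow> 'b::real_vector) \<Rightarrow> nat \<Rightarrow> 'b" where
  "dq_snapshots T N u m =
    (if m \<le> N then u (time_grid T N m)
     else (u (time_grid T N (m - N)) - u (time_grid T N (m - N - 1))) /\<^sub>R (T / real N))"

text \<open>\<open>ip\<close> is the inner product of the Hilbert space in which the modes are computed.\<close>

definition pod_matrix ::
    "real \<Rightarrow> nat \<Rightarrow> ('b \<Rightarrow> 'b \<Rightarrow> real) \<Rightarrow> (real \<Rightarrow> 'b::real_vector) \<Rightarrow> nat \<Rightarrow> nat \<Rightarrow> real" where
  "pod_matrix T N ip u m n = ip (dq_snapshots T N u m) (dq_snapshots T N u n) / real (2 * N + 1)"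

text \<open>Rows and columns of \<open>K\<close> are indexed by \<open>0, \<dots>, M - 1\<close>, eigenpairs by \<open>1, \<dots>, M\<close>; the entry
  \<open>z i m\<close> is the \<open>m\<close>-th component of the \<open>i\<close>-th eigenvector.\<close>

definition ordered_eigensystem ::
    "nat \<Rightarrow> (nat \<Rightarrow> nat \<Rightarrow> real) \<Rightarrow> (nat \<Rightarrow> real) \<Rightarrow> (nat \<Rightarrow> nat \<Rightarrow> real) \<Rightarrow> bool" where
  "ordered_eigensystem M K lam z \<longleftrightarrow>
    (\<forall>i\<in>{1..M}. \<forall>m<M. (\<Sum>n<M. K m n * z i n) = lam i * z i m) \<and>
    (\<forall>i\<in>{1..M}. \<forall>j\<in>{1..M}. (\<Sum>m<M. z i m * z j m) = (if i = j then 1 else 0)) \<and>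
    (\<forall>i\<in>{1..M}. 0 \<le> lam i) \<and>
    (\<forall>i\<in>{1..M}. \<forall>j\<in>{1..M}. i \<le> j \<longrightarrow> lam j \<le> lam i)"

definition num_positive :: "nat \<Rightarrow> (nat \<Rightarrow> real) \<Rightarrow> nat" where
  "num_positive M lam = card {i\<in>{1..M}. 0 < lam i}"

definition pod_mode ::
    "real \<Rightarrow> nat \<Rightarrow> (real \<Rightarrow> 'b::real_vector) \<Rightarrow> (nat \<Rightarrow> real) \<Rightarrow> (nat \<Rightarrow> nat \<Rightarrow> real) \<Rightarrow> nat \<Rightarrow> 'b" where
  "pod_mode T N u lam z i =
    (1 / sqrt (lam i)) *\<^sub>R (1 / sqrt (real (2 * N + 1))) *\<^sub>R
      (\<Sum>m\<le>2 * N. z i m *\<^sub>R dq_snapshots T N u m)"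

definition pod_space ::
    "real \<Rightarrow> nat \<Rightarrow> (real \<Rightarrow> 'b::real_vector) \<Rightarrow> (nat \<Rightarrow> real) \<Rightarrow> (nat \<Rightarrow> nat \<Rightarrow> real) \<Rightarrow> nat \<Rightarrow> 'b set" where
  "pod_space T N u lam z r = span (pod_mode T N u lam z ` {1..r})"

definition is_ritz_projection ::
    "'a::euclidean_space set \<Rightarrow> 'a l2 set \<Rightarrow> ('a l2 \<Rightarrow> 'a l2) \<Rightarrow> bool" where
  "is_ritz_projection \<Omega> Xr R \<longleftrightarrow>
    (\<forall>w\<in>H10 \<Omega>. R w \<in> Xr \<and> (\<forall>v\<in>Xr. grad_inner \<Omega> (w - R w) v = 0))"

definition cn_pod_g_rom ::
    "'a::euclidean_space set \<Rightarrow> real \<Rightarrow> real \<Rightarrow> nat \<Rightarrow> (real \<Rightarrow> 'a l2) \<Rightarrow> 'a l2 set \<Rightarrow> (nat \<Rightarrow> 'a l2) \<Rightarrow> bool"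
where
  "cn_pod_g_rom \<Omega> \<nu> T N f Xr ur \<longleftrightarrow>
    (\<forall>n\<le>N. ur n \<in> Xr) \<and>
    (\<forall>n<N. \<forall>v\<in>Xr.
      ((ur (n + 1) - ur n) /\<^sub>R (T / real N)) \<bullet> v
      + \<nu> * grad_inner \<Omega> ((1 / 2) *\<^sub>R (ur (n + 1) + ur n)) v
      = ((1 / 2) *\<^sub>R (f (time_grid T N (n + 1)) + f (time_grid T N n))) \<bullet> v)"

end

theory Submission
  imports Defs
begin

text \<open>
  Write \<open>e\<^sup>k = \<eta>\<^sup>k - \<phi>\<^sub>r\<^sup>k\<close> with the Ritz projection error \<open>\<eta>\<^sup>k = u\<^sup>k - R\<^sub>r(u\<^sup>k)\<close> and
  \<open>\<phi>\<^sub>r\<^sup>k = u\<^sub>r\<^sup>k - R\<^sub>r(u\<^sup>k)\<close> in \<open>X\<^sup>r\<close>. Averaging the heat equation at two consecutive grid points makes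
  \<open>f\<close> and \<open>\<Delta>u\<close> drop out exactly, so \<open>\<phi>\<^sub>r\<close> solves the Crank-Nicolson scheme whose right-hand side is
  the trapezoidal error \<open>u\<^sub>t\<^sup>n\<^sup>+\<^sup>1\<^sup>/\<^sup>2 - \<partial>u\<^sup>n\<^sup>+\<^sup>1\<close> plus \<open>\<partial>\<eta>\<^sup>n\<^sup>+\<^sup>1\<close>. Testing with \<open>\<partial>\<phi>\<^sub>r\<^sup>n\<^sup>+\<^sup>1\<close> bounds
  \<open>\<nabla>\<phi>\<^sub>r\<^sup>k\<close> by the initial value and the \<open>L\<^sup>2\<close> norms of the right-hand sides. The trapezoidal errors are of
  order \<open>\<Delta>t\<^sup>2\<close> in terms of \<open>u\<^sub>t\<^sub>t\<^sub>t\<close>, and the \<open>\<partial>\<eta>\<^sup>n\<close> are projection errors of snapshots, whose mean square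
  is the POD tail because the eigenvectors are orthonormal. Since the difference quotients are
  snapshots too, the mean square over the snapshots also controls every single \<open>\<nabla>\<eta>\<^sup>k\<close>. The Poincare
  inequality enters only through the uniqueness, hence linearity, of \<open>R\<^sub>r\<close>.
\<close>


text \<open>One bound serves both bases. Its tail uses only that the eigenvectors \<open>z i\<close>
  are orthonormal in Euclidean space, so projection errors can be measured in
  \<open>L\<^sup>2\<close> and in the gradient norm whatever inner product produced the modes. For
  the \<open>H10\<close> basis the modes beyond r are orthogonal to the reduced space, so each is
  its own Ritz error with gradient norm 1, whence the summand 1 + norm^2. Testing with the
  difference quotient leaves neither a Gronwall factor nor a Poincare constant: the final constant
  depends on T and \<nu> alone.

  Much of the work gives content to the weak notions. \<open>weak_grad\<close> is a definite
  description and time derivatives are known only against test functions, so both need explicit test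
  functions: products of functions exp(-1/t) that approximate indicators of boxes. In space they
  show that only 0 is orthogonal to all test functions; in time they turn a weak derivative into
  differences of point values, from which the Taylor estimates follow.\<close>

section \<open>Completeness of \<open>L\<^sup>2\<close>\<close>

lemma abs_l2_eqI:
  assumes "sq_int f" "g \<in> borel_measurable lborel" "AE x in lborel. f x = g x"
  shows "sq_int g" "abs_l2 f = abs_l2 g"
proof -
  have "integrable lborel (\<lambda>x. (f x)\<^sup>2) = integrable lborel (\<lambda>x. (g x)\<^sup>2)"
    by (rule integrable_cong_AE) (use assms in \<open>auto simp: sq_int_def\<close>)
  then show g: "sq_int g" using assms by (simp add: sq_int_def)
  show "abs_l2 f = abs_l2 g"
    by (rule Quotient3_rel_abs[OF Quotient3_l2]) (simp add: l2_rel_def assms g)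
qed

lemma rep_abs_l2: "sq_int f \<Longrightarrow> AE x in lborel. rep_l2 (abs_l2 f) x = f x"
  using rep_abs_rsp[OF Quotient3_l2, of f f] by (auto simp: l2_rel_def)

lemma sq_int_abs: "sq_int f \<Longrightarrow> sq_int (\<lambda>x. \<bar>f x\<bar>)"
  by (auto simp: sq_int_def intro: borel_measurable_abs)

lemma sq_int_sum: "(\<And>i. i \<in> I \<Longrightarrow> sq_int (h i)) \<Longrightarrow> sq_int (\<lambda>x. \<Sum>i\<in>I. h i x)"
  by (induction I rule: infinite_finite_induct) (auto intro: sq_int_add)

text \<open>Completeness lets integrability of \<open>l2\<close>-valued functions of time be proved
  by domination. A subsequence with increments of norm at most (1/2)^k has an increment series whose
  absolute sum is square integrable by monotone convergence. The subsequence then converges almost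
  everywhere under a square integrable majorant, hence in \<open>l2\<close>.\<close>

instance l2 :: (euclidean_space) banach
proof
  fix X :: "nat \<Rightarrow> 'a l2"
  assume X: "Cauchy X"
  have "\<forall>k. \<exists>M. \<forall>m\<ge>M. \<forall>n\<ge>M. norm (X m - X n) < (1/2)^k"
    using X unfolding Cauchy_iff by simp
  then obtain M where M: "\<And>k m n. M k \<le> m \<Longrightarrow> M k \<le> n \<Longrightarrow> norm (X m - X n) < (1/2)^k"
    by metis
  define r where "r = rec_nat (M 0) (\<lambda>k m. max (Suc m) (M (Suc k)))"
  have r_Suc: "r (Suc k) = max (Suc (r k)) (M (Suc k))" for k by (simp add: r_def)
  have "strict_mono r" by (simp add: strict_mono_Suc_iff r_Suc less_max_iff_disj)
  have Mr: "M k \<le> r k" for k by (cases k) (simp_all add: r_Suc, simp add: r_def)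
  have step: "norm (X (r (Suc k)) - X (r k)) \<le> (1/2)^k" for k
    using M[of k "r (Suc k)" "r k"] Mr[of k] by (simp add: r_Suc less_imp_le)
  define f where "f k = rep_l2 (X (r k))" for k
  have f: "sq_int (f k)" for k by (simp add: f_def sq_int_rep_l2)
  have [measurable]: "f k \<in> borel_measurable borel" for k using f[of k] by (auto simp: sq_int_def)
  have Xf: "X (r k) = abs_l2 (f k)" for k by (simp add: f_def abs_rep_l2)
  define d where "d k x = \<bar>f (Suc k) x - f k x\<bar>" for k x
  have [measurable]: "d k \<in> borel_measurable borel" for k unfolding d_def by simp
  have d: "sq_int (d k)" for k unfolding d_def by (intro sq_int_abs sq_int_diff f)
  have nd: "norm (abs_l2 (d k)) \<le> (1/2)^k" for k
    using step[of k] norm_abs_l2[OF d[of k]] norm_abs_l2[OF sq_int_diff[OF f[of "Suc k"] f[of k]]]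
    by (simp add: d_def Xf abs_l2_diff[OF f f])
  define D where "D n x = (\<Sum>k<n. d k x)" for n x
  have D: "sq_int (D n)" for n unfolding D_def by (intro sq_int_sum d)
  have [measurable]: "D k \<in> borel_measurable borel" for k unfolding D_def by simp
  have D_nonneg: "0 \<le> D n x" for n x by (simp add: D_def d_def sum_nonneg)
  have D_mono: "D m x \<le> D n x" if "m \<le> n" for m n x
    unfolding D_def using that by (intro sum_mono2) (auto simp: d_def)
  have "abs_l2 (D n) = (\<Sum>k<n. abs_l2 (d k))" for n
    unfolding D_def by (rule abs_l2_sum) (auto intro: d)
  then have "norm (abs_l2 (D n)) \<le> (\<Sum>k<n. (1/2)^k)" for n
    by (auto intro!: sum_norm_le nd)
  also have "(\<Sum>k<n. (1/2)^k) \<le> (2::real)" for n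
    by (simp add: geometric_sum)
  finally have "sqrt (\<integral>x. (D n x)\<^sup>2 \<partial>lborel) \<le> 2" for n
    by (simp add: norm_abs_l2[OF D])
  then have D4: "(\<integral>x. (D n x)\<^sup>2 \<partial>lborel) \<le> 4" for n
    using real_sqrt_le_iff[of _ 4] by simp
  have D4': "(\<integral>\<^sup>+x. ennreal ((D n x)\<^sup>2) \<partial>lborel) \<le> 4" for n
    using D4[of n] D[of n] by (subst nn_integral_eq_integral) (auto simp: sq_int_def simp flip: ennreal_numeral)
  have "(\<integral>\<^sup>+x. (SUP n. ennreal ((D n x)\<^sup>2)) \<partial>lborel) = (SUP n. \<integral>\<^sup>+x. ennreal ((D n x)\<^sup>2) \<partial>lborel)"
    by (intro nn_integral_monotone_convergence_SUP)
       (auto simp: incseq_def le_fun_def intro!: ennreal_leI power_mono D_nonneg D_mono)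
  also have "\<dots> \<le> 4" by (intro SUP_least D4')
  finally have S4: "(\<integral>\<^sup>+x. (SUP n. ennreal ((D n x)\<^sup>2)) \<partial>lborel) \<le> 4" .
  then have fin: "AE x in lborel. (SUP n. ennreal ((D n x)\<^sup>2)) \<noteq> \<infinity>"
    by (intro nn_integral_PInf_AE) (auto simp: top_unique)
  \<comment> \<open>The points where the absolute increments have bounded partial sums; the
    complement is a null set because the supremum has integral at most 4 = 2^2.\<close>
  define S where "S = {x. (SUP n. ennreal ((D n x)\<^sup>2)) < \<infinity>}"
  have [measurable]: "S \<in> sets borel" unfolding S_def by measurable
  have AES: "AE x in lborel. x \<in> S" using fin by eventually_elim (simp only: S_def mem_Collect_eq infinity_ennreal_def less_top)
  have S_summable: "summable (\<lambda>k. d k x)" if "x \<in> S" for x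
  proof -
    obtain c where c: "(SUP n. ennreal ((D n x)\<^sup>2)) = ennreal c" "0 \<le> c"
      using \<open>x \<in> S\<close> unfolding S_def by (cases "SUP n. ennreal ((D n x)\<^sup>2)") auto
    have "ennreal ((D n x)\<^sup>2) \<le> ennreal c" for n
      using c(1) SUP_upper[of n UNIV "\<lambda>n. ennreal ((D n x)\<^sup>2)"] by simp
    then have "(D n x)\<^sup>2 \<le> c" for n using c(2) by (simp add: ennreal_le_iff)
    then have "D n x \<le> sqrt c" for n by (rule real_le_rsqrt)
    then show ?thesis
      unfolding D_def
      by (intro bounded_imp_summable[of _ "sqrt c"])
         (auto simp: d_def lessThan_Suc_atMost[symmetric] simp del: sum.lessThan_Suc)
  qed
  \<comment> \<open>\<open>abs_l2_dominated_convergence\<close> asks for convergence and domination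
    at every point, so the functions are set to 0 outside \<open>S\<close>; for \<open>f' k\<close>
    this leaves the class unchanged.\<close>
  define g where "g x = (if x \<in> S then \<Sum>k. d k x else 0)" for x
  define f' where "f' k x = (if x \<in> S then f k x else 0)" for k x
  define F where "F x = (if x \<in> S then f 0 x + (\<Sum>k. f (Suc k) x - f k x) else 0)" for x
  have [measurable]: "g \<in> borel_measurable borel" "F \<in> borel_measurable borel"
      "f' k \<in> borel_measurable borel" for k
    unfolding g_def F_def f'_def by measurable
  have Dg: "(\<lambda>n. D n x) \<longlonglongrightarrow> g x" "D n x \<le> g x" if "x \<in> S" for x n
    using S_summable[OF that] that unfolding D_def g_def
    by (auto intro!: summable_LIMSEQ sum_le_suminf simp: d_def)
  have g0: "0 \<le> g x" for x using Dg(2)[of x 0] by (cases "x \<in> S") (auto simp: D_def g_def)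
  have g2: "ennreal ((g x)\<^sup>2) \<le> (SUP n. ennreal ((D n x)\<^sup>2))" for x
  proof (cases "x \<in> S")
    case True
    have "(\<lambda>n. ennreal ((D n x)\<^sup>2)) \<longlonglongrightarrow> ennreal ((g x)\<^sup>2)"
      by (intro tendsto_intros Dg True)
    then show ?thesis by (rule LIMSEQ_le_const2) (intro exI allI impI SUP_upper UNIV_I)
  qed (simp add: g_def)
  have g: "sq_int g"
    unfolding sq_int_def
  proof
    have "(\<integral>\<^sup>+x. ennreal ((g x)\<^sup>2) \<partial>lborel) \<le> 4"
      by (rule order_trans[OF nn_integral_mono S4]) (rule g2)
    then show "integrable lborel (\<lambda>x. (g x)\<^sup>2)"
      by (intro integrableI_bounded) (auto simp: le_less_trans)
  qed simp
  have tel: "(\<Sum>k<n. f (Suc k) x - f k x) = f n x - f 0 x" for n x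
    using sum_lessThan_telescope[of "\<lambda>k. f k x" n] by simp
  have lim: "(\<lambda>k. f' k x) \<longlonglongrightarrow> F x" for x
  proof (cases "x \<in> S")
    case True
    then have "summable (\<lambda>k. f (Suc k) x - f k x)"
      using S_summable unfolding d_def by (auto intro: summable_rabs_cancel)
    then have "(\<lambda>n. f 0 x + (f n x - f 0 x)) \<longlonglongrightarrow> f 0 x + (\<Sum>k. f (Suc k) x - f k x)"
      unfolding tel[symmetric] by (intro tendsto_intros summable_LIMSEQ)
    then show ?thesis using True by (simp add: f'_def F_def)
  qed (simp add: f'_def F_def)
  have bound: "\<bar>f' k x\<bar> \<le> \<bar>f 0 x\<bar> + g x" for k x
  proof (cases "x \<in> S")
    case True
    have "\<bar>f k x - f 0 x\<bar> \<le> D k x"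
      unfolding tel[symmetric] D_def d_def by (rule sum_abs)
    then show ?thesis using Dg(2)[OF True, of k] True by (simp add: f'_def)
  qed (simp add: f'_def g0)
  have "(\<lambda>k. abs_l2 (f' k)) \<longlonglongrightarrow> abs_l2 F"
    by (rule abs_l2_dominated_convergence(3)[where g="\<lambda>x. \<bar>f 0 x\<bar> + g x"])
       (auto intro!: sq_int_add sq_int_abs f g lim bound)
  moreover have "abs_l2 (f' k) = X (r k)" for k
    unfolding Xf by (rule abs_l2_eqI(2)[symmetric, OF f]) (use AES in \<open>auto simp: f'_def\<close>)
  ultimately have "(X \<circ> r) \<longlonglongrightarrow> abs_l2 F" by (simp add: o_def)
  then have "X \<longlonglongrightarrow> abs_l2 F"
    using Cauchy_converges_subseq[OF X \<open>strict_mono r\<close>] by blast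
  then show "convergent X" by (rule convergentI)
qed


section \<open>Smooth approximations of boxes\<close>

text \<open>With s = 1/t this is p(s) exp(-s), extended by 0. Admitting all polynomials closes the
  family under differentiation, which gives smoothness of every order without a formula for higher
  derivatives.\<close>

definition flat_exp :: "real poly \<Rightarrow> real \<Rightarrow> real" where
  "flat_exp p t = (if 0 < t then poly p (1 / t) * exp (- (1 / t)) else 0)"

lemma poly_times_exp_minus_tendsto_0: "((\<lambda>x::real. poly p x * exp (- x)) \<longlongrightarrow> 0) at_top"
proof -
  have "((\<lambda>x. \<Sum>i\<le>degree p. coeff p i * (x ^ i / exp x)) \<longlongrightarrow> (\<Sum>i\<le>degree p. coeff p i * 0)) at_top"
    by (intro tendsto_intros tendsto_power_div_exp_0)
  moreover have "(\<Sum>i\<le>degree p. coeff p i * (x ^ i / exp x)) = poly p x * exp (- x)" for x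
    by (simp add: poly_altdef exp_minus divide_inverse sum_distrib_right mult.assoc)
  ultimately show ?thesis by simp
qed

text \<open>With s = 1/t one has ds/dt = - s^2, so the derivative of p(s) exp(-s) is s^2 (p - p')(s)
  exp(-s), and \<open>[:0, 0, 1:]\<close> is the polynomial s^2. At 0 the quotient from the right is
  s p(s) exp(-s), which tends to 0 as s grows.\<close>

lemma DERIV_flat_exp:
  "(flat_exp p has_real_derivative flat_exp ([:0, 0, 1:] * (p - pderiv p)) t) (at t)"
proof -
  consider "t < 0" | "t = 0" | "t > 0" by linarith
  then show ?thesis
  proof cases
    case 1
    have "((\<lambda>_. 0) has_real_derivative flat_exp ([:0, 0, 1:] * (p - pderiv p)) t) (at t)"
      using 1 by (simp add: flat_exp_def)
    then show ?thesis
      by (rule has_field_derivative_transform_within_open[of _ _ _ "{..<0}"])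
        (use 1 in \<open>auto simp: flat_exp_def\<close>)
  next
    case 3
    have i: "((\<lambda>t. 1 / t) has_real_derivative - (1 / t\<^sup>2)) (at t)"
      using 3 by (auto intro!: derivative_eq_intros simp: power2_eq_square)
    have "flat_exp ([:0, 0, 1:] * (p - pderiv p)) t
        = poly (pderiv p) (1 / t) * - (1 / t\<^sup>2) * exp (- (1 / t))
          + exp (- (1 / t)) * - (- (1 / t\<^sup>2)) * poly p (1 / t)"
      using 3 by (simp add: flat_exp_def power2_eq_square left_diff_distrib right_diff_distrib)
    then have "((\<lambda>t. poly p (1 / t) * exp (- (1 / t))) has_real_derivative
        flat_exp ([:0, 0, 1:] * (p - pderiv p)) t) (at t)"
      using DERIV_mult[OF DERIV_chain2[OF poly_DERIV i] DERIV_chain2[OF DERIV_exp DERIV_minus[OF i]]]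
      by simp
    then show ?thesis
      by (rule has_field_derivative_transform_within_open[of _ _ _ "{0<..}"])
        (use 3 in \<open>auto simp: flat_exp_def\<close>)
  next
    case 2
    have "((\<lambda>t. poly [:0, 1:] (1/t) * (poly p (1/t) * exp (- (1/t)))) \<longlongrightarrow> 0) (at_right 0)"
      using filterlim_compose[OF poly_times_exp_minus_tendsto_0[of "[:0, 1:] * p"] filterlim_inverse_at_top_right]
      by (simp add: inverse_eq_divide mult.assoc)
    then have "((\<lambda>t. (flat_exp p t - flat_exp p 0) / (t - 0)) \<longlongrightarrow> 0) (at_right 0)"
      by (rule Lim_transform_eventually)
         (use eventually_at_right_less in eventually_elim, simp add: flat_exp_def)
    moreover have "((\<lambda>t. (flat_exp p t - flat_exp p 0) / (t - 0)) \<longlongrightarrow> 0) (at_left 0)"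
      by (rule Lim_transform_eventually[OF tendsto_const])
         (simp add: flat_exp_def eventually_at_filter)
    ultimately have "((\<lambda>t. (flat_exp p t - flat_exp p 0) / (t - 0)) \<longlongrightarrow> 0) (at 0)"
      by (simp add: filterlim_split_at)
    then show ?thesis using 2 by (simp add: has_field_derivative_iff flat_exp_def)
  qed
qed

text \<open>Closed under partial derivatives, so that membership gives smoothness of the bumps below.\<close>

inductive flat_combination :: "('a::euclidean_space \<Rightarrow> real) \<Rightarrow> bool" where
  flat_exp: "flat_combination (\<lambda>x. flat_exp p (c * (x \<bullet> b) + d))"
| const: "flat_combination (\<lambda>x. c)"
| add: "flat_combination f \<Longrightarrow> flat_combination g \<Longrightarrow> flat_combination (\<lambda>x. f x + g x)"
| mult: "flat_combination f \<Longrightarrow> flat_combination g \<Longrightarrow> flat_combination (\<lambda>x. f x * g x)"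

lemma partial_deriv_eq: "(f has_derivative D) (at x) \<Longrightarrow> partial_deriv b f x = D b"
  using frechet_derivative_at[of f D x] by (simp add: partial_deriv_def)

lemma partial_deriv_linear:
  assumes "f differentiable at x" "g differentiable at x"
  shows "partial_deriv b (\<lambda>x. c * f x + g x) x = c * partial_deriv b f x + partial_deriv b g x"
proof -
  have "((\<lambda>x. c * f x + g x) has_derivative
      (\<lambda>v. c * frechet_derivative f (at x) v + frechet_derivative g (at x) v)) (at x)"
    using assms by (intro has_derivative_add has_derivative_mult_right) (auto simp: frechet_derivative_works)
  from partial_deriv_eq[OF this] show ?thesis by (simp add: partial_deriv_def)
qed

lemma partial_deriv_mult:
  assumes "f differentiable at x" "g differentiable at x"
  shows "partial_deriv b (\<lambda>x. f x * g x) x = f x * partial_deriv b g x + partial_deriv b f x * g x"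
proof -
  have "((\<lambda>x. f x * g x) has_derivative
      (\<lambda>v. f x * frechet_derivative g (at x) v + frechet_derivative f (at x) v * g x)) (at x)"
    using assms by (intro has_derivative_mult) (auto simp: frechet_derivative_works)
  from partial_deriv_eq[OF this] show ?thesis by (simp add: partial_deriv_def)
qed

lemma flat_combination_deriv:
  assumes "flat_combination f"
  shows "(\<forall>x. f differentiable at x) \<and> (\<forall>v. flat_combination (partial_deriv v f))"
  using assms
proof induction
  case (flat_exp p c b d)
  have "((\<lambda>x. flat_exp p (c * (x \<bullet> b) + d)) has_derivative
      (\<lambda>v. flat_exp ([:0, 0, 1:] * (p - pderiv p)) (c * (x \<bullet> b) + d) * (c * (v \<bullet> b)))) (at x)" for x :: 'a
    by (rule has_derivative_compose[OF _ DERIV_flat_exp[unfolded has_field_derivative_def]])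
       (auto intro!: derivative_eq_intros)
  note D = this
  have "partial_deriv v (\<lambda>x. flat_exp p (c * (x \<bullet> b) + d))
      = (\<lambda>x. flat_exp ([:0, 0, 1:] * (p - pderiv p)) (c * (x \<bullet> b) + d) * (c * (v \<bullet> b)))" for v :: 'a
    by (rule ext) (rule partial_deriv_eq[OF D])
  then show ?case
    using D by (auto simp: differentiable_def intro: flat_combination.intros)
next
  case (const c)
  have "partial_deriv v (\<lambda>x. c) = (\<lambda>x. 0)" for v :: 'a
    by (rule ext) (rule partial_deriv_eq[of _ "\<lambda>_. 0"], simp)
  then show ?case by (auto intro: flat_combination.intros)
next
  case (add f g)
  then have "partial_deriv v (\<lambda>x. f x + g x) = (\<lambda>x. partial_deriv v f x + partial_deriv v g x)" for v
    using partial_deriv_linear[of f _ g v 1] by auto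
  then show ?case using add by (auto intro: flat_combination.intros)
next
  case (mult f g)
  then have "partial_deriv v (\<lambda>x. f x * g x)
      = (\<lambda>x. f x * partial_deriv v g x + partial_deriv v f x * g x)" for v
    by (intro ext partial_deriv_mult) auto
  then show ?case using mult by (auto intro!: flat_combination.add flat_combination.mult)
qed

lemma flat_combination_smooth:
  assumes "flat_combination f"
  shows "smooth f"
proof -
  have "flat_combination (foldr partial_deriv bs f)" for bs
    using assms by (induction bs) (auto simp: flat_combination_deriv)
  then show ?thesis by (auto simp: smooth_def flat_combination_deriv)
qed

text \<open>The function exp(-1/t), positive exactly for t > 0. It approaches 1 only at infinity, so
  step functions are approximated by scaling the argument, not by a cutoff that equals 1
  somewhere.\<close>

definition ramp :: "real \<Rightarrow> real" where
  "ramp = flat_exp 1"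

lemma ramp_bounds: "0 \<le> ramp t" "ramp t \<le> 1"
  by (auto simp: ramp_def flat_exp_def)

lemma ramp_eq_0_iff: "ramp t = 0 \<longleftrightarrow> t \<le> 0"
  by (auto simp: ramp_def flat_exp_def)

lemma ramp_scaled_tendsto_1:
  assumes "0 < t"
  shows "(\<lambda>n. ramp (real (Suc n) * t)) \<longlonglongrightarrow> 1"
proof -
  have "(\<lambda>n. exp (- (1 / (real (Suc n)) * (1 / t)))) \<longlonglongrightarrow> exp (- (0 * (1 / t)))"
    by (intro tendsto_intros LIMSEQ_Suc[OF lim_1_over_n])
  then show ?thesis using assms by (simp add: ramp_def flat_exp_def)
qed

text \<open>A smooth approximation of the indicator of the open box that is positive exactly there
  for every n: all n share one support, and the indicator dominates the whole sequence.
  \<open>Suc n\<close> keeps the scale positive at n = 0.\<close>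

definition box_bump :: "'a::euclidean_space \<Rightarrow> 'a \<Rightarrow> nat \<Rightarrow> 'a \<Rightarrow> real" where
  "box_bump a b n x = (\<Prod>i\<in>Basis. ramp (real (Suc n) * ((x - a) \<bullet> i)) * ramp (real (Suc n) * ((b - x) \<bullet> i)))"

lemma box_bump_bounds: "0 \<le> box_bump a b n x" "box_bump a b n x \<le> 1"
  unfolding box_bump_def
  by (auto intro!: prod_nonneg prod_le_1 mult_le_one mult_nonneg_nonneg simp: ramp_bounds)

lemma box_bump_support: "{x. box_bump a b n x \<noteq> 0} = box a b"
  by (auto simp: box_bump_def ramp_eq_0_iff mem_box inner_diff_left not_le zero_less_mult_iff)

lemma box_bump_tendsto: "(\<lambda>n. box_bump a b n x) \<longlonglongrightarrow> indicator (box a b) x"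
proof (cases "x \<in> box a b")
  case True
  then have "(\<lambda>n. box_bump a b n x) \<longlonglongrightarrow> (\<Prod>i\<in>(Basis::'a set). 1 * 1)"
    unfolding box_bump_def mem_box
    by (intro tendsto_prod tendsto_mult ramp_scaled_tendsto_1) (auto simp: inner_diff_left)
  then show ?thesis using True by simp
next
  case False
  then have "box_bump a b n x = 0" for n using box_bump_support[of a b n] by auto
  then show ?thesis using False by simp
qed

lemma box_bump_test_function:
  assumes "cbox a b \<subseteq> \<Omega>"
  shows "box_bump a b n \<in> test_functions \<Omega>"
proof -
  have flat: "flat_combination (\<lambda>x::'a. ramp (real (Suc n) * ((x - a) \<bullet> i)) * ramp (real (Suc n) * ((b - x) \<bullet> i)))" for i
  proof -
    have "(\<lambda>x. ramp (real (Suc n) * ((x - a) \<bullet> i))) = (\<lambda>x. flat_exp 1 (real (Suc n) * (x \<bullet> i) + - real (Suc n) * (a \<bullet> i)))"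
      "(\<lambda>x. ramp (real (Suc n) * ((b - x) \<bullet> i))) = (\<lambda>x. flat_exp 1 (- real (Suc n) * (x \<bullet> i) + real (Suc n) * (b \<bullet> i)))"
      unfolding ramp_def by (auto simp: inner_diff_left algebra_simps)
    then show ?thesis by (simp only: flat_combination.intros)
  qed
  have "flat_combination (\<lambda>x::'a. \<Prod>i\<in>I. ramp (real (Suc n) * ((x - a) \<bullet> i)) * ramp (real (Suc n) * ((b - x) \<bullet> i)))" for I
  proof (induction I rule: infinite_finite_induct)
    case (insert i I)
    show ?case
      unfolding prod.insert[OF insert.hyps] by (rule flat_combination.mult[OF flat insert.IH])
  qed (simp_all add: flat_combination.const)
  then have "smooth (box_bump a b n)"
    unfolding box_bump_def[abs_def] by (intro flat_combination_smooth) simp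
  moreover have "closure (box a b) \<subseteq> cbox a b"
    by (intro closure_minimal box_subset_cbox closed_cbox)
  moreover have "compact (closure (box a b))" by (simp add: compact_closure bounded_box)
  ultimately show ?thesis using assms by (auto simp: test_functions_def box_bump_support)
qed


section \<open>Test functions and uniqueness of weak derivatives\<close>

lemma continuous_compact_support_bounded:
  fixes h :: "'a::euclidean_space \<Rightarrow> real"
  assumes "continuous_on UNIV h" "compact K" "\<And>x. x \<notin> K \<Longrightarrow> h x = 0"
  obtains M where "0 \<le> M" "\<And>x. \<bar>h x\<bar> \<le> M * indicator K x"
proof -
  have "compact (h ` K)"
    using assms by (intro compact_continuous_image continuous_on_subset[OF assms(1)]) auto
  then obtain M where M: "\<And>x. x \<in> K \<Longrightarrow> \<bar>h x\<bar> \<le> M"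
    using compact_imp_bounded[of "h ` K"] unfolding bounded_iff by auto
  show thesis
  proof (rule that)
    show "\<bar>h x\<bar> \<le> \<bar>M\<bar> * indicator K x" for x
      using M[of x] assms(3)[of x] by (cases "x \<in> K") auto
  qed simp
qed

lemma sq_int_continuous_compact_support:
  fixes h :: "'a::euclidean_space \<Rightarrow> real"
  assumes "continuous_on UNIV h" "compact K" "\<And>x. x \<notin> K \<Longrightarrow> h x = 0"
  shows "sq_int h" "integrable lborel h"
proof -
  have 1: "integrable lborel f" if f: "continuous_on UNIV f" "\<And>x. x \<notin> K \<Longrightarrow> f x = 0" for f :: "'a \<Rightarrow> real"
  proof -
    have "integrable lborel (\<lambda>x. indicator K x *\<^sub>R f x)"
      by (rule borel_integrable_compact[OF assms(2) continuous_on_subset[OF f(1)]]) simp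
    also have "(\<lambda>x. indicator K x *\<^sub>R f x) = f"
      using f(2) by (auto simp: fun_eq_iff indicator_def)
    finally show ?thesis .
  qed
  show "integrable lborel h" by (rule 1[OF assms(1,3)])
  have "integrable lborel (\<lambda>x. (h x)\<^sup>2)"
    by (intro 1 continuous_intros assms(1)) (simp add: assms(3))
  then show "sq_int h"
    using borel_measurable_continuous_onI[OF assms(1)] by (simp add: sq_int_def)
qed

lemma smooth_partial_deriv:
  assumes "smooth \<phi>" "b \<in> Basis"
  shows "smooth (partial_deriv b \<phi>)"
proof -
  have "foldr partial_deriv bs (partial_deriv b \<phi>) differentiable at x" if "bs \<in> lists Basis" for bs x
  proof -
    have "bs @ [b] \<in> lists Basis" using that assms(2) by simp
    then show ?thesis
      using bspec[OF assms(1)[unfolded smooth_def], of "bs @ [b]"] by simp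
  qed
  then show ?thesis by (simp add: smooth_def)
qed

lemma smooth_differentiable: "smooth \<phi> \<Longrightarrow> \<phi> differentiable at x"
  unfolding smooth_def by (drule bspec[of _ _ "[]"]) auto

lemma smooth_continuous_on: "smooth \<phi> \<Longrightarrow> continuous_on S \<phi>"
  by (intro continuous_at_imp_continuous_on ballI differentiable_imp_continuous_within smooth_differentiable)

lemma smooth_linear:
  assumes "smooth \<phi>" "smooth \<psi>"
  shows "smooth (\<lambda>x. c * \<phi> x + \<psi> x)"
proof -
  have "foldr partial_deriv bs (\<lambda>x. c * \<phi> x + \<psi> x)
      = (\<lambda>x. c * foldr partial_deriv bs \<phi> x + foldr partial_deriv bs \<psi> x)" if "bs \<in> lists Basis" for bs
    using that
  proof (induction bs)
    case (Cons b bs)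
    have d: "foldr partial_deriv bs \<phi> differentiable at x" "foldr partial_deriv bs \<psi> differentiable at x" for x
      using Cons.hyps assms by (auto simp: smooth_def)
    have IH: "foldr partial_deriv bs (\<lambda>x. c * \<phi> x + \<psi> x)
        = (\<lambda>x. c * foldr partial_deriv bs \<phi> x + foldr partial_deriv bs \<psi> x)"
      using Cons.IH Cons.hyps by blast
    show ?case
      unfolding foldr.simps o_apply IH by (rule ext) (rule partial_deriv_linear[OF d])
  qed simp
  then show ?thesis
    using assms by (auto simp: smooth_def intro!: differentiable_add differentiable_mult)
qed

lemma test_function_smooth: "\<phi> \<in> test_functions \<Omega> \<Longrightarrow> smooth \<phi>"
  by (simp add: test_functions_def)

lemma test_function_support:
  assumes "\<phi> \<in> test_functions \<Omega>"
  obtains K where "compact K" "K \<subseteq> \<Omega>" "\<And>x. x \<notin> K \<Longrightarrow> \<phi> x = 0"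
    "\<And>x b. x \<notin> K \<Longrightarrow> partial_deriv b \<phi> x = 0"
proof (rule that)
  let ?K = "closure {x. \<phi> x \<noteq> 0}"
  show "compact ?K" "?K \<subseteq> \<Omega>" using assms by (auto simp: test_functions_def)
  have 0: "\<phi> x = 0" if "x \<notin> ?K" for x using that closure_subset[of "{x. \<phi> x \<noteq> 0}"] by auto
  then show "\<phi> x = 0" if "x \<notin> ?K" for x using that .
  show "partial_deriv b \<phi> x = 0" if "x \<notin> ?K" for x b
  proof -
    have "(\<phi> has_derivative (\<lambda>_. 0)) (at x)"
    proof (rule has_derivative_transform_within_open[of "\<lambda>_. 0" _ _ UNIV "- ?K"])
      show "0 = \<phi> y" if "y \<in> - ?K" for y using 0[of y] that by auto
    qed (use that in auto)
    then show ?thesis by (rule partial_deriv_eq)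
  qed
qed

lemma test_functions_linear:
  assumes "\<phi> \<in> test_functions \<Omega>" "\<psi> \<in> test_functions \<Omega>"
  shows "(\<lambda>x. c * \<phi> x + \<psi> x) \<in> test_functions \<Omega>"
proof -
  let ?K = "closure {x. \<phi> x \<noteq> 0} \<union> closure {x. \<psi> x \<noteq> 0}"
  have K: "compact ?K" "?K \<subseteq> \<Omega>" using assms by (auto simp: test_functions_def)
  have "{x. c * \<phi> x + \<psi> x \<noteq> 0} \<subseteq> {x. \<phi> x \<noteq> 0} \<union> {x. \<psi> x \<noteq> 0}" by auto
  also have "\<dots> \<subseteq> ?K" by (intro Un_mono closure_subset)
  finally have sub: "{x. c * \<phi> x + \<psi> x \<noteq> 0} \<subseteq> ?K" .
  from sub have "closure {x. c * \<phi> x + \<psi> x \<noteq> 0} \<subseteq> ?K"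
    using K by (intro closure_minimal compact_imp_closed)
  moreover have "compact (closure {x. c * \<phi> x + \<psi> x \<noteq> 0})"
    using bounded_subset[OF compact_imp_bounded[OF K(1)] sub] by (simp add: compact_closure)
  ultimately show ?thesis
    using K(2) assms by (auto simp: test_functions_def smooth_linear)
qed

lemma test_function_sq_int:
  assumes "\<phi> \<in> test_functions \<Omega>"
  shows "sq_int \<phi>" "b \<in> Basis \<Longrightarrow> sq_int (partial_deriv b \<phi>)"
proof -
  obtain K where K: "compact K" "\<And>x. x \<notin> K \<Longrightarrow> \<phi> x = 0" "\<And>x b. x \<notin> K \<Longrightarrow> partial_deriv b \<phi> x = 0"
    using test_function_support[OF assms] by metis
  note smooth = test_function_smooth[OF assms]
  show "sq_int \<phi>"
    by (rule sq_int_continuous_compact_support(1)[OF smooth_continuous_on[OF smooth] K(1,2)])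
  show "sq_int (partial_deriv b \<phi>)" if "b \<in> Basis"
    by (rule sq_int_continuous_compact_support(1)[OF _ K(1,3)])
       (rule smooth_continuous_on[OF smooth_partial_deriv[OF smooth that]])
qed

text \<open>\<open>rep_l2\<close> chooses a representative of each class and is therefore linear
  only almost everywhere, which is all that the definition of \<open>L2\<close> looks at.\<close>

lemma subspace_L2: "subspace (L2 \<Omega>)"
proof -
  have 0: "AE x in lborel. rep_l2 (0::'a l2) x = 0"
    using rep_abs_l2[of "\<lambda>_::'a. 0"] by (simp add: abs_l2_zero)
  have add: "AE x in lborel. rep_l2 (u + v) x = rep_l2 u x + rep_l2 v x" for u v :: "'a l2"
    using rep_abs_l2[OF sq_int_add[OF sq_int_rep_l2 sq_int_rep_l2], of u v]
    by (simp add: abs_l2_add sq_int_rep_l2 abs_rep_l2)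
  have scale: "AE x in lborel. rep_l2 (c *\<^sub>R u) x = c * rep_l2 u x" for c and u :: "'a l2"
    using rep_abs_l2[OF sq_int_scale[OF sq_int_rep_l2], of c u]
    by (simp add: abs_l2_scale sq_int_rep_l2 abs_rep_l2)
  show ?thesis
    unfolding subspace_def
  proof (intro conjI ballI allI)
    show "0 \<in> L2 \<Omega>" using 0 by (auto simp: L2_def elim: eventually_mono)
    fix u v assume u: "u \<in> L2 \<Omega>" 
    then show "c *\<^sub>R u \<in> L2 \<Omega>" for c
      using scale[of c u] unfolding L2_def by (auto elim: eventually_elim2)
    assume "v \<in> L2 \<Omega>"
    with u show "u + v \<in> L2 \<Omega>"
      using add[of u v] unfolding L2_def mem_Collect_eq by eventually_elim simp
  qed
qed

section \<open>Integrals against test functions as inner products in \<open>l2\<close>\<close>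

lemma abs_l2_in_L2: "sq_int f \<Longrightarrow> (\<And>x. x \<notin> \<Omega> \<Longrightarrow> f x = 0) \<Longrightarrow> abs_l2 f \<in> L2 \<Omega>"
  using rep_abs_l2[of f] by (auto simp: L2_def elim: eventually_mono)

lemma inner_abs_l2:
  assumes "sq_int f"
  shows "u \<bullet> abs_l2 f = (\<integral>x. rep_l2 u x * f x \<partial>lborel)"
proof -
  have "abs_l2 (rep_l2 u) \<bullet> abs_l2 f = (\<integral>x. rep_l2 u x * f x \<partial>lborel)"
    using assms by (simp add: inner_l2.abs_eq l2_rel_def sq_int_rep_l2)
  then show ?thesis by (simp add: abs_rep_l2)
qed

text \<open>The factor \<open>f\<close> already vanishes off \<Omega>, so the set integral is the
  integral over the whole space.\<close>

lemma set_integral_eq_inner: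
  assumes "sq_int f" "\<And>x. x \<notin> \<Omega> \<Longrightarrow> f x = 0"
  shows "(LINT x:\<Omega>|lborel. rep_l2 u x * f x) = u \<bullet> abs_l2 f"
proof -
  have eq: "indicator \<Omega> x *\<^sub>R (rep_l2 u x * f x) = rep_l2 u x * f x" for x
    using assms(2)[of x] by (cases "x \<in> \<Omega>") auto
  show ?thesis
    unfolding inner_abs_l2[OF assms(1)] set_lebesgue_integral_def eq ..
qed

lemma test_function_vanishes:
  assumes "\<phi> \<in> test_functions \<Omega>" "x \<notin> \<Omega>"
  shows "\<phi> x = 0" "partial_deriv b \<phi> x = 0"
  using test_function_support[OF assms(1)] assms(2) by (metis subsetD)+

text \<open>In this form the weak derivative is a linear condition on \<open>u\<close> and
  \<open>g\<close> that does not mention representatives; later proofs use it in place of the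
  definition.\<close>

lemma weak_partial_deriv_iff:
  assumes "b \<in> Basis"
  shows "weak_partial_deriv \<Omega> b u g \<longleftrightarrow> u \<in> L2 \<Omega> \<and> g \<in> L2 \<Omega> \<and>
    (\<forall>\<phi>\<in>test_functions \<Omega>. u \<bullet> abs_l2 (partial_deriv b \<phi>) = - (g \<bullet> abs_l2 \<phi>))"
  unfolding weak_partial_deriv_def
  using assms by (auto simp: set_integral_eq_inner test_function_vanishes test_function_sq_int)

text \<open>The open boxes form an intersection-stable generator of the Borel sets, so vanishing
  integrals spread from boxes to all Borel sets; \<open>density_unique_real\<close> then compares
  \<open>h\<close> with 0.\<close>

lemma AE_zero_if_box_integrals_zero:
  fixes h :: "'a::euclidean_space \<Rightarrow> real"
  assumes h: "integrable lborel h"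
    and box: "\<And>a b. (LINT x:box a b|lborel. h x) = 0"
  shows "AE x in lborel. h x = 0"
proof (rule density_unique_real[OF h integrable_zero])
  let ?G = "range (\<lambda>(a, b). box a b :: 'a set)"
  have G: "sets borel = sigma_sets UNIV ?G"
    by (simp add: borel_eq_box)
  have si: "set_integrable lborel A h" if "A \<in> sets borel" for A
    using integrable_mult_indicator[of A lborel h] h that by (simp add: set_integrable_def)
  \<comment> \<open>The complement step of the induction needs the integral over the whole space,
    which is the limit along growing boxes.\<close>
  have tot: "(LINT x:UNIV|lborel. h x) = 0"
  proof -
    have "(\<lambda>n. LINT x:box (- (real n *\<^sub>R One)) (real n *\<^sub>R One)|lborel. h x)
        \<longlonglongrightarrow> (LINT x:(\<Union>n::nat. box (- (real n *\<^sub>R One)) (real n *\<^sub>R One))|lborel. h x)"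
    proof (rule set_integral_cont_up)
      show "incseq (\<lambda>n. box (- (real n *\<^sub>R One)) (real n *\<^sub>R One :: 'a))"
        by (auto simp: incseq_def subset_box)
      show "set_integrable lborel (\<Union>n::nat. box (- (real n *\<^sub>R One)) (real n *\<^sub>R One)) h"
        by (rule si) auto
    qed auto
    then have "(\<lambda>n::nat. 0) \<longlonglongrightarrow> (LINT x:UNIV|lborel. h x)" by (simp add: box UN_box_eq_UNIV)
    then show ?thesis by (simp add: LIMSEQ_const_iff)
  qed
  fix A :: "'a set" assume "A \<in> sets lborel"
  then have A: "A \<in> sigma_sets UNIV ?G" by (simp only: sets_lborel G)
  have "(LINT x:A|lborel. h x) = 0"
  proof (rule sigma_sets_induct_disjoint[OF _ _ A])
    show "Int_stable ?G" by (auto simp: Int_stable_def box_Int_box)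
    show "(LINT x:UNIV - A|lborel. h x) = 0" if "A \<in> sigma_sets UNIV ?G" "(LINT x:A|lborel. h x) = 0" for A
    proof -
      have "(LINT x:A \<union> (UNIV - A)|lborel. h x) = (LINT x:A|lborel. h x) + (LINT x:UNIV - A|lborel. h x)"
        using that(1)[folded G] by (intro set_integral_Un si) auto
      moreover have "A \<union> (UNIV - A) = UNIV" by auto
      ultimately show ?thesis using tot that(2) by simp
    qed
    show "(LINT x:\<Union> (range A)|lborel. h x) = 0"
      if dis: "disjoint_family A" and rA: "range A \<subseteq> sigma_sets UNIV ?G"
        and A0: "\<And>i. (LINT x:A i|lborel. h x) = 0" for A :: "nat \<Rightarrow> 'a set"
    proof -
      have "(LINT x:\<Union> (range A)|lborel. h x) = (\<Sum>i. (LINT x:A i|lborel. h x))"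
        using rA[folded G] dis
        by (intro lebesgue_integral_countable_add si) (auto simp: disjoint_family_on_def)
      then show ?thesis by (simp add: A0)
    qed
  qed (use box in \<open>auto simp: set_lebesgue_integral_def\<close>)
  then show "(LINT x:A|lborel. h x) = (LINT x:A|lborel. 0)"
    by (simp add: set_lebesgue_integral_def)
qed

lemma sq_int_indicator_box: "sq_int (indicator (box a b))"
proof -
  have "integrable lborel (indicator (box a b) :: 'a \<Rightarrow> real)"
    by (intro integrable_real_indicator emeasure_lborel_box_finite) auto
  then have "integrable lborel (\<lambda>x. (indicat_real (box a b) x)\<^sup>2)"
    by (simp add: power2_eq_square indicator_inter_arith[symmetric])
  then show ?thesis by (simp add: sq_int_def)
qed

text \<open>The fundamental lemma of the calculus of variations. Box bumps converge in
  \<open>l2\<close> to the indicator of the box, so \<open>g\<close> integrates to 0 over every box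
  with \<open>cbox a b\<close> inside \<Omega>. Hence \<open>g\<close> vanishes almost everywhere on
  each such box, and countably many of them cover \<Omega>.\<close>

lemma L2_zero_if_orthogonal_test_functions:
  assumes "open \<Omega>" and g: "g \<in> L2 \<Omega>"
    and orth: "\<And>\<phi>. \<phi> \<in> test_functions \<Omega> \<Longrightarrow> g \<bullet> abs_l2 \<phi> = 0"
  shows "g = 0"
proof -
  have box0: "(LINT x:box a b|lborel. rep_l2 g x) = 0" if "cbox a b \<subseteq> \<Omega>" for a b
  proof -
    have "(\<lambda>n. abs_l2 (box_bump a b n)) \<longlonglongrightarrow> abs_l2 (indicator (box a b))"
    proof (rule abs_l2_dominated_convergence(3)[OF _ _ sq_int_indicator_box box_bump_tendsto])
      show "box_bump a b n \<in> borel_measurable lborel" for n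
        using test_function_sq_int(1)[OF box_bump_test_function[OF that, of n]] by blast
      show "\<bar>box_bump a b n x\<bar> \<le> indicat_real (box a b) x" for n x
        using box_bump_bounds[of a b n x] box_bump_support[of a b n] by (cases "x \<in> box a b") auto
    qed auto
    then have "(\<lambda>n. g \<bullet> abs_l2 (box_bump a b n)) \<longlonglongrightarrow> g \<bullet> abs_l2 (indicator (box a b))"
      by (intro tendsto_intros)
    then have "g \<bullet> abs_l2 (indicator (box a b)) = 0"
      using orth[OF box_bump_test_function[OF that]] by (simp add: LIMSEQ_const_iff)
    then show ?thesis
      by (simp add: inner_abs_l2[OF sq_int_indicator_box] set_lebesgue_integral_def mult.commute)
  qed
  have AE_box: "AE x in lborel. x \<in> box a b \<longrightarrow> rep_l2 g x = 0" if "cbox a b \<subseteq> \<Omega>" for a b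
  proof -
    have "AE x in lborel. indicat_real (box a b) x * rep_l2 g x = 0"
    proof (rule AE_zero_if_box_integrals_zero)
      show "integrable lborel (\<lambda>x. indicat_real (box a b) x * rep_l2 g x)"
        by (rule sq_int_mult[OF sq_int_indicator_box sq_int_rep_l2])
      fix c d
      \<comment> \<open>Corners of the intersection with \<open>box a b\<close>: localising
        \<open>g\<close> to \<open>box a b\<close> leads back to boxes whose closed versions lie in
        \<Omega>.\<close>
      define l where "l = (\<Sum>i\<in>Basis. max (a \<bullet> i) (c \<bullet> i) *\<^sub>R i)"
      define r where "r = (\<Sum>i\<in>Basis. min (b \<bullet> i) (d \<bullet> i) *\<^sub>R i)"
      have "box c d \<inter> box a b = box l r" "cbox l r \<subseteq> cbox a b"
        by (auto simp: l_def r_def mem_box)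
      then have "(LINT x:box l r|lborel. rep_l2 g x) = 0" "box l r = box c d \<inter> box a b"
        using box0[of l r] that by auto
      then show "(LINT x:box c d|lborel. indicat_real (box a b) x * rep_l2 g x) = 0"
        by (simp add: set_lebesgue_integral_def indicator_inter_arith mult.assoc)
    qed
    then show ?thesis by (rule eventually_mono) auto
  qed
  define F where "F = {box a b | a b. cbox a b \<subseteq> \<Omega>}"
  have UF: "\<Union> F = \<Omega>"
  proof
    show "\<Union> F \<subseteq> \<Omega>" using box_subset_cbox unfolding F_def by blast
    show "\<Omega> \<subseteq> \<Union> F"
    proof
      fix x assume "x \<in> \<Omega>"
      then obtain a b where "cbox a b \<subseteq> \<Omega>" "x \<in> box a b"
        using open_contains_cbox[OF \<open>open \<Omega>\<close>] by metis
      then show "x \<in> \<Union> F" unfolding F_def by blast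
    qed
  qed
  have "open B" if "B \<in> F" for B using that by (auto simp: F_def)
  then obtain F' where F': "F' \<subseteq> F" "countable F'" "\<Union> F' = \<Union> F"
    by (rule Lindelof)
  have "AE x in lborel. \<forall>B\<in>F'. x \<in> B \<longrightarrow> rep_l2 g x = 0"
    using F'(1) AE_box by (intro AE_ball_countable'[OF _ F'(2)]) (auto simp: F_def)
  moreover have "AE x in lborel. x \<notin> \<Omega> \<longrightarrow> rep_l2 g x = 0" using g by (simp add: L2_def)
  ultimately have "AE x in lborel. rep_l2 g x = 0"
    by eventually_elim (use F'(3) UF in blast)
  then have "abs_l2 (rep_l2 g) = abs_l2 (\<lambda>_. 0)"
    by (intro abs_l2_eqI(2) sq_int_rep_l2) auto
  then show ?thesis by (simp add: abs_rep_l2 abs_l2_zero)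
qed

section \<open>Weak gradients as linear maps on \<open>H1\<close>\<close>

lemma weak_partial_deriv_unique:
  assumes "open \<Omega>" "b \<in> Basis" "weak_partial_deriv \<Omega> b u g" "weak_partial_deriv \<Omega> b u g'"
  shows "g = g'"
proof -
  have "g - g' = 0"
  proof (rule L2_zero_if_orthogonal_test_functions[OF assms(1)])
    show "g - g' \<in> L2 \<Omega>"
      using assms by (auto simp: weak_partial_deriv_iff intro: subspace_diff subspace_L2)
  qed (use assms in \<open>simp add: weak_partial_deriv_iff inner_diff_left\<close>)
  then show ?thesis by simp
qed

lemma weak_grad_eq:
  assumes "open \<Omega>" "b \<in> Basis" "weak_partial_deriv \<Omega> b u g"
  shows "weak_grad \<Omega> b u = g"
  unfolding weak_grad_def using assms weak_partial_deriv_unique by blast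

lemma weak_partial_deriv_weak_grad:
  assumes "open \<Omega>" "b \<in> Basis" "u \<in> H1 \<Omega>"
  shows "weak_partial_deriv \<Omega> b u (weak_grad \<Omega> b u)"
  using assms weak_grad_eq unfolding H1_def by blast

lemma weak_partial_deriv_linear:
  assumes "b \<in> Basis" "weak_partial_deriv \<Omega> b u g" "weak_partial_deriv \<Omega> b v h"
  shows "weak_partial_deriv \<Omega> b (c *\<^sub>R u + v) (c *\<^sub>R g + h)"
  using assms by (auto simp: weak_partial_deriv_iff inner_add_left subspace_L2 subspace_add subspace_scale)

lemma H1_weak_grad_linear:
  assumes "open \<Omega>" "u \<in> H1 \<Omega>" "v \<in> H1 \<Omega>"
  shows "c *\<^sub>R u + v \<in> H1 \<Omega>"
    "b \<in> Basis \<Longrightarrow> weak_grad \<Omega> b (c *\<^sub>R u + v) = c *\<^sub>R weak_grad \<Omega> b u + weak_grad \<Omega> b v"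
proof -
  have *: "weak_partial_deriv \<Omega> b (c *\<^sub>R u + v) (c *\<^sub>R weak_grad \<Omega> b u + weak_grad \<Omega> b v)"
    if "b \<in> Basis" for b
    using that assms by (intro weak_partial_deriv_linear weak_partial_deriv_weak_grad)
  show "b \<in> Basis \<Longrightarrow> weak_grad \<Omega> b (c *\<^sub>R u + v) = c *\<^sub>R weak_grad \<Omega> b u + weak_grad \<Omega> b v"
    using * weak_grad_eq assms(1) by blast
  have "c *\<^sub>R u + v \<in> L2 \<Omega>"
    using assms by (auto simp: H1_def subspace_L2 subspace_add subspace_scale)
  then show "c *\<^sub>R u + v \<in> H1 \<Omega>" using * by (auto simp: H1_def)
qed


section \<open>Integration by parts\<close>

lemma integral_translation:
  fixes h :: "'a::euclidean_space \<Rightarrow> real"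
  assumes "h \<in> borel_measurable borel"
  shows "(\<integral>x. h (x + c) \<partial>lborel) = (\<integral>x. h x \<partial>lborel)"
proof -
  have "(\<integral>x. h x \<partial>distr lborel borel ((+) c)) = (\<integral>x. h (c + x) \<partial>lborel)"
    using assms by (intro integral_distr) auto
  then show ?thesis by (simp add: lborel_distr_plus add.commute)
qed

text \<open>Translation invariance: the difference quotients in direction \<open>b\<close> have
  integral 0, and they converge to the derivative under a common bound with compact support. This
  avoids iterated integrals.\<close>

lemma integral_partial_deriv_eq_0:
  fixes h :: "'a::euclidean_space \<Rightarrow> real"
  assumes d: "\<And>x. h differentiable at x" and c: "continuous_on UNIV (partial_deriv b h)"
    and K: "compact K" "\<And>x. x \<notin> K \<Longrightarrow> h x = 0" "\<And>x. x \<notin> K \<Longrightarrow> partial_deriv b h x = 0"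
  shows "(\<integral>x. partial_deriv b h x \<partial>lborel) = 0"
proof -
  obtain M where M: "0 \<le> M" "\<And>x. \<bar>partial_deriv b h x\<bar> \<le> M * indicator K x"
    using continuous_compact_support_bounded[OF c K(1,3)] by metis
  have M': "\<bar>partial_deriv b h x\<bar> \<le> M" for x
    using M(2)[of x] M(1) by (cases "x \<in> K") auto
  have ch: "continuous_on UNIV h"
    using d by (intro continuous_at_imp_continuous_on ballI differentiable_imp_continuous_within)
  have line: "((\<lambda>t. h (x + t *\<^sub>R b)) has_real_derivative partial_deriv b h (x + t *\<^sub>R b)) (at t)" for x t
  proof -
    have "((\<lambda>t. h (x + t *\<^sub>R b)) has_derivative
        (\<lambda>s. frechet_derivative h (at (x + t *\<^sub>R b)) (s *\<^sub>R b))) (at t)"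
      by (rule has_derivative_compose[where g=h]) (auto intro!: derivative_eq_intros d[unfolded frechet_derivative_works])
    moreover have "frechet_derivative h (at (x + t *\<^sub>R b)) (s *\<^sub>R b) = partial_deriv b h (x + t *\<^sub>R b) * s" for s
      using linear_frechet_derivative[OF d, of "x + t *\<^sub>R b"]
      by (simp add: partial_deriv_def linear_cmul)
    ultimately show ?thesis by (simp add: has_field_derivative_def)
  qed
  obtain r where r: "K \<subseteq> cball 0 r"
    using compact_imp_bounded[OF K(1)] by (auto simp: bounded_iff subset_iff)
  define e where "e n = 1 / real (Suc n)" for n
  have e: "0 < e n" "e n \<le> 1" for n by (auto simp: e_def)
  define D where "D n x = (h (x + e n *\<^sub>R b) - h x) / e n" for n x
  have "(\<lambda>n. \<integral>x. D n x \<partial>lborel) \<longlonglongrightarrow> (\<integral>x. partial_deriv b h x \<partial>lborel)"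
  proof (rule integral_dominated_convergence)
    \<comment> \<open>As \<open>e n\<close> is at most 1, \<open>D n\<close> can be nonzero only
      within \<open>norm b\<close> of the ball \<open>cball 0 r\<close> that contains
      \<open>K\<close>; there the mean value theorem bounds it by \<open>M\<close>.\<close>
    show "integrable lborel (\<lambda>x. M * indicator (cball 0 (r + norm b)) x :: real)"
      by (intro integrable_mult_right integrable_real_indicator) (use emeasure_bounded_finite[OF bounded_cball] in auto)
    show "partial_deriv b h \<in> borel_measurable lborel"
      using borel_measurable_continuous_onI[OF c] by simp
    show "D n \<in> borel_measurable lborel" for n
      unfolding D_def using borel_measurable_continuous_onI[OF ch] by measurable
    have e0: "filterlim e (at 0) sequentially"
      unfolding e_def by (intro filterlim_atI LIMSEQ_Suc[OF lim_1_over_n]) auto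
    have "(\<lambda>n. D n x) \<longlonglongrightarrow> partial_deriv b h x" for x
      using filterlim_compose[OF line[of x 0, unfolded DERIV_def] e0] by (simp add: D_def)
    then show "AE x in lborel. (\<lambda>n. D n x) \<longlonglongrightarrow> partial_deriv b h x" by simp
    have "norm (D n x) \<le> M * indicator (cball 0 (r + norm b)) x" for n x
    proof (cases "x \<in> cball 0 (r + norm b)")
      case True
      obtain t where "h (x + e n *\<^sub>R b) - h (x + 0 *\<^sub>R b) = (e n - 0) * partial_deriv b h (x + t *\<^sub>R b)"
        using MVT2[OF e(1)[of n] line[of x]] by blast
      then have "D n x = partial_deriv b h (x + t *\<^sub>R b)" using e(1)[of n] by (simp add: D_def)
      then show ?thesis using True M'[of "x + t *\<^sub>R b"] by simp
    next
      case False
      have "norm x \<le> norm (x + e n *\<^sub>R b) + norm (e n *\<^sub>R b)"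
        using norm_triangle_ineq4[of "x + e n *\<^sub>R b" "e n *\<^sub>R b"] by simp
      moreover have "norm (e n *\<^sub>R b) \<le> norm b"
        using e[of n] by (simp add: mult_left_le_one_le)
      ultimately have "x + e n *\<^sub>R b \<notin> cball 0 r" "x \<notin> cball 0 r"
        using False norm_ge_zero[of b] by (auto simp del: norm_ge_zero)
      then have "h (x + e n *\<^sub>R b) = 0" "h x = 0" using K(2) r by blast+
      then show ?thesis using False by (simp add: D_def)
    qed
    then show "AE x in lborel. norm (D n x) \<le> M * indicator (cball 0 (r + norm b)) x" for n by simp
  qed
  moreover have "(\<integral>x. D n x \<partial>lborel) = 0" for n
  proof -
    have h: "integrable lborel h" by (rule sq_int_continuous_compact_support(2)[OF ch K(1,2)])
    have m: "h \<in> borel_measurable borel" by (rule borel_measurable_continuous_onI[OF ch])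
    have "integrable (distr lborel borel ((+) (e n *\<^sub>R b))) h"
      using h by (simp add: lborel_distr_plus)
    then have "integrable lborel (\<lambda>x. h (e n *\<^sub>R b + x))"
      using m by (subst (asm) integrable_distr_eq) auto
    then have "integrable lborel (\<lambda>x. h (x + e n *\<^sub>R b))" by (simp add: add.commute)
    then show ?thesis
      using h by (simp add: D_def integral_translation[OF m])
  qed
  ultimately show ?thesis by (simp add: LIMSEQ_const_iff)
qed

lemma integral_test_function_by_parts:
  assumes \<phi>: "\<phi> \<in> test_functions \<Omega>" and \<psi>: "smooth \<psi>" and b: "b \<in> Basis"
  shows "(\<integral>x. \<phi> x * partial_deriv b \<psi> x \<partial>lborel) = - (\<integral>x. partial_deriv b \<phi> x * \<psi> x \<partial>lborel)"
proof -
  obtain K where K: "compact K" "\<And>x. x \<notin> K \<Longrightarrow> \<phi> x = 0" "\<And>x b. x \<notin> K \<Longrightarrow> partial_deriv b \<phi> x = 0"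
    using test_function_support[OF \<phi>] by metis
  note \<phi>s = test_function_smooth[OF \<phi>]
  note diff = smooth_differentiable[OF \<phi>s] smooth_differentiable[OF \<psi>]
  note cont = smooth_continuous_on[OF \<phi>s] smooth_continuous_on[OF \<psi>]
    smooth_continuous_on[OF smooth_partial_deriv[OF \<phi>s b]]
    smooth_continuous_on[OF smooth_partial_deriv[OF \<psi> b]]
  have eq: "partial_deriv b (\<lambda>x. \<phi> x * \<psi> x) = (\<lambda>x. \<phi> x * partial_deriv b \<psi> x + partial_deriv b \<phi> x * \<psi> x)"
    by (intro ext partial_deriv_mult diff)
  have "(\<integral>x. partial_deriv b (\<lambda>x. \<phi> x * \<psi> x) x \<partial>lborel) = 0"
  proof (rule integral_partial_deriv_eq_0[OF _ _ K(1)])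
    show "continuous_on UNIV (partial_deriv b (\<lambda>x. \<phi> x * \<psi> x))"
      unfolding eq by (intro continuous_intros cont)
  qed (auto simp: eq K intro!: differentiable_mult diff)
  moreover have "integrable lborel (\<lambda>x. \<phi> x * partial_deriv b \<psi> x)"
    "integrable lborel (\<lambda>x. partial_deriv b \<phi> x * \<psi> x)"
    using K by (auto intro!: sq_int_continuous_compact_support(2)[OF _ K(1)] continuous_intros cont)
  ultimately show ?thesis unfolding eq by simp
qed

lemma weak_partial_deriv_test_function:
  assumes \<phi>: "\<phi> \<in> test_functions \<Omega>" and b: "b \<in> Basis"
  shows "weak_partial_deriv \<Omega> b (abs_l2 \<phi>) (abs_l2 (partial_deriv b \<phi>))"
  unfolding weak_partial_deriv_iff[OF b]
proof (intro conjI ballI)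
  show "abs_l2 \<phi> \<in> L2 \<Omega>" "abs_l2 (partial_deriv b \<phi>) \<in> L2 \<Omega>"
    using abs_l2_in_L2[OF test_function_sq_int(1)[OF \<phi>]]
      abs_l2_in_L2[OF test_function_sq_int(2)[OF \<phi> b]] test_function_vanishes[OF \<phi>] by blast+
  fix \<psi> assume \<psi>: "\<psi> \<in> test_functions \<Omega>"
  show "abs_l2 \<phi> \<bullet> abs_l2 (partial_deriv b \<psi>) = - (abs_l2 (partial_deriv b \<phi>) \<bullet> abs_l2 \<psi>)"
    using integral_test_function_by_parts[OF \<phi> test_function_smooth[OF \<psi>] b]
      test_function_sq_int[OF \<phi>] test_function_sq_int[OF \<psi>] b
    by (simp add: inner_l2.abs_eq l2_rel_def)
qed

lemma test_function_in_H1: "\<phi> \<in> test_functions \<Omega> \<Longrightarrow> abs_l2 \<phi> \<in> H1 \<Omega>"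
  using weak_partial_deriv_test_function unfolding H1_def
  using abs_l2_in_L2[OF test_function_sq_int(1)] test_function_vanishes(1) by blast

text \<open>Integrating the \<open>b\<close>-derivative of \<open>(x \<bullet> b) \<phi>\<^sup>2\<close> gives the Poincare inequality.\<close>

lemma poincare_test_function:
  assumes \<phi>: "\<phi> \<in> test_functions \<Omega>" and b: "b \<in> Basis" and r: "\<Omega> \<subseteq> cball 0 r" "0 \<le> r"
  shows "norm (abs_l2 \<phi>) \<le> 2 * r * norm (abs_l2 (partial_deriv b \<phi>))"
proof -
  obtain K where K: "compact K" "K \<subseteq> \<Omega>" "\<And>x. x \<notin> K \<Longrightarrow> \<phi> x = 0" "\<And>x b. x \<notin> K \<Longrightarrow> partial_deriv b \<phi> x = 0"
    using test_function_support[OF \<phi>] by metis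
  note \<phi>s = test_function_smooth[OF \<phi>]
  note diff = smooth_differentiable[OF \<phi>s]
  note cont = smooth_continuous_on[OF \<phi>s] smooth_continuous_on[OF smooth_partial_deriv[OF \<phi>s b]]
  note sq = test_function_sq_int(1)[OF \<phi>] test_function_sq_int(2)[OF \<phi> b]
  have sqx: "sq_int (\<lambda>x. (x \<bullet> b) * \<phi> x)"
    using K by (auto intro!: sq_int_continuous_compact_support(1)[OF _ K(1)] continuous_intros cont)
  have db: "partial_deriv b (\<lambda>x. x \<bullet> b) x = 1" for x :: 'a
  proof -
    have "((\<lambda>x. x \<bullet> b) has_derivative (\<lambda>v. v \<bullet> b)) (at x)" by (auto intro!: derivative_eq_intros)
    from partial_deriv_eq[OF this, of b] show ?thesis using b by simp
  qed
  have dd: "(\<lambda>x. x \<bullet> b) differentiable at x" for x :: 'a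
    by (rule differentiableI) (auto intro!: derivative_eq_intros)
  have eq: "partial_deriv b (\<lambda>x. (x \<bullet> b) * (\<phi> x * \<phi> x))
      = (\<lambda>x. 2 * (((x \<bullet> b) * \<phi> x) * partial_deriv b \<phi> x) + \<phi> x * \<phi> x)"
    by (simp add: partial_deriv_mult dd diff differentiable_mult db fun_eq_iff algebra_simps)
  have "(\<integral>x. partial_deriv b (\<lambda>x. (x \<bullet> b) * (\<phi> x * \<phi> x)) x \<partial>lborel) = 0"
  proof (rule integral_partial_deriv_eq_0[OF _ _ K(1)])
    show "continuous_on UNIV (partial_deriv b (\<lambda>x. (x \<bullet> b) * (\<phi> x * \<phi> x)))"
      unfolding eq by (intro continuous_intros cont)
    show "(\<lambda>x. x \<bullet> b * (\<phi> x * \<phi> x)) differentiable at x" for x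
      by (intro differentiable_mult dd diff)
  qed (auto simp: eq K)
  then have "2 * (\<integral>x. ((x \<bullet> b) * \<phi> x) * partial_deriv b \<phi> x \<partial>lborel) + (\<integral>x. \<phi> x * \<phi> x \<partial>lborel) = 0"
    unfolding eq using sq_int_mult[OF sqx sq(2)] sq_int_mult[OF sq(1) sq(1)] by simp
  then have "2 * (abs_l2 (\<lambda>x. (x \<bullet> b) * \<phi> x) \<bullet> abs_l2 (partial_deriv b \<phi>)) + abs_l2 \<phi> \<bullet> abs_l2 \<phi> = 0"
    using sqx sq by (simp add: inner_l2.abs_eq l2_rel_def)
  then have "(norm (abs_l2 \<phi>))\<^sup>2 = - 2 * (abs_l2 (\<lambda>x. (x \<bullet> b) * \<phi> x) \<bullet> abs_l2 (partial_deriv b \<phi>))"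
    by (simp add: power2_norm_eq_inner)
  also have "\<dots> \<le> 2 * (norm (abs_l2 (\<lambda>x. (x \<bullet> b) * \<phi> x)) * norm (abs_l2 (partial_deriv b \<phi>)))"
    using Cauchy_Schwarz_ineq2[of "abs_l2 (\<lambda>x. (x \<bullet> b) * \<phi> x)" "abs_l2 (partial_deriv b \<phi>)"] by linarith
  \<comment> \<open>On \<Omega> the weight |x . b| is at most \<open>r\<close>; together with the 2
    from differentiating the square this gives the constant 2 r.\<close>
  also have "norm (abs_l2 (\<lambda>x. (x \<bullet> b) * \<phi> x)) \<le> r * norm (abs_l2 \<phi>)"
  proof -
    have "((x \<bullet> b) * \<phi> x)\<^sup>2 \<le> r\<^sup>2 * (\<phi> x)\<^sup>2" for x
    proof (cases "x \<in> K")
      case True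
      then have "norm x \<le> r" using K(2) r(1) by auto
      then have "\<bar>x \<bullet> b\<bar> \<le> r" using Basis_le_norm[OF b, of x] by linarith
      then have "(x \<bullet> b)\<^sup>2 \<le> r\<^sup>2" using power_mono[of "\<bar>x \<bullet> b\<bar>" r 2] by simp
      then show ?thesis by (simp add: power_mult_distrib mult_right_mono)
    qed (simp add: K)
    then have "(\<integral>x. ((x \<bullet> b) * \<phi> x)\<^sup>2 \<partial>lborel) \<le> (\<integral>x. r\<^sup>2 * (\<phi> x)\<^sup>2 \<partial>lborel)"
      using sqx sq(1) by (intro integral_mono) (auto simp: sq_int_def)
    then have "sqrt (\<integral>x. ((x \<bullet> b) * \<phi> x)\<^sup>2 \<partial>lborel) \<le> sqrt (r\<^sup>2 * (\<integral>x. (\<phi> x)\<^sup>2 \<partial>lborel))"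
      by simp
    then show ?thesis by (simp add: norm_abs_l2 sqx sq real_sqrt_mult r(2))
  qed
  finally have *: "(norm (abs_l2 \<phi>))\<^sup>2 \<le> 2 * (r * norm (abs_l2 \<phi>) * norm (abs_l2 (partial_deriv b \<phi>)))"
    by (simp add: mult_right_mono)
  show ?thesis
  proof (cases "abs_l2 \<phi> = 0")
    case False
    then show ?thesis using * by (simp add: power2_eq_square)
  qed (use r(2) in simp)
qed


section \<open>The gradient inner product on \<open>H\<^sub>0\<^sup>1\<close>\<close>

text \<open>Relative to a set \<open>V\<close>, since \<open>grad_inner\<close> is shown to be an
  inner product on \<open>H10 \<Omega>\<close> and not on the whole type. Both inner products used
  for the POD are instances.\<close>

locale inner_product_on =
  fixes V :: "'b::real_vector set" and ip :: "'b \<Rightarrow> 'b \<Rightarrow> real"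
  assumes subspace: "subspace V"
    and ip_commute: "u \<in> V \<Longrightarrow> v \<in> V \<Longrightarrow> ip u v = ip v u"
    and ip_linear: "u \<in> V \<Longrightarrow> v \<in> V \<Longrightarrow> w \<in> V \<Longrightarrow> ip (c *\<^sub>R u + v) w = c * ip u w + ip v w"
    and ip_nonneg: "u \<in> V \<Longrightarrow> 0 \<le> ip u u"
    and ip_definite: "u \<in> V \<Longrightarrow> ip u u = 0 \<Longrightarrow> u = 0"
begin

lemma in_V [simp]:
  "0 \<in> V" "u \<in> V \<Longrightarrow> c *\<^sub>R u \<in> V" "u \<in> V \<Longrightarrow> v \<in> V \<Longrightarrow> u + v \<in> V" "u \<in> V \<Longrightarrow> v \<in> V \<Longrightarrow> u - v \<in> V"
  "(\<And>i. i \<in> I \<Longrightarrow> g i \<in> V) \<Longrightarrow> (\<Sum>i\<in>I. g i) \<in> V"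
  using subspace by (auto intro: subspace_0 subspace_scale subspace_add subspace_diff subspace_sum)

lemma ip_add_left: "u \<in> V \<Longrightarrow> v \<in> V \<Longrightarrow> w \<in> V \<Longrightarrow> ip (u + v) w = ip u w + ip v w"
  using ip_linear[of u v w 1] by simp

lemma ip_zero_left [simp]: "w \<in> V \<Longrightarrow> ip 0 w = 0"
  using ip_linear[of 0 0 w 1] by simp

lemma ip_scale_left: "u \<in> V \<Longrightarrow> w \<in> V \<Longrightarrow> ip (c *\<^sub>R u) w = c * ip u w"
  using ip_linear[of u 0 w c] by simp

lemma ip_diff_left: "u \<in> V \<Longrightarrow> v \<in> V \<Longrightarrow> w \<in> V \<Longrightarrow> ip (u - v) w = ip u w - ip v w"
  using ip_linear[of v u w "-1"] by simp

lemma ip_add_right: "u \<in> V \<Longrightarrow> v \<in> V \<Longrightarrow> w \<in> V \<Longrightarrow> ip w (u + v) = ip w u + ip w v"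
  by (simp add: ip_commute[of w] ip_add_left)

lemma ip_zero_right [simp]: "w \<in> V \<Longrightarrow> ip w 0 = 0"
  by (simp add: ip_commute[of w])

lemma ip_scale_right: "u \<in> V \<Longrightarrow> w \<in> V \<Longrightarrow> ip w (c *\<^sub>R u) = c * ip w u"
  by (simp add: ip_commute[of w] ip_scale_left)

lemma ip_diff_right: "u \<in> V \<Longrightarrow> v \<in> V \<Longrightarrow> w \<in> V \<Longrightarrow> ip w (u - v) = ip w u - ip w v"
  by (simp add: ip_commute[of w] ip_diff_left)

lemma ip_sum_left: "(\<And>i. i \<in> I \<Longrightarrow> g i \<in> V) \<Longrightarrow> w \<in> V \<Longrightarrow> ip (\<Sum>i\<in>I. g i) w = (\<Sum>i\<in>I. ip (g i) w)"
  by (induction I rule: infinite_finite_induct) (simp_all add: ip_add_left)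

lemma ip_sum_right: "(\<And>i. i \<in> I \<Longrightarrow> g i \<in> V) \<Longrightarrow> w \<in> V \<Longrightarrow> ip w (\<Sum>i\<in>I. g i) = (\<Sum>i\<in>I. ip w (g i))"
  by (simp add: ip_commute[of w] ip_sum_left)

text \<open>The parallelogram law with the nonnegative term of the sum dropped.\<close>

lemma ip_diff_bound:
  assumes "u \<in> V" "v \<in> V"
  shows "ip (u - v) (u - v) \<le> 2 * ip u u + 2 * ip v v"
proof -
  have "ip (u + v) (u + v) + ip (u - v) (u - v) = 2 * ip u u + 2 * ip v v"
    using assms by (simp add: ip_add_left ip_add_right ip_diff_left ip_diff_right)
  then show ?thesis using ip_nonneg[of "u + v"] assms by simp
qed

end

lemma inner_product_on_inner: "subspace V \<Longrightarrow> inner_product_on V inner"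
  by unfold_locales (auto simp: inner_commute inner_add_left inner_add_right)

section \<open>The space \<open>H10\<close> and definiteness of the gradient inner product\<close>

lemma H1_norm_eq: "H1_norm \<Omega> u = sqrt ((norm u)\<^sup>2 + (\<Sum>b\<in>Basis. (norm (weak_grad \<Omega> b u))\<^sup>2))"
  by (simp add: H1_norm_def grad_norm_def grad_inner_def power2_norm_eq_inner sum_nonneg)

lemma H1_norm_bounds:
  "norm u \<le> H1_norm \<Omega> u" "b \<in> Basis \<Longrightarrow> norm (weak_grad \<Omega> b u) \<le> H1_norm \<Omega> u"
proof -
  have nonneg: "0 \<le> (\<Sum>b\<in>Basis. (norm (weak_grad \<Omega> b u))\<^sup>2)" by (simp add: sum_nonneg)
  then show "norm u \<le> H1_norm \<Omega> u"
    unfolding H1_norm_eq by (intro real_le_rsqrt) simp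
  assume b: "b \<in> Basis"
  have "(norm (weak_grad \<Omega> b u))\<^sup>2 \<le> (\<Sum>b\<in>Basis. (norm (weak_grad \<Omega> b u))\<^sup>2)"
    by (rule member_le_sum[OF b]) auto
  then show "norm (weak_grad \<Omega> b u) \<le> H1_norm \<Omega> u"
    unfolding H1_norm_eq by (intro real_le_rsqrt order_trans[OF _ le_add_same_cancel2[THEN iffD2]]) simp_all
qed

text \<open>Testing convergence on the function and on each weak derivative separately replaces a
  triangle inequality for \<open>H1_norm\<close>.\<close>

lemma H1_norm_tendsto_0_iff:
  "(\<lambda>k. H1_norm \<Omega> (w k)) \<longlonglongrightarrow> 0 \<longleftrightarrow> w \<longlonglongrightarrow> 0 \<and> (\<forall>b\<in>Basis. (\<lambda>k. weak_grad \<Omega> b (w k)) \<longlonglongrightarrow> 0)"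
proof safe
  assume *: "(\<lambda>k. H1_norm \<Omega> (w k)) \<longlonglongrightarrow> 0"
  show "w \<longlonglongrightarrow> 0"
    by (rule Lim_null_comparison[OF _ *]) (simp add: H1_norm_bounds)
  show "(\<lambda>k. weak_grad \<Omega> b (w k)) \<longlonglongrightarrow> 0" if "b \<in> Basis" for b
    by (rule Lim_null_comparison[OF _ *]) (simp add: H1_norm_bounds that)
next
  assume "w \<longlonglongrightarrow> 0" "\<forall>b\<in>Basis. (\<lambda>k. weak_grad \<Omega> b (w k)) \<longlonglongrightarrow> 0"
  then have "(\<lambda>k. sqrt ((norm (w k))\<^sup>2 + (\<Sum>b\<in>Basis. (norm (weak_grad \<Omega> b (w k)))\<^sup>2)))
      \<longlonglongrightarrow> sqrt ((norm (0::'a l2))\<^sup>2 + (\<Sum>b\<in>(Basis::'a set). (norm (0::'a l2))\<^sup>2))"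
    by (intro tendsto_intros) auto
  then show "(\<lambda>k. H1_norm \<Omega> (w k)) \<longlonglongrightarrow> 0" by (simp add: H1_norm_eq)
qed

lemma H10_subset_H1: "H10 \<Omega> \<subseteq> H1 \<Omega>"
  by (auto simp: H10_def)

lemma zero_test_function: "(\<lambda>_. 0) \<in> test_functions \<Omega>"
  using flat_combination_smooth[OF flat_combination.const[of 0]] by (simp add: test_functions_def)

lemma test_function_in_H10:
  assumes "open \<Omega>" "\<phi> \<in> test_functions \<Omega>"
  shows "abs_l2 \<phi> \<in> H10 \<Omega>"
proof -
  have "weak_grad \<Omega> b 0 = 0" if "b \<in> Basis" for b
    by (rule weak_grad_eq[OF assms(1) that])
       (use that in \<open>simp add: weak_partial_deriv_iff subspace_0 subspace_L2\<close>)
  then have "H1_norm \<Omega> 0 = 0" by (simp add: H1_norm_eq)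
  then show ?thesis
    using assms(2) test_function_in_H1[OF assms(2)]
    unfolding H10_def by (auto intro!: exI[of _ "\<lambda>_. \<phi>"])
qed

lemma H10_linear:
  assumes \<Omega>: "open \<Omega>" and u: "u \<in> H10 \<Omega>" and v: "v \<in> H10 \<Omega>"
  shows "c *\<^sub>R u + v \<in> H10 \<Omega>"
proof -
  obtain \<phi> \<psi> where \<phi>: "\<And>k. \<phi> k \<in> test_functions \<Omega>" "(\<lambda>k. H1_norm \<Omega> (u - abs_l2 (\<phi> k))) \<longlonglongrightarrow> 0"
    and \<psi>: "\<And>k. \<psi> k \<in> test_functions \<Omega>" "(\<lambda>k. H1_norm \<Omega> (v - abs_l2 (\<psi> k))) \<longlonglongrightarrow> 0"
    using u v unfolding H10_def by blast
  have H1: "u \<in> H1 \<Omega>" "v \<in> H1 \<Omega>" using u v H10_subset_H1 by auto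
  have w: "u - abs_l2 (\<phi> k) \<in> H1 \<Omega>" "v - abs_l2 (\<psi> k) \<in> H1 \<Omega>" for k
    using H1_weak_grad_linear(1)[OF \<Omega> test_function_in_H1[OF \<phi>(1)] H1(1), of "-1"]
      H1_weak_grad_linear(1)[OF \<Omega> test_function_in_H1[OF \<psi>(1)] H1(2), of "-1"] by auto
  have eq: "c *\<^sub>R u + v - abs_l2 (\<lambda>x. c * \<phi> k x + \<psi> k x)
      = c *\<^sub>R (u - abs_l2 (\<phi> k)) + (v - abs_l2 (\<psi> k))" for k
    using test_function_sq_int(1)[OF \<phi>(1)[of k]] test_function_sq_int(1)[OF \<psi>(1)[of k]]
    by (simp add: abs_l2_add abs_l2_scale sq_int_scale algebra_simps)
  have "(\<lambda>k. H1_norm \<Omega> (c *\<^sub>R u + v - abs_l2 (\<lambda>x. c * \<phi> k x + \<psi> k x))) \<longlonglongrightarrow> 0"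
    unfolding eq H1_norm_tendsto_0_iff
  proof (intro conjI ballI)
    have "(\<lambda>k. c *\<^sub>R (u - abs_l2 (\<phi> k)) + (v - abs_l2 (\<psi> k))) \<longlonglongrightarrow> c *\<^sub>R 0 + 0"
      using \<phi>(2) \<psi>(2) unfolding H1_norm_tendsto_0_iff by (intro tendsto_intros) auto
    then show "(\<lambda>k. c *\<^sub>R (u - abs_l2 (\<phi> k)) + (v - abs_l2 (\<psi> k))) \<longlonglongrightarrow> 0" by simp
    fix b :: 'a assume b: "b \<in> Basis"
    have "(\<lambda>k. c *\<^sub>R weak_grad \<Omega> b (u - abs_l2 (\<phi> k)) + weak_grad \<Omega> b (v - abs_l2 (\<psi> k))) \<longlonglongrightarrow> c *\<^sub>R 0 + 0"
      using \<phi>(2) \<psi>(2) b unfolding H1_norm_tendsto_0_iff by (intro tendsto_intros) auto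
    then show "(\<lambda>k. weak_grad \<Omega> b (c *\<^sub>R (u - abs_l2 (\<phi> k)) + (v - abs_l2 (\<psi> k)))) \<longlonglongrightarrow> 0"
      by (simp add: H1_weak_grad_linear(2)[OF \<Omega> w b])
  qed
  then show ?thesis
    using H1_weak_grad_linear(1)[OF \<Omega> H1, of c] test_functions_linear[OF \<phi>(1) \<psi>(1), of c]
    unfolding H10_def mem_Collect_eq by (intro conjI exI[of _ "\<lambda>k x. c * \<phi> k x + \<psi> k x"]) auto
qed

lemma subspace_H10:
  assumes "open \<Omega>"
  shows "subspace (H10 \<Omega>)"
proof -
  have 0: "0 \<in> H10 \<Omega>"
    using test_function_in_H10[OF assms zero_test_function] by (simp add: abs_l2_zero)
  then have "c *\<^sub>R u \<in> H10 \<Omega>" "u + v \<in> H10 \<Omega>" if "u \<in> H10 \<Omega>" "v \<in> H10 \<Omega>" for c u v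
    using H10_linear[OF assms that(1) 0, of c] H10_linear[OF assms that, of 1] by auto
  with 0 show ?thesis by (auto simp: subspace_def)
qed

text \<open>The approximating test functions have \<open>b\<close>-derivatives tending to 0. By the
  Poincare inequality they tend to 0 themselves, and their limit is \<open>u\<close>; one direction
  is enough.\<close>

lemma H10_zero_if_weak_grad_zero:
  assumes \<Omega>: "open \<Omega>" "bounded \<Omega>" and u: "u \<in> H10 \<Omega>"
    and b: "b \<in> Basis" and g: "weak_grad \<Omega> b u = 0"
  shows "u = 0"
proof -
  obtain r where r: "\<Omega> \<subseteq> cball 0 r" "0 \<le> r"
  proof -
    obtain a where "\<forall>x\<in>\<Omega>. norm x \<le> a" using \<Omega>(2) unfolding bounded_iff by blast
    then have "\<Omega> \<subseteq> cball 0 \<bar>a\<bar>" by fastforce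
    then show thesis using that by auto
  qed
  obtain \<phi> where \<phi>: "\<And>k. \<phi> k \<in> test_functions \<Omega>" "(\<lambda>k. H1_norm \<Omega> (u - abs_l2 (\<phi> k))) \<longlonglongrightarrow> 0"
    using u unfolding H10_def by blast
  have H1: "u \<in> H1 \<Omega>" using u H10_subset_H1 by auto
  have "weak_grad \<Omega> b (u - abs_l2 (\<phi> k)) = - abs_l2 (partial_deriv b (\<phi> k))" for k
    using H1_weak_grad_linear(2)[OF \<Omega>(1) test_function_in_H1[OF \<phi>(1)[of k]] H1 b, of "-1"]
      weak_grad_eq[OF \<Omega>(1) b weak_partial_deriv_test_function[OF \<phi>(1)[of k] b]] g by simp
  then have "(\<lambda>k. - abs_l2 (partial_deriv b (\<phi> k))) \<longlonglongrightarrow> 0"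
    using \<phi>(2) b unfolding H1_norm_tendsto_0_iff by auto
  then have "(\<lambda>k. 2 * r * norm (- abs_l2 (partial_deriv b (\<phi> k)))) \<longlonglongrightarrow> 2 * r * norm (0::'a l2)"
    by (intro tendsto_intros)
  then have "(\<lambda>k. 2 * r * norm (abs_l2 (partial_deriv b (\<phi> k)))) \<longlonglongrightarrow> 0" by simp
  then have "(\<lambda>k. abs_l2 (\<phi> k)) \<longlonglongrightarrow> 0"
    by (rule Lim_null_comparison[rotated]) (simp add: poincare_test_function[OF \<phi>(1) b r])
  moreover have "(\<lambda>k. u - (u - abs_l2 (\<phi> k))) \<longlonglongrightarrow> u - 0"
    using \<phi>(2) unfolding H1_norm_tendsto_0_iff by (intro tendsto_intros) auto
  ultimately show ?thesis using LIMSEQ_unique by fastforce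
qed

lemma inner_product_on_grad_inner:
  assumes \<Omega>: "open \<Omega>" "bounded \<Omega>"
  shows "inner_product_on (H10 \<Omega>) (grad_inner \<Omega>)"
proof
  show "subspace (H10 \<Omega>)" by (rule subspace_H10[OF \<Omega>(1)])
  show "grad_inner \<Omega> u v = grad_inner \<Omega> v u" for u v
    by (simp add: grad_inner_def inner_commute)
  show "grad_inner \<Omega> (c *\<^sub>R u + v) w = c * grad_inner \<Omega> u w + grad_inner \<Omega> v w"
    if "u \<in> H10 \<Omega>" "v \<in> H10 \<Omega>" for u v w c
  proof -
    have "u \<in> H1 \<Omega>" "v \<in> H1 \<Omega>" using that H10_subset_H1 by auto
    then show ?thesis
      by (simp add: grad_inner_def H1_weak_grad_linear[OF \<Omega>(1)] inner_add_left sum.distrib sum_distrib_left)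
  qed
  show "0 \<le> grad_inner \<Omega> u u" for u by (simp add: grad_inner_def sum_nonneg)
  show "u = 0" if "u \<in> H10 \<Omega>" "grad_inner \<Omega> u u = 0" for u
  proof -
    obtain b :: 'a where b: "b \<in> Basis" using nonempty_Basis by blast
    have "weak_grad \<Omega> b u = 0"
      using that(2) b unfolding grad_inner_def by (simp add: sum_nonneg_eq_0_iff)
    then show ?thesis using H10_zero_if_weak_grad_zero[OF \<Omega> that(1) b] by blast
  qed
qed

lemma grad_norm_power2: "(grad_norm \<Omega> u)\<^sup>2 = (\<Sum>b\<in>Basis. (norm (weak_grad \<Omega> b u))\<^sup>2)"
  by (simp add: grad_norm_def grad_inner_def power2_norm_eq_inner sum_nonneg)


section \<open>Weak time derivatives\<close>

text \<open>The function exp(-1/t) / t^2 for t > 0 and 0 elsewhere: a probability density, because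
  \<open>ramp\<close> rises from 0 to 1, and after rescaling an approximate identity that acts from
  the right.\<close>

abbreviation ramp' :: "real \<Rightarrow> real" where
  "ramp' \<equiv> flat_exp [:0, 0, 1:]"

lemma DERIV_ramp: "(ramp has_real_derivative ramp' t) (at t)"
  using DERIV_flat_exp[of 1 t] by (simp add: ramp_def one_pCons)

lemma continuous_on_flat_exp: "continuous_on S (flat_exp p)"
  using DERIV_flat_exp DERIV_isCont continuous_at_imp_continuous_on by blast

lemma flat_exp_measurable [measurable]: "flat_exp p \<in> borel_measurable borel"
  by (intro borel_measurable_continuous_onI continuous_on_flat_exp)

lemma ramp_measurable [measurable]: "ramp \<in> borel_measurable borel"
  by (simp add: ramp_def)

lemma ramp'_nonneg: "0 \<le> ramp' t"
  by (auto simp: flat_exp_def)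

lemma ramp_tendsto_1: "(ramp \<longlongrightarrow> 1) at_top"
proof -
  have "((\<lambda>t::real. exp (- (inverse t))) \<longlongrightarrow> exp (- 0)) at_top"
    by (intro tendsto_intros tendsto_inverse_0_at_top filterlim_ident)
  then have "((\<lambda>t::real. exp (- (inverse t))) \<longlongrightarrow> 1) at_top" by simp
  then show ?thesis
    by (rule Lim_transform_eventually)
       (use eventually_gt_at_top[of 0] in eventually_elim, simp add: ramp_def flat_exp_def inverse_eq_divide)
qed

lemma has_integral_ramp': "has_bochner_integral lborel ramp' 1"
proof -
  have "(\<integral>\<^sup>+x. ennreal (ramp' x) * indicator {0..} x \<partial>lborel) = ennreal (1 - ramp 0)"
    by (intro nn_integral_FTC_atLeast DERIV_ramp ramp_tendsto_1) (auto simp: ramp'_nonneg)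
  also have "(\<lambda>x. ennreal (ramp' x) * indicator {0..} x) = (\<lambda>x. ennreal (ramp' x))"
    by (auto simp: fun_eq_iff indicator_def flat_exp_def)
  also have "ramp 0 = 0" by (simp add: ramp_eq_0_iff)
  finally show ?thesis
    by (intro has_bochner_integral_nn_integral) (auto simp: ramp'_nonneg)
qed

text \<open>Substituting \<open>t = a + y / n\<close> moves the dependence on \<open>n\<close> into a bounded factor.\<close>

lemma ramp'_concentrates:
  fixes F :: "real \<Rightarrow> real"
  assumes [measurable]: "F \<in> borel_measurable borel" and B: "\<And>t. \<bar>F t\<bar> \<le> B"
    and F: "(F \<longlongrightarrow> F a) (at_right a)" and "a < b"
  shows "(\<lambda>n. \<integral>t. real (Suc n) * ramp' (real (Suc n) * (t - a)) * ramp (real (Suc n) * (b - t)) * F t \<partial>lborel) \<longlonglongrightarrow> F a"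
proof -
  define S where "S n y = ramp' y * ramp (real (Suc n) * (b - a) - y) * F (a + y / real (Suc n))" for n y
  have "(\<integral>t. real (Suc n) * ramp' (real (Suc n) * (t - a)) * ramp (real (Suc n) * (b - t)) * F t \<partial>lborel)
      = (\<integral>y. S n y \<partial>lborel)" for n
  proof -
    define N where "N = real (Suc n)"
    have N: "0 < N" by (simp add: N_def)
    then have "N * (a + 1 / N * y - a) = y" "N * (b - (a + 1 / N * y)) = N * (b - a) - y"
      "a + 1 / N * y = a + y / N" for y
      by (simp_all add: field_simps)
    then show ?thesis
      unfolding S_def N_def[symmetric] using N
      by (subst lborel_integral_real_affine[where c="1 / N" and t=a]) (simp_all add: mult.assoc)
  qed
  moreover have "(\<lambda>n. \<integral>y. S n y \<partial>lborel) \<longlonglongrightarrow> (\<integral>y. ramp' y * F a \<partial>lborel)"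
  proof (rule integral_dominated_convergence)
    show "integrable lborel (\<lambda>y. ramp' y * B)"
      using has_integral_ramp' by (auto simp: has_bochner_integral_iff)
    show "AE y in lborel. norm (S n y) \<le> ramp' y * B" for n
      using B ramp'_nonneg ramp_bounds
      by (intro AE_I2) (auto simp: S_def abs_mult intro!: mult_mono mult_left_le)
    have "(\<lambda>n. S n y) \<longlonglongrightarrow> ramp' y * F a" for y
    proof (cases "0 < y")
      case True
      have top: "filterlim (\<lambda>n. real (Suc n) * (b - a) - y) at_top sequentially"
        using filterlim_tendsto_add_at_top[OF tendsto_const filterlim_tendsto_pos_mult_at_top[OF tendsto_const _
              filterlim_compose[OF filterlim_real_sequentially filterlim_Suc]], of "b - a" "- y"] \<open>a < b\<close>
        by (simp add: mult.commute)
      have "filterlim (\<lambda>n. a + y / real (Suc n)) (at_right a) sequentially"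
      proof (rule tendsto_imp_filterlim_at_right)
        have "(\<lambda>n. a + y * (1 / real (Suc n))) \<longlonglongrightarrow> a + y * 0"
          by (intro tendsto_intros LIMSEQ_Suc[OF lim_1_over_n])
        then show "(\<lambda>n. a + y / real (Suc n)) \<longlonglongrightarrow> a" by simp
      qed (use True in auto)
      then have "(\<lambda>n. S n y) \<longlonglongrightarrow> ramp' y * 1 * F a"
        unfolding S_def
        by (intro tendsto_intros filterlim_compose[OF ramp_tendsto_1 top] filterlim_compose[OF F])
      then show ?thesis by simp
    qed (simp add: S_def flat_exp_def)
    then show "AE y in lborel. (\<lambda>n. S n y) \<longlonglongrightarrow> ramp' y * F a" by simp
    show "S n \<in> borel_measurable lborel" for n unfolding S_def by measurable
  qed measurable
  moreover have "(\<integral>y. ramp' y * F a \<partial>lborel) = F a"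
    using has_integral_ramp' by (simp add: has_bochner_integral_iff)
  ultimately show ?thesis by (simp only:)
qed

section \<open>Increments of a scalar function with a weak derivative\<close>

lemma box_bump_real:
  "box_bump a b n t = ramp (real (Suc n) * (t - a)) * ramp (real (Suc n) * (b - t))" for t :: real
  by (simp add: box_bump_def)

lemma deriv_box_bump:
  "deriv (box_bump a b n) t = real (Suc n) * ramp' (real (Suc n) * (t - a)) * ramp (real (Suc n) * (b - t))
     - real (Suc n) * ramp' (real (Suc n) * (b - t)) * ramp (real (Suc n) * (t - a))" for t :: real
  unfolding box_bump_real[abs_def]
  by (rule DERIV_imp_deriv)
     (auto intro!: derivative_eq_intros DERIV_chain2[OF DERIV_ramp] simp: algebra_simps)

text \<open>The test functions are the box bumps of (a,b). The derivative of a bump acts like a unit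
  mass reaching \<open>a\<close> from the right minus one reaching \<open>b\<close> from the left,
  while the bump itself tends to the indicator.\<close>

lemma weak_deriv_integral:
  fixes W G :: "real \<Rightarrow> real"
  assumes W: "continuous_on {0..T} W" and G: "set_integrable lborel {0<..<T} G"
    and weak: "\<And>\<psi>. \<psi> \<in> test_functions {0<..<T} \<Longrightarrow>
      (LINT t:{0<..<T}|lborel. deriv \<psi> t * W t) = - (LINT t:{0<..<T}|lborel. \<psi> t * G t)"
    and ab: "0 < a" "a < b" "b < T"
  shows "(LINT t:{a<..<b}|lborel. G t) = W b - W a"
proof -
  \<comment> \<open>Extension by 0 makes the function bounded and measurable on the whole line, as
    \<open>ramp'_concentrates\<close> requires; on [0,T] it is still \<open>W\<close>.\<close>
  define F where "F t = indicator {0..T} t *\<^sub>R W t" for t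
  have Fm [measurable]: "F \<in> borel_measurable borel"
    using borel_measurable_continuous_on_indicator[OF _ W] by (simp add: F_def[abs_def])
  obtain B where B: "\<And>t. \<bar>F t\<bar> \<le> B"
  proof -
    have "compact (W ` {0..T})" by (intro compact_continuous_image W compact_Icc)
    then obtain B where B: "\<And>x. x \<in> W ` {0..T} \<Longrightarrow> norm x \<le> B"
      using compact_imp_bounded[of "W ` {0..T}"] unfolding bounded_iff by blast
    have "\<bar>F t\<bar> \<le> \<bar>B\<bar>" for t
      using B[of "W t"] by (cases "t \<in> {0..T}") (auto simp: F_def)
    then show thesis by (rule that)
  qed
  have cont: "isCont F t" if "t \<in> {a..b}" for t
  proof -
    have "continuous_on {0<..<T} F"
      by (rule continuous_on_eq[OF continuous_on_subset[OF W]]) (auto simp: F_def)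
    then show ?thesis using that ab by (auto simp: continuous_on_eq_continuous_at)
  qed
  let ?d1 = "\<lambda>n t. real (Suc n) * ramp' (real (Suc n) * (t - a)) * ramp (real (Suc n) * (b - t)) * F t"
  let ?d2 = "\<lambda>n t. real (Suc n) * ramp' (real (Suc n) * (b - t)) * ramp (real (Suc n) * (t - a)) * F t"
  have supp: "?d1 n t = 0" "?d2 n t = 0" if "t \<notin> {a..b}" for n t
    using that by (auto simp: flat_exp_def ramp_def mult_le_0_iff not_le zero_less_mult_iff)
  have int: "integrable lborel (?d1 n)" "integrable lborel (?d2 n)" for n
  proof -
    have c: "continuous_on {a..b} F"
      using cont by (intro continuous_at_imp_continuous_on) auto
    have "integrable lborel (\<lambda>t. indicator {a..b} t *\<^sub>R ?d1 n t)"
      "integrable lborel (\<lambda>t. indicator {a..b} t *\<^sub>R ?d2 n t)"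
      unfolding ramp_def
      by (intro borel_integrable_compact compact_Icc continuous_intros c
          continuous_on_compose2[OF continuous_on_flat_exp[of UNIV]]; simp)+
    moreover have "(\<lambda>t. indicator {a..b} t *\<^sub>R ?d1 n t) = ?d1 n" "(\<lambda>t. indicator {a..b} t *\<^sub>R ?d2 n t) = ?d2 n"
      using supp by (auto simp: fun_eq_iff indicator_def simp del: of_nat_Suc)
    ultimately show "integrable lborel (?d1 n)" "integrable lborel (?d2 n)" by simp_all
  qed
  have lim1: "(\<lambda>n. \<integral>t. ?d1 n t \<partial>lborel) \<longlonglongrightarrow> F a"
    using cont[of a] ab B by (intro ramp'_concentrates[OF Fm]) (auto simp: isCont_def filterlim_at_split)
  \<comment> \<open>The reflection t -> a + b - t exchanges the two ends and so reduces the mass at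
    \<open>b\<close> to the one-sided limit at \<open>a\<close>.\<close>
  have lim2: "(\<lambda>n. \<integral>t. ?d2 n t \<partial>lborel) \<longlonglongrightarrow> F b"
  proof -
    have "(\<lambda>n. \<integral>t. real (Suc n) * ramp' (real (Suc n) * (t - a)) * ramp (real (Suc n) * (b - t))
        * F (a + b - t) \<partial>lborel) \<longlonglongrightarrow> F (a + b - a)"
    proof (rule ramp'_concentrates)
      have "isCont (\<lambda>t. F (a + b - t)) a"
        using cont[of b] ab by (intro isCont_o2[where f="\<lambda>t. a + b - t" and g=F] continuous_intros) simp
      then show "((\<lambda>t. F (a + b - t)) \<longlongrightarrow> F (a + b - a)) (at_right a)"
        by (rule Lim_at_imp_Lim_at_within[OF isContD])
    qed (use ab B in auto)
    moreover have "(\<integral>t. real (Suc n) * ramp' (real (Suc n) * (t - a)) * ramp (real (Suc n) * (b - t)) * F (a + b - t) \<partial>lborel)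
        = (\<integral>t. ?d2 n t \<partial>lborel)" for n
      by (subst lborel_integral_real_affine[where c="-1" and t="a + b"]) (simp_all add: algebra_simps)
    ultimately show ?thesis by (simp only: add_diff_cancel_left')
  qed
  have test: "box_bump a b n \<in> test_functions {0<..<T}" for n
    using ab by (intro box_bump_test_function) auto
  have "(LINT t:{0<..<T}|lborel. deriv (box_bump a b n) t * W t)
      = (\<integral>t. ?d1 n t \<partial>lborel) - (\<integral>t. ?d2 n t \<partial>lborel)" for n
  proof -
    have "indicator {0<..<T} t *\<^sub>R (deriv (box_bump a b n) t * W t) = ?d1 n t - ?d2 n t" for t
    proof (cases "t \<in> {a..b}")
      case True
      then have "indicator {0<..<T} t = (1::real)" "F t = W t" using ab by (auto simp: F_def)
      then show ?thesis unfolding deriv_box_bump by (simp add: left_diff_distrib del: of_nat_Suc)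
    next
      case False
      have "deriv (box_bump a b n) t = 0"
        unfolding deriv_box_bump using False
        by (auto simp: flat_exp_def ramp_def mult_le_0_iff not_le zero_less_mult_iff)
      then show ?thesis by (simp only: supp[OF False] mult_zero_left scaleR_zero_right diff_self)
    qed
    then show ?thesis
      using int by (simp add: set_lebesgue_integral_def del: of_nat_Suc)
  qed
  then have *: "(\<lambda>n. - (LINT t:{0<..<T}|lborel. box_bump a b n t * G t)) \<longlonglongrightarrow> F a - F b"
    using tendsto_diff[OF lim1 lim2] by (simp add: weak[OF test])
  have "(\<lambda>n. LINT t:{0<..<T}|lborel. box_bump a b n t * G t)
      \<longlonglongrightarrow> (LINT t:{0<..<T}|lborel. indicator (box a b) t * G t)"
    unfolding set_lebesgue_integral_def
  proof (rule integral_dominated_convergence)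
    have [measurable]: "(\<lambda>t. indicator {0<..<T} t *\<^sub>R G t) \<in> borel_measurable borel"
      using G by (simp add: set_integrable_def borel_measurable_integrable)
    have [measurable]: "box_bump a b n \<in> borel_measurable borel" for n
      unfolding box_bump_real[abs_def] by measurable
    show "integrable lborel (\<lambda>t. norm (indicator {0<..<T} t *\<^sub>R G t))"
      using G unfolding set_integrable_def by (rule integrable_norm)
    have "(\<lambda>t. box_bump a b n t * (indicator {0<..<T} t *\<^sub>R G t)) \<in> borel_measurable lborel" for n
      by measurable
    then show "(\<lambda>t. indicator {0<..<T} t *\<^sub>R (box_bump a b n t * G t)) \<in> borel_measurable lborel" for n
      by (simp add: mult.left_commute)
    have "(\<lambda>t. indicator (box a b) t * (indicator {0<..<T} t *\<^sub>R G t)) \<in> borel_measurable lborel"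
      by measurable
    then show "(\<lambda>t. indicator {0<..<T} t *\<^sub>R (indicat_real (box a b) t * G t)) \<in> borel_measurable lborel"
      by (simp add: mult.left_commute)
    show "AE t in lborel. (\<lambda>n. indicator {0<..<T} t *\<^sub>R (box_bump a b n t * G t))
        \<longlonglongrightarrow> indicator {0<..<T} t *\<^sub>R (indicator (box a b) t * G t)"
      by (intro AE_I2 tendsto_intros box_bump_tendsto)
    show "AE t in lborel. norm (indicator {0<..<T} t *\<^sub>R (box_bump a b n t * G t))
        \<le> norm (indicator {0<..<T} t *\<^sub>R G t)" for n
      using box_bump_bounds[of a b n]
      by (intro AE_I2) (auto simp: abs_mult indicator_def intro!: mult_left_le_one_le)
  qed
  also have "(LINT t:{0<..<T}|lborel. indicator (box a b) t * G t) = (LINT t:{a<..<b}|lborel. G t)"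
    unfolding set_lebesgue_integral_def using ab
    by (intro Bochner_Integration.integral_cong) (auto simp: indicator_def)
  finally have "(LINT t:{a<..<b}|lborel. G t) = - (F a - F b)"
    using tendsto_minus[OF *] LIMSEQ_unique by fastforce
  then show ?thesis using ab by (simp add: F_def)
qed

section \<open>Increments of \<open>l2\<close>-valued functions of time\<close>

lemma integral_cauchy_schwarz:
  assumes "sq_int f" "sq_int g"
  shows "(\<integral>x. f x * g x \<partial>lborel)\<^sup>2 \<le> (\<integral>x. (f x)\<^sup>2 \<partial>lborel) * (\<integral>x. (g x)\<^sup>2 \<partial>lborel)"
  using Cauchy_Schwarz_ineq[of "abs_l2 f" "abs_l2 g"] assms
  by (simp add: inner_l2.abs_eq l2_rel_def power2_eq_square)

lemma set_integrable_scaleR_bounded: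
  fixes g :: "real \<Rightarrow> 'b::{banach, second_countable_topology}"
  assumes g: "set_integrable lborel S g" and p: "continuous_on UNIV p" and B: "\<And>t. \<bar>p t\<bar> \<le> B"
  shows "set_integrable lborel S (\<lambda>t. p t *\<^sub>R g t)"
  unfolding set_integrable_def
proof (rule Bochner_Integration.integrable_bound)
  have gi: "integrable lborel (\<lambda>t. indicator S t *\<^sub>R g t)" using g by (simp add: set_integrable_def)
  then show "integrable lborel (\<lambda>t. B *\<^sub>R (indicator S t *\<^sub>R g t))"
    by (rule integrable_scaleR_right)
  have "(\<lambda>t. p t *\<^sub>R (indicator S t *\<^sub>R g t)) \<in> borel_measurable lborel"
    by (rule borel_measurable_scaleR[OF _ borel_measurable_integrable[OF gi]])
       (use borel_measurable_continuous_onI[OF p] in simp)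
  then show "(\<lambda>t. indicator S t *\<^sub>R p t *\<^sub>R g t) \<in> borel_measurable lborel"
    by (simp add: mult.commute)
  show "AE t in lborel. norm (indicator S t *\<^sub>R p t *\<^sub>R g t) \<le> norm (B *\<^sub>R (indicator S t *\<^sub>R g t))"
  proof (rule AE_I2)
    fix t
    have "\<bar>p t\<bar> * norm (g t) \<le> \<bar>B\<bar> * norm (g t)"
      by (rule mult_right_mono[OF order_trans[OF B abs_ge_self]]) simp
    then show "norm (indicator S t *\<^sub>R p t *\<^sub>R g t) \<le> norm (B *\<^sub>R (indicator S t *\<^sub>R g t))"
      by (cases "t \<in> S") auto
  qed
qed

lemma deriv_eq_partial_deriv:
  assumes "smooth \<psi>"
  shows "deriv \<psi> = partial_deriv (1::real) \<psi>"
proof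
  fix t
  obtain D where D: "(\<psi> has_real_derivative D) (at t)"
    using smooth_differentiable[OF assms, of t] by (auto simp: real_differentiable_def)
  then have "(\<psi> has_derivative (*) D) (at t)" by (simp add: has_field_derivative_def)
  from partial_deriv_eq[OF this, of 1] show "deriv \<psi> t = partial_deriv 1 \<psi> t"
    using DERIV_imp_deriv[OF D] by simp
qed

lemma inner_set_integral:
  fixes g :: "real \<Rightarrow> 'b::{banach, second_countable_topology, real_inner}"
  assumes "set_integrable lborel S g"
  shows "set_integrable lborel S (\<lambda>t. g t \<bullet> v)"
    "(LINT t:S|lborel. g t \<bullet> v) = (LINT t:S|lborel. g t) \<bullet> v"
  using assms integrable_inner_left[of v lborel "\<lambda>t. indicator S t *\<^sub>R g t"]
    integral_inner_left[of v lborel "\<lambda>t. indicator S t *\<^sub>R g t"]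
  by (auto simp: set_integrable_def set_lebesgue_integral_def)

text \<open>Pairing with a fixed vector reduces this to the scalar case. The ends 0 and T are
  excluded because the bumps need closed support inside the open interval;
  \<open>time_increment_le\<close> recovers them by continuity.\<close>

lemma weak_time_deriv_integral:
  fixes w g :: "real \<Rightarrow> 'a::euclidean_space l2"
  assumes w: "continuous_on {0..T} w" and g: "set_integrable lborel {0<..<T} g"
    and weak: "weak_time_deriv T w g" and ab: "0 < a" "a < b" "b < T"
  shows "(LINT t:{a<..<b}|lborel. g t \<bullet> v) = (w b - w a) \<bullet> v"
proof -
  have wi: "set_integrable lborel {0<..<T} w"
    by (rule set_integrable_subset[OF borel_integrable_atLeastAtMost'[OF w]]) auto
  have "(LINT t:{a<..<b}|lborel. g t \<bullet> v) = w b \<bullet> v - w a \<bullet> v"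
  proof (rule weak_deriv_integral[where T=T, OF _ _ _ ab])
    show "continuous_on {0..T} (\<lambda>t. w t \<bullet> v)" by (intro continuous_intros w)
    show "set_integrable lborel {0<..<T} (\<lambda>t. g t \<bullet> v)" by (rule inner_set_integral(1)[OF g])
    fix \<psi> assume \<psi>: "\<psi> \<in> test_functions {0<..<T}"
    note smooth = test_function_smooth[OF \<psi>]
    obtain K where K: "compact K" "\<And>x. x \<notin> K \<Longrightarrow> \<psi> x = 0" "\<And>x b. x \<notin> K \<Longrightarrow> partial_deriv b \<psi> x = 0"
      using test_function_support[OF \<psi>] by metis
    have si: "set_integrable lborel {0<..<T} (\<lambda>t. p t *\<^sub>R h t)"
      if p: "continuous_on UNIV p" "\<And>x. x \<notin> K \<Longrightarrow> p x = 0" and h: "set_integrable lborel {0<..<T} h"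
      for p and h :: "real \<Rightarrow> 'a l2"
    proof -
      obtain M where M: "0 \<le> M" "\<And>x. \<bar>p x\<bar> \<le> M * indicator K x"
        using continuous_compact_support_bounded[OF p(1) K(1) p(2)] by metis
      have "\<bar>p x\<bar> \<le> M" for x using M(2)[of x] M(1) by (cases "x \<in> K") auto
      then show ?thesis by (rule set_integrable_scaleR_bounded[OF h p(1)])
    qed
    have i1: "set_integrable lborel {0<..<T} (\<lambda>t. deriv \<psi> t *\<^sub>R w t)"
      unfolding deriv_eq_partial_deriv[OF smooth]
      by (rule si[OF smooth_continuous_on[OF smooth_partial_deriv[OF smooth]] K(3) wi]) auto
    have i2: "set_integrable lborel {0<..<T} (\<lambda>t. \<psi> t *\<^sub>R g t)"
      by (rule si[OF smooth_continuous_on[OF smooth] K(2) g])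
    have "(LINT t:{0<..<T}|lborel. deriv \<psi> t *\<^sub>R w t) = - (LINT t:{0<..<T}|lborel. \<psi> t *\<^sub>R g t)"
      using weak \<psi> unfolding weak_time_deriv_def by blast
    then show "(LINT t:{0<..<T}|lborel. deriv \<psi> t * (w t \<bullet> v)) = - (LINT t:{0<..<T}|lborel. \<psi> t * (g t \<bullet> v))"
      using inner_set_integral(2)[OF i1, of v] inner_set_integral(2)[OF i2, of v] by simp
  qed
  then show ?thesis by (simp add: inner_diff_left)
qed

lemma set_integral_nonneg_mono_set:
  fixes f :: "'b \<Rightarrow> real"
  assumes "set_integrable M B f" "A \<subseteq> B" "\<And>x. 0 \<le> f x"
  shows "(LINT x:A|M. f x) \<le> (LINT x:B|M. f x)"
  unfolding set_lebesgue_integral_def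
  using assms by (intro integral_mono') (auto simp: set_integrable_def indicator_def)

text \<open>The comparison function \<open>q\<close> is a Taylor polynomial of \<open>w\<close> in the applications.\<close>

lemma time_increment_le:
  fixes w g q q' :: "real \<Rightarrow> 'a::euclidean_space l2"
  assumes w: "continuous_on {0..T} w" and g: "set_integrable lborel {0<..<T} g"
    and weak: "weak_time_deriv T w g"
    and q: "\<And>t. (q has_vector_derivative q' t) (at t)" and q': "continuous_on UNIV q'"
    and ab: "0 \<le> a" "a < b" "b \<le> T"
  shows "norm ((w b - q b) - (w a - q a)) \<le> (LINT t:{a<..<b}|lborel. norm (g t - q' t))"
proof -
  have gq: "set_integrable lborel S (\<lambda>t. g t - q' t)" if "S \<in> sets borel" "S \<subseteq> {0<..<T}" for S
  proof (rule set_integrable_subset[OF set_integral_diff(1)])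
    show "set_integrable lborel {0<..<T} q'"
      by (rule set_integrable_subset[OF borel_integrable_atLeastAtMost'[of 0 T]])
         (auto intro: continuous_on_subset[OF q'])
  qed (use g that in auto)
  have gq': "set_integrable lborel S (\<lambda>t. norm (g t - q' t))" if "S \<in> sets borel" "S \<subseteq> {0<..<T}" for S
    using set_integrable_norm[OF gq[OF that]] .
  have interior: "norm ((w d - q d) - (w c - q c)) \<le> (LINT t:{a<..<b}|lborel. norm (g t - q' t))"
    if cd: "a < c" "c < d" "d < b" for c d
  proof -
    \<comment> \<open>Pairing with the increment itself produces its squared norm, so that one
      factor \<open>norm v\<close> cancels at the end.\<close>
    define v where "v = (w d - q d) - (w c - q c)"
    have sub: "{c<..<d} \<subseteq> {0<..<T}" using cd ab by auto
    have gi: "set_integrable lborel {c<..<d} g" by (rule set_integrable_subset[OF g]) (use sub in auto)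
    have qi: "set_integrable lborel {c..d} q'"
      by (rule borel_integrable_atLeastAtMost'[OF continuous_on_subset[OF q']]) auto
    have qi': "set_integrable lborel {c<..<d} q'"
      by (rule set_integrable_subset[OF qi]) auto
    have "(LINT t:{c..d}|lborel. q' t \<bullet> v) = q d \<bullet> v - q c \<bullet> v"
      unfolding set_lebesgue_integral_def
    proof (rule integral_FTC_atLeastAtMost)
      show "((\<lambda>t. q t \<bullet> v) has_vector_derivative q' x \<bullet> v) (at x within {c..d})" for x
        using has_vector_derivative_at_within[OF q]
        by (rule bounded_linear.has_vector_derivative[OF bounded_linear_inner_left])
      show "continuous_on {c..d} (\<lambda>x. q' x \<bullet> v)"
        by (intro continuous_intros continuous_on_subset[OF q']) auto
    qed (use cd in simp)
    moreover have "(LINT t:{c..d}|lborel. q' t \<bullet> v) = (LINT t:{c<..<d}|lborel. q' t \<bullet> v)"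
      by (rule set_integral_discrete_difference[where X="{c, d}"]) auto
    moreover have "(LINT t:{c<..<d}|lborel. g t \<bullet> v) = (w d - w c) \<bullet> v"
      by (rule weak_time_deriv_integral[OF w g weak]) (use cd ab in auto)
    ultimately have "v \<bullet> v = (LINT t:{c<..<d}|lborel. g t \<bullet> v) - (LINT t:{c<..<d}|lborel. q' t \<bullet> v)"
      by (simp add: v_def algebra_simps inner_commute)
    also have "\<dots> = (LINT t:{c<..<d}|lborel. (g t - q' t) \<bullet> v)"
      using inner_set_integral(1)[OF gi, of v] inner_set_integral(1)[OF qi', of v]
      by (simp add: inner_diff_left set_integral_diff(2))
    also have "\<dots> \<le> (LINT t:{c<..<d}|lborel. norm (g t - q' t) * norm v)"
      using sub by (intro set_integral_mono inner_set_integral(1) gq set_integrable_mult_left gq')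
        (auto simp: norm_cauchy_schwarz)
    also have "\<dots> = (LINT t:{c<..<d}|lborel. norm (g t - q' t)) * norm v" by simp
    also have "(LINT t:{c<..<d}|lborel. norm (g t - q' t)) \<le> (LINT t:{a<..<b}|lborel. norm (g t - q' t))"
      using ab cd by (intro set_integral_nonneg_mono_set gq') auto
    finally have "norm v * norm v \<le> (LINT t:{a<..<b}|lborel. norm (g t - q' t)) * norm v"
      by (simp add: mult_right_mono flip: power2_norm_eq_inner power2_eq_square)
    moreover have "0 \<le> (LINT t:{a<..<b}|lborel. norm (g t - q' t))"
      by (simp add: set_lebesgue_integral_def)
    ultimately show ?thesis
      unfolding v_def[symmetric] by (cases "v = 0") auto
  qed
  \<comment> \<open>The interior points a + \<epsilon> and b - \<epsilon> approach the ends; the 3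
    keeps \<epsilon> below half the length already at n = 0.\<close>
  define \<epsilon> where "\<epsilon> n = (b - a) / real (n + 3)" for n
  have "0 < \<epsilon> n" for n using ab(2) by (simp add: \<epsilon>_def)
  moreover have "\<epsilon> n < (b - a) / 2" for n
    unfolding \<epsilon>_def by (rule divide_strict_left_mono) (use ab(2) in auto)
  ultimately have \<epsilon>: "0 < \<epsilon> n" "\<epsilon> n < (b - a) / 2" for n by auto
  have \<epsilon>0: "\<epsilon> \<longlonglongrightarrow> 0"
    unfolding \<epsilon>_def by (rule LIMSEQ_ignore_initial_segment[OF lim_const_over_n])
  have in_T: "a + \<epsilon> n \<in> {0..T}" "b - \<epsilon> n \<in> {0..T}" "a \<in> {0..T}" "b \<in> {0..T}" for n
    using \<epsilon>[of n] ab by (auto simp: field_simps)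
  have lim: "(\<lambda>n. a + \<epsilon> n) \<longlonglongrightarrow> a" "(\<lambda>n. b - \<epsilon> n) \<longlonglongrightarrow> b"
    using tendsto_add[OF tendsto_const \<epsilon>0, of a] tendsto_diff[OF tendsto_const \<epsilon>0, of b] by auto
  have "continuous_on {0..T} q"
    using q has_vector_derivative_continuous by (intro continuous_at_imp_continuous_on) blast
  then have c: "continuous_on {0..T} (\<lambda>t. w t - q t)" by (intro continuous_on_diff w)
  have "(\<lambda>n. norm ((w (b - \<epsilon> n) - q (b - \<epsilon> n)) - (w (a + \<epsilon> n) - q (a + \<epsilon> n))))
      \<longlonglongrightarrow> norm ((w b - q b) - (w a - q a))"
    using in_T by (intro tendsto_norm tendsto_diff[of "\<lambda>n. w (b - \<epsilon> n) - q (b - \<epsilon> n)"]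
      continuous_on_tendsto_compose[OF c lim(1)] continuous_on_tendsto_compose[OF c lim(2)]) auto
  then show ?thesis
  proof (rule LIMSEQ_le_const2)
    show "\<exists>N. \<forall>n\<ge>N. norm ((w (b - \<epsilon> n) - q (b - \<epsilon> n)) - (w (a + \<epsilon> n) - q (a + \<epsilon> n)))
        \<le> (LINT t:{a<..<b}|lborel. norm (g t - q' t))"
    proof (intro exI allI impI interior)
      fix n show "a < a + \<epsilon> n" "a + \<epsilon> n < b - \<epsilon> n" "b - \<epsilon> n < b"
        using \<epsilon>[of n] by (auto simp: field_simps)
    qed
  qed
qed

text \<open>Made for iteration: each use turns a bound on the Taylor remainder of the derivative
  into one for the function itself, with one more power of the step.\<close>

lemma time_increment_le_const:
  fixes w g q q' :: "real \<Rightarrow> 'a::euclidean_space l2"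
  assumes "continuous_on {0..T} w" "set_integrable lborel {0<..<T} g" "weak_time_deriv T w g"
    and "\<And>t. (q has_vector_derivative q' t) (at t)" "continuous_on UNIV q'"
    and ab: "0 \<le> a" "a \<le> b" "b \<le> T"
    and B: "\<And>t. a \<le> t \<Longrightarrow> t \<le> b \<Longrightarrow> norm (g t - q' t) \<le> B"
  shows "norm ((w b - q b) - (w a - q a)) \<le> B * (b - a)"
proof (cases "a = b")
  case False
  then have less: "a < b" using ab by simp
  have "norm ((w b - q b) - (w a - q a)) \<le> (LINT t:{a<..<b}|lborel. norm (g t - q' t))"
    by (rule time_increment_le[OF assms(1-5) ab(1) less ab(3)])
  also have "\<dots> \<le> (LINT t:{a<..<b}|lborel. B)"
    unfolding set_lebesgue_integral_def
  proof (rule integral_mono')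
    have "0 \<le> B" using order_trans[OF norm_ge_zero B[of a]] ab by simp
    then show "0 \<le> indicator {a<..<b} t *\<^sub>R B" for t by simp
    show "integrable lborel (\<lambda>t. indicator {a<..<b} t *\<^sub>R B)"
      by (intro integrable_scaleR_left integrable_real_indicator) (use ab in auto)
    show "indicator {a<..<b} t *\<^sub>R norm (g t - q' t) \<le> indicator {a<..<b} t *\<^sub>R B" for t
      using B[of t] by (cases "t \<in> {a<..<b}") auto
  qed
  also have "\<dots> = B * (b - a)" using less by (simp add: set_lebesgue_integral_def)
  finally show ?thesis .
qed simp

text \<open>Reading t -> norm (g t), extended by 0, as a square integrable function on the real line
  makes the product and Cauchy-Schwarz estimates for \<open>sq_int\<close> available for time
  integrals.\<close>

lemma L2_time_sq_int:
  assumes "L2_time T V g"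
  shows "sq_int (\<lambda>t. indicator {0<..<T} t * norm (g t))"
proof -
  have m: "(\<lambda>t. indicator {0<..<T} t *\<^sub>R g t) \<in> borel_measurable lborel"
    using assms by (simp add: L2_time_def set_borel_measurable_def)
  have eq: "(\<lambda>t. indicator {0<..<T} t * norm (g t)) = (\<lambda>t. norm (indicator {0<..<T} t *\<^sub>R g t))" by auto
  have eq2: "(indicator {0<..<T} t * norm (g t))\<^sup>2 = indicator {0<..<T} t *\<^sub>R (norm (g t))\<^sup>2" for t
    by (cases "t \<in> {0<..<T}") auto
  have "integrable lborel (\<lambda>t. (indicator {0<..<T} t * norm (g t))\<^sup>2)"
    unfolding eq2 using assms by (simp add: L2_time_def set_integrable_def)
  moreover have "(\<lambda>t. indicator {0<..<T} t * norm (g t)) \<in> borel_measurable lborel"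
    unfolding eq by (rule measurable_compose[OF m borel_measurable_norm])
  ultimately show ?thesis by (simp add: sq_int_def)
qed

lemma sq_int_indicator_interval: "sq_int (indicator {a<..<b::real})"
  using sq_int_indicator_box[of a b] by (simp add: box_real)

lemma L2_time_integrable:
  fixes g :: "real \<Rightarrow> 'a::euclidean_space l2"
  assumes "L2_time T V g"
  shows "set_integrable lborel {0<..<T} g"
  unfolding set_integrable_def
proof (rule Bochner_Integration.integrable_bound)
  show "integrable lborel (\<lambda>t. indicator {0<..<T} t * (indicator {0<..<T} t * norm (g t)))"
    by (rule sq_int_mult[OF sq_int_indicator_interval L2_time_sq_int[OF assms]])
  show "(\<lambda>t. indicator {0<..<T} t *\<^sub>R g t) \<in> borel_measurable lborel"
    using assms by (simp add: L2_time_def set_borel_measurable_def)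
qed (auto simp: indicator_def)

lemma L2_time_cauchy_schwarz:
  assumes g: "L2_time T V g" and ab: "0 \<le> a" "a < b" "b \<le> T"
  shows "(LINT t:{a<..<b}|lborel. norm (g t))\<^sup>2 \<le> (b - a) * (LINT t:{a<..<b}|lborel. (norm (g t))\<^sup>2)"
proof -
  have eq: "indicator {a<..<b} t * (indicator {a<..<b} t * (indicator {0<..<T} t * norm (g t)))
      = indicator {a<..<b} t *\<^sub>R norm (g t)" 
    "(indicator {a<..<b} t * (indicator {0<..<T} t * norm (g t)))\<^sup>2 = indicator {a<..<b} t *\<^sub>R (norm (g t))\<^sup>2"
    "(indicator {a<..<b} t :: real)\<^sup>2 = indicator {a<..<b} t" for t
    using ab by (auto simp: indicator_def)
  have "sq_int (\<lambda>t. indicator {a<..<b} t * (indicator {0<..<T} t * norm (g t)))"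
    unfolding sq_int_def
  proof
    have gs: "sq_int (\<lambda>t. indicator {0<..<T} t * norm (g t))" by (rule L2_time_sq_int[OF g])
    then show "(\<lambda>t. indicator {a<..<b} t * (indicator {0<..<T} t * norm (g t))) \<in> borel_measurable lborel"
      by (intro borel_measurable_times sq_int_measurable borel_measurable_indicator) simp
    have "integrable lborel (\<lambda>t. indicator {a<..<b} t *\<^sub>R (indicator {0<..<T} t * norm (g t))\<^sup>2)"
      using gs by (intro integrable_mult_indicator) (auto simp: sq_int_def)
    then show "integrable lborel (\<lambda>t. (indicator {a<..<b} t * (indicator {0<..<T} t * norm (g t)))\<^sup>2)"
      by (rule Bochner_Integration.integrable_cong[THEN iffD1, rotated -1]) (auto simp: indicator_def)
  qed
  from integral_cauchy_schwarz[OF sq_int_indicator_interval[of a b] this]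
  show ?thesis using ab unfolding eq by (simp add: set_lebesgue_integral_def)
qed


section \<open>The trapezoidal rule\<close>

text \<open>Let M be the integral of the norm of \<open>du 3\<close> and h = b - a. Integrating
  upwards from \<open>du 3\<close> bounds the Taylor remainders at \<open>a\<close> of
  \<open>du 2\<close>, \<open>du 1\<close> and \<open>du 0\<close> by M, M h and M h^2. The Taylor
  terms cancel in the trapezoidal error and leave at most M h / 2 + M h, rounded up to 2 M h.
  Squaring, with Cauchy-Schwarz for M^2, gives 4 h^3.\<close>

lemma trapezoid_error:
  fixes u :: "real \<Rightarrow> 'a::euclidean_space l2"
  assumes reg: "H_time 3 T V u du" and ab: "0 \<le> a" "a < b" "b \<le> T"
  shows "(norm ((1 / 2) *\<^sub>R (du 1 b + du 1 a) - (u b - u a) /\<^sub>R (b - a)))\<^sup>2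
    \<le> 4 * (b - a) ^ 3 * (LINT t:{a<..<b}|lborel. (norm (du 3 t))\<^sup>2)"
proof -
  have u: "u = du 0" using reg by (simp add: H_time_def)
  have cont: "continuous_on {0..T} (du j)" and weak: "weak_time_deriv T (du j) (du (Suc j))" if "j < 3" for j
    using reg that by (auto simp: H_time_def)
  have L2: "L2_time T V (du j)" if "j \<le> 3" for j
    using reg that by (auto simp: H_time_def)
  have int: "set_integrable lborel {0<..<T} (du j)" if "j \<le> 3" for j
    by (rule L2_time_integrable[OF L2[OF that]])
  define h where "h = b - a"
  define M where "M = (LINT t:{a<..<b}|lborel. norm (du 3 t))"
  have M0: "0 \<le> M" by (simp add: M_def set_lebesgue_integral_def)
  have h: "0 < h" using ab by (simp add: h_def)
  have r2: "norm (du 2 t - du 2 a) \<le> M" if t: "a \<le> t" "t \<le> b" for t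
  proof (cases "a = t")
    case False
    have i3: "set_integrable lborel {a<..<b} (\<lambda>t. norm (du 3 t))"
      by (rule set_integrable_subset[OF set_integrable_norm[OF int]]) (use ab in auto)
    have "norm ((du 2 t - 0) - (du 2 a - 0)) \<le> (LINT t:{a<..<t}|lborel. norm (du 3 t - 0))"
      by (rule time_increment_le[OF cont int _ _ _ ab(1)])
         (use weak[of 2] t ab False in \<open>auto simp: numeral_3_eq_3 numeral_2_eq_2\<close>)
    also have "\<dots> \<le> M"
      unfolding M_def using t i3 by (auto intro!: set_integral_nonneg_mono_set)
    finally show ?thesis by simp
  qed (simp add: M0)
  have r1: "norm (du 1 t - du 1 a - (t - a) *\<^sub>R du 2 a) \<le> M * (t - a)" if t: "a \<le> t" "t \<le> b" for t
  proof -
    have "norm ((du 1 t - (t - a) *\<^sub>R du 2 a) - (du 1 a - (a - a) *\<^sub>R du 2 a)) \<le> M * (t - a)"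
    proof (rule time_increment_le_const[OF cont int[of 2] _ _ _ ab(1) t(1)])
      show "((\<lambda>t. (t - a) *\<^sub>R du 2 a) has_vector_derivative du 2 a) (at t)" for t
        by (auto intro!: derivative_eq_intros)
    qed (use weak[of 1] t ab r2 in \<open>auto simp: numeral_2_eq_2\<close>)
    then show ?thesis by (simp add: algebra_simps)
  qed
  \<comment> \<open>The quadratic Taylor polynomial of \<open>du 0\<close> at \<open>a\<close>; its
    derivative is the affine polynomial subtracted in \<open>r1\<close>.\<close>
  define p where "p t = (t - a) *\<^sub>R du 1 a + ((t - a)\<^sup>2 / 2) *\<^sub>R du 2 a" for t
  have "norm ((du 0 b - p b) - (du 0 a - p a)) \<le> (M * h) * (b - a)"
  proof (rule time_increment_le_const[OF cont int[of 1] _ _ _ ab(1)])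
    show "(p has_vector_derivative (du 1 a + (t - a) *\<^sub>R du 2 a)) (at t)" for t
      unfolding p_def by (auto intro!: derivative_eq_intros)
    show "continuous_on UNIV (\<lambda>t. du 1 a + (t - a) *\<^sub>R du 2 a)" by (intro continuous_intros)
    show "norm (du 1 t - (du 1 a + (t - a) *\<^sub>R du 2 a)) \<le> M * h" if "a \<le> t" "t \<le> b" for t
    proof -
      have "M * (t - a) \<le> M * h" using that M0 by (intro mult_left_mono) (auto simp: h_def)
      then show ?thesis using r1[OF that] by (simp add: algebra_simps)
    qed
  qed (use weak[of 0] ab in auto)
  then have r0: "norm (du 0 b - du 0 a - h *\<^sub>R du 1 a - (h\<^sup>2 / 2) *\<^sub>R du 2 a) \<le> M * h * h"
    by (simp add: p_def h_def algebra_simps)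
  have r1': "norm (du 1 b - du 1 a - h *\<^sub>R du 2 a) \<le> M * h"
    using r1[of b] ab by (simp add: h_def)
  have "(1 / 2) *\<^sub>R (du 1 b + du 1 a) - (u b - u a) /\<^sub>R h
      = (1 / 2) *\<^sub>R (du 1 b - du 1 a - h *\<^sub>R du 2 a)
        - (1 / h) *\<^sub>R (du 0 b - du 0 a - h *\<^sub>R du 1 a - (h\<^sup>2 / 2) *\<^sub>R du 2 a)"
  proof -
    \<comment> \<open>Writing \<open>du 1 a\<close> as P + P lets the whole and the halved copies of
      it cancel by additive rules alone.\<close>
    define P where "P = (1 / 2) *\<^sub>R du 1 a"
    have "du 1 a = P + P" by (simp add: P_def flip: scaleR_add_left)
    then have e1: "(1 / h) *\<^sub>R (h *\<^sub>R du 1 a) = P + P" using h by simp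
    have e2: "(1 / h) *\<^sub>R ((h\<^sup>2 / 2) *\<^sub>R du 2 a) = (1 / 2) *\<^sub>R (h *\<^sub>R du 2 a)"
      using h by (simp add: power2_eq_square)
    show ?thesis
      unfolding u scaleR_diff_right scaleR_add_right e1 e2 inverse_eq_divide P_def[symmetric]
      by (simp only: algebra_simps)
  qed
  also have "norm \<dots> \<le> 1 / 2 * (M * h) + 1 / h * (M * h * h)"
    using r1' r0 h by (intro order_trans[OF norm_triangle_ineq4] add_mono) (simp_all add: pos_divide_le_eq)
  also have "\<dots> \<le> 2 * M * h" using h M0 by simp
  finally have "(norm ((1 / 2) *\<^sub>R (du 1 b + du 1 a) - (u b - u a) /\<^sub>R h))\<^sup>2 \<le> (2 * M * h)\<^sup>2"
    by (intro power_mono) auto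
  also have "\<dots> = 4 * h\<^sup>2 * M\<^sup>2" by (simp add: power_mult_distrib)
  also have "\<dots> \<le> 4 * h\<^sup>2 * (h * (LINT t:{a<..<b}|lborel. (norm (du 3 t))\<^sup>2))"
    unfolding M_def h_def by (intro mult_left_mono L2_time_cauchy_schwarz[OF L2 ab]) auto
  finally show ?thesis by (simp add: h_def power3_eq_cube power2_eq_square mult.assoc)
qed

text \<open>Only three powers of the step appear here; the fourth comes from the factor
  \<open>dt\<close> in \<open>crank_nicolson_energy\<close>.\<close>

lemma trapezoid_error_sum:
  fixes u :: "real \<Rightarrow> 'a::euclidean_space l2"
  assumes reg: "H_time 3 T V u du" and T: "0 < T" and N: "1 \<le> N"
  defines "t \<equiv> time_grid T N" and "dt \<equiv> T / real N"
  shows "(\<Sum>n<N. (norm ((1 / 2) *\<^sub>R (du 1 (t (Suc n)) + du 1 (t n)) - (u (t (Suc n)) - u (t n)) /\<^sub>R dt))\<^sup>2)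
    \<le> 4 * dt ^ 3 * (L2_time_norm T (du 3))\<^sup>2"
proof -
  have dt: "0 < dt" using T N by (simp add: dt_def)
  have step: "t (Suc n) - t n = dt" for n by (simp add: t_def time_grid_def dt_def algebra_simps add_divide_distrib)
  have mono: "t n < t (Suc n)" "0 \<le> t n" for n using step[of n] dt T by (auto simp: t_def time_grid_def)
  have tT: "t n \<le> T" if "n \<le> N" for n
    using that T N by (simp add: t_def time_grid_def field_simps)
  define f where "f s = (norm (du 3 s))\<^sup>2" for s
  have f: "set_integrable lborel {0<..<T} f"
    using reg by (simp add: H_time_def L2_time_def f_def[abs_def])
  have fi: "set_integrable lborel S f" if "S \<in> sets borel" "S \<subseteq> {0<..<T}" for S
    using that by (intro set_integrable_subset[OF f]) auto
  \<comment> \<open>The open subintervals leave out the grid points. An inequality suffices, so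
    monotonicity of the integral in its domain takes care of them.\<close>
  have sum: "(\<Sum>n<k. LINT s:{t n<..<t (Suc n)}|lborel. f s) \<le> (LINT s:{0<..<t k}|lborel. f s)" if "k \<le> N" for k
    using that
  proof (induction k)
    case (Suc k)
    have "(\<Sum>n<Suc k. LINT s:{t n<..<t (Suc n)}|lborel. f s)
        \<le> (LINT s:{0<..<t k}|lborel. f s) + (LINT s:{t k<..<t (Suc k)}|lborel. f s)"
      using Suc by simp
    also have "\<dots> = (LINT s:{0<..<t k} \<union> {t k<..<t (Suc k)}|lborel. f s)"
      using tT[of k] tT[of "Suc k"] mono(2)[of k] Suc.prems
      by (intro set_integral_Un[symmetric] fi) auto
    also have "\<dots> \<le> (LINT s:{0<..<t (Suc k)}|lborel. f s)"
      using tT[of "Suc k"] mono[of k] Suc.prems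
      by (intro set_integral_nonneg_mono_set fi) (auto simp: f_def)
    finally show ?case .
  qed (simp add: set_lebesgue_integral_def f_def)
  have "(\<Sum>n<N. (norm ((1 / 2) *\<^sub>R (du 1 (t (Suc n)) + du 1 (t n)) - (u (t (Suc n)) - u (t n)) /\<^sub>R dt))\<^sup>2)
      \<le> (\<Sum>n<N. 4 * dt ^ 3 * (LINT s:{t n<..<t (Suc n)}|lborel. f s))"
  proof (rule sum_mono)
    fix n assume "n \<in> {..<N}"
    then show "(norm ((1 / 2) *\<^sub>R (du 1 (t (Suc n)) + du 1 (t n)) - (u (t (Suc n)) - u (t n)) /\<^sub>R dt))\<^sup>2
        \<le> 4 * dt ^ 3 * (LINT s:{t n<..<t (Suc n)}|lborel. f s)"
      using trapezoid_error[OF reg mono(2) mono(1) tT, of n] by (simp add: step f_def)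
  qed
  also have "\<dots> \<le> 4 * dt ^ 3 * (LINT s:{0<..<t N}|lborel. f s)"
    unfolding sum_distrib_left[symmetric] using dt by (intro mult_left_mono sum) auto
  also have "t N = T" using N by (simp add: t_def time_grid_def)
  also have "(LINT s:{0<..<T}|lborel. f s) = (L2_time_norm T (du 3))\<^sup>2"
    unfolding L2_time_norm_def f_def by (subst real_sqrt_pow2) (auto simp: set_lebesgue_integral_def)
  finally show ?thesis .
qed


section \<open>Proper orthogonal decomposition and projections\<close>

text \<open>The defect \<open>\<delta> - P\<close>, with \<open>P\<close> the orthogonal projection onto the span of the \<open>z i\<close>, has
  squared Frobenius norm \<open>M - 2 M + M = 0\<close>.\<close>

lemma orthonormal_columns_imp_rows:
  fixes z :: "nat \<Rightarrow> nat \<Rightarrow> real"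
  assumes orth: "\<And>i j. i \<in> {1..M} \<Longrightarrow> j \<in> {1..M} \<Longrightarrow> (\<Sum>m<M. z i m * z j m) = (if i = j then 1 else 0)"
    and mn: "m < M" "n < M"
  shows "(\<Sum>i=1..M. z i m * z i n) = (if m = n then 1 else 0)"
proof -
  define P where "P m n = (\<Sum>i=1..M. z i m * z i n)" for m n
  define d where "d m n = (if m = n then 1 else 0 :: real)" for m n :: nat
  have tr: "(\<Sum>m<M. P m m) = M"
    unfolding P_def by (subst sum.swap) (simp add: orth)
  have "(\<Sum>m<M. \<Sum>n<M. (P m n)\<^sup>2) = (\<Sum>m<M. \<Sum>n<M. \<Sum>i=1..M. \<Sum>j=1..M. (z i m * z j m) * (z i n * z j n))"
    by (simp add: P_def power2_eq_square sum_product algebra_simps)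
  also have "\<dots> = (\<Sum>m<M. \<Sum>i=1..M. \<Sum>n<M. \<Sum>j=1..M. (z i m * z j m) * (z i n * z j n))"
    by (intro sum.cong refl sum.swap)
  also have "\<dots> = (\<Sum>m<M. \<Sum>i=1..M. \<Sum>j=1..M. (z i m * z j m) * (\<Sum>n<M. z i n * z j n))"
    unfolding sum_distrib_left by (intro sum.cong refl sum.swap)
  also have "\<dots> = (\<Sum>i=1..M. \<Sum>m<M. \<Sum>j=1..M. (z i m * z j m) * (\<Sum>n<M. z i n * z j n))"
    by (rule sum.swap)
  also have "\<dots> = (\<Sum>i=1..M. \<Sum>j=1..M. (\<Sum>m<M. z i m * z j m) * (\<Sum>n<M. z i n * z j n))"
    unfolding sum_distrib_right by (intro sum.cong refl sum.swap)
  also have "\<dots> = (\<Sum>i=1..M. \<Sum>j=1..M. if i = j then 1 else 0)"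
    by (intro sum.cong refl) (simp add: orth)
  also have "\<dots> = M" by (simp add: sum.delta)
  finally have sq: "(\<Sum>m<M. \<Sum>n<M. (P m n)\<^sup>2) = M" .
  have "(\<Sum>m<M. \<Sum>n<M. (d m n - P m n)\<^sup>2) = (\<Sum>m<M. \<Sum>n<M. d m n - 2 * (d m n * P m n) + (P m n)\<^sup>2)"
    by (intro sum.cong refl) (auto simp: d_def power2_eq_square algebra_simps)
  also have "\<dots> = (\<Sum>m<M. \<Sum>n<M. d m n) - 2 * (\<Sum>m<M. \<Sum>n<M. d m n * P m n) + (\<Sum>m<M. \<Sum>n<M. (P m n)\<^sup>2)"
    by (simp add: sum.distrib sum_subtractf sum_distrib_left)
  also have "(\<Sum>m<M. \<Sum>n<M. d m n) = M" by (simp add: d_def sum.delta)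
  also have "(\<Sum>m<M. \<Sum>n<M. d m n * P m n) = M"
    using tr by (simp add: d_def if_distrib[of "\<lambda>x. x * _"] sum.delta cong: if_cong)
  finally have "(\<Sum>m<M. \<Sum>n<M. (d m n - P m n)\<^sup>2) = 0" using sq by simp
  then have "(\<Sum>n<M. (d m n - P m n)\<^sup>2) = 0"
    using mn by (subst (asm) sum_nonneg_eq_0_iff) (auto intro: sum_nonneg)
  then have "(d m n - P m n)\<^sup>2 = 0"
    using mn by (subst (asm) sum_nonneg_eq_0_iff) auto
  then show ?thesis by (simp add: d_def P_def)
qed

text \<open>Summation over m removes the mixed terms by orthonormality of the coefficient vectors
  \<open>z i\<close>, whatever the \<open>w i\<close> are. This is what allows POD errors to be
  measured in norms other than that of the POD inner product.\<close>

lemma sum_norm_orthonormal_combination: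
  fixes w :: "nat \<Rightarrow> 'b::real_inner" and z :: "nat \<Rightarrow> nat \<Rightarrow> real"
  assumes orth: "\<And>i j. i \<in> I \<Longrightarrow> j \<in> I \<Longrightarrow> (\<Sum>m<M. z i m * z j m) = (if i = j then 1 else 0)"
    and I: "finite I"
  shows "(\<Sum>m<M. (norm (\<Sum>i\<in>I. (c i * z i m) *\<^sub>R w i))\<^sup>2) = (\<Sum>i\<in>I. (c i)\<^sup>2 * (norm (w i))\<^sup>2)"
proof -
  have "(\<Sum>m<M. (norm (\<Sum>i\<in>I. (c i * z i m) *\<^sub>R w i))\<^sup>2)
      = (\<Sum>m<M. \<Sum>i\<in>I. \<Sum>j\<in>I. (z i m * z j m) * (c i * c j * (w i \<bullet> w j)))"
    by (simp add: power2_norm_eq_inner inner_sum_left inner_sum_right sum_distrib_left mult_ac inner_commute)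
  also have "\<dots> = (\<Sum>i\<in>I. \<Sum>m<M. \<Sum>j\<in>I. (z i m * z j m) * (c i * c j * (w i \<bullet> w j)))"
    by (rule sum.swap)
  also have "\<dots> = (\<Sum>i\<in>I. \<Sum>j\<in>I. (\<Sum>m<M. z i m * z j m) * (c i * c j * (w i \<bullet> w j)))"
    unfolding sum_distrib_right by (intro sum.cong refl sum.swap)
  also have "\<dots> = (\<Sum>i\<in>I. \<Sum>j\<in>I. if i = j then c i * c j * (w i \<bullet> w j) else 0)"
    by (intro sum.cong refl) (simp add: orth)
  also have "\<dots> = (\<Sum>i\<in>I. (c i)\<^sup>2 * (norm (w i))\<^sup>2)"
    using I by (simp add: power2_norm_eq_inner) (simp add: power2_eq_square)
  finally show ?thesis .
qed

text \<open>The eigenvalues are in decreasing order, so the positive ones fill an initial segment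
  and their number is its last index.\<close>

lemma num_positive_iff:
  assumes "ordered_eigensystem M K lam z" "i \<in> {1..M}"
  shows "0 < lam i \<longleftrightarrow> i \<le> num_positive M lam"
proof -
  define A where "A = {i\<in>{1..M}. 0 < lam i}"
  have mono: "lam j \<le> lam i" if "i \<in> {1..M}" "j \<in> {1..M}" "i \<le> j" for i j
    using assms(1) that unfolding ordered_eigensystem_def by blast
  have down: "j \<in> A" if "i \<in> A" "1 \<le> j" "j \<le> i" for i j
    using that mono[of j i] by (auto simp: A_def)
  have fin: "finite A" by (simp add: A_def)
  show ?thesis
  proof
    assume "0 < lam i"
    then have "{1..i} \<subseteq> A" using down[of i] assms(2) by (auto simp: A_def)
    then show "i \<le> num_positive M lam"
      using card_mono[OF fin, of "{1..i}"] by (simp add: num_positive_def A_def)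
  next
    assume i: "i \<le> num_positive M lam"
    show "0 < lam i"
    proof (rule ccontr)
      assume neg: "\<not> 0 < lam i"
      have "A \<subseteq> {1..<i}"
      proof
        fix j assume "j \<in> A"
        then show "j \<in> {1..<i}"
          using down[of j i] assms(2) neg by (cases "i \<le> j") (auto simp: A_def)
      qed
      then have "card A \<le> i - 1" using card_mono[of "{1..<i}" A] by simp
      moreover have "i \<le> card A" using i by (simp only: num_positive_def A_def)
      ultimately show False using assms(2) unfolding atLeastAtMost_iff by linarith
    qed
  qed
qed

lemma num_positive_le: "num_positive M lam \<le> M"
proof -
  have "card {i\<in>{1..M}. 0 < lam i} \<le> card {1..M}" by (rule card_mono) auto
  then show ?thesis by (simp add: num_positive_def)
qed

text \<open>The unnormalised modes \<open>g i\<close> are orthogonal with squared length M lam i,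
  because the correlation matrix multiplies \<open>z i\<close> by \<open>lam i\<close>.
  Orthonormality of the rows of \<open>z\<close> expands each snapshot in all the
  \<open>g i\<close>, and those with eigenvalue 0 vanish by definiteness.\<close>

lemma (in inner_product_on) pod_modes:
  fixes y :: "nat \<Rightarrow> 'b"
  assumes M: "0 < M" and y: "\<And>m. m < M \<Longrightarrow> y m \<in> V"
    and eig: "ordered_eigensystem M (\<lambda>m n. ip (y m) (y n) / real M) lam z"
  defines "mode i \<equiv> (1 / sqrt (lam i)) *\<^sub>R (1 / sqrt (real M)) *\<^sub>R (\<Sum>m<M. z i m *\<^sub>R y m)"
    and "s \<equiv> num_positive M lam"
  shows "mode i \<in> V"
    "i \<in> {1..s} \<Longrightarrow> j \<in> {1..s} \<Longrightarrow> ip (mode i) (mode j) = (if i = j then 1 else 0)"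
    "m < M \<Longrightarrow> y m = (\<Sum>i=1..s. (sqrt (real M * lam i) * z i m) *\<^sub>R mode i)"
proof -
  have eig_eq: "(\<Sum>n<M. ip (y m) (y n) / real M * z i n) = lam i * z i m" if "i \<in> {1..M}" "m < M" for i m
    using eig that unfolding ordered_eigensystem_def by blast
  have orth: "(\<Sum>m<M. z i m * z j m) = (if i = j then 1 else 0)" if "i \<in> {1..M}" "j \<in> {1..M}" for i j
    using eig that unfolding ordered_eigensystem_def by blast
  have nonneg: "0 \<le> lam i" if "i \<in> {1..M}" for i
    using eig that unfolding ordered_eigensystem_def by blast
  have sM: "s \<le> M" unfolding s_def by (rule num_positive_le)
  have pos: "0 < lam i \<longleftrightarrow> i \<le> s" if "i \<in> {1..M}" for i
    unfolding s_def by (rule num_positive_iff[OF eig that])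
  define g where "g i = (\<Sum>m<M. z i m *\<^sub>R y m)" for i
  have g: "g i \<in> V" for i unfolding g_def by (intro in_V) (use y in auto)
  have mode: "mode i = (1 / sqrt (real M * lam i)) *\<^sub>R g i" for i
    by (simp add: mode_def g_def real_sqrt_mult)
  then show "mode i \<in> V" using g by simp
  have gg: "ip (g i) (g j) = (if i = j then real M * lam j else 0)" if ij: "i \<in> {1..M}" "j \<in> {1..M}" for i j
  proof -
    have "ip (g i) (g j) = (\<Sum>m<M. ip (z i m *\<^sub>R y m) (g j))"
      unfolding g_def[of i] by (rule ip_sum_left) (use y g in simp_all)
    also have "\<dots> = (\<Sum>m<M. z i m * ip (y m) (g j))"
      by (rule sum.cong) (simp_all add: ip_scale_left y g)
    also have "\<dots> = (\<Sum>m<M. z i m * (\<Sum>n<M. z j n * ip (y m) (y n)))"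
    proof (intro sum.cong refl arg_cong2[where f="(*)"])
      fix m assume m: "m \<in> {..<M}"
      have "ip (y m) (g j) = (\<Sum>n<M. ip (y m) (z j n *\<^sub>R y n))"
        unfolding g_def by (rule ip_sum_right) (use y m in simp_all)
      also have "\<dots> = (\<Sum>n<M. z j n * ip (y m) (y n))"
        by (rule sum.cong) (use y m in \<open>simp_all add: ip_scale_right\<close>)
      finally show "ip (y m) (g j) = (\<Sum>n<M. z j n * ip (y m) (y n))" .
    qed
    also have "\<dots> = (\<Sum>m<M. z i m * (real M * (lam j * z j m)))"
    proof (intro sum.cong refl)
      fix m assume m: "m \<in> {..<M}"
      have "(\<Sum>n<M. z j n * ip (y m) (y n)) = real M * (\<Sum>n<M. ip (y m) (y n) / real M * z j n)"
        using M by (simp add: sum_distrib_left mult.commute)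
      then show "z i m * (\<Sum>n<M. z j n * ip (y m) (y n)) = z i m * (real M * (lam j * z j m))"
        using eig_eq[OF ij(2)] m by simp
    qed
    also have "\<dots> = real M * lam j * (\<Sum>m<M. z i m * z j m)"
      by (simp add: sum_distrib_left mult_ac)
    finally show ?thesis by (simp add: orth[OF ij])
  qed
  show "ip (mode i) (mode j) = (if i = j then 1 else 0)" if ij: "i \<in> {1..s}" "j \<in> {1..s}"
  proof -
    have ij': "i \<in> {1..M}" "j \<in> {1..M}" using ij sM by auto
    have "0 < lam j" using pos[OF ij'(2)] ij by simp
    then show ?thesis
      using M g by (simp add: mode ip_scale_left ip_scale_right gg[OF ij'])
  qed
  show "y m = (\<Sum>i=1..s. (sqrt (real M * lam i) * z i m) *\<^sub>R mode i)" if m: "m < M"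
  proof -
    have "(\<Sum>i=1..M. z i m *\<^sub>R g i) = (\<Sum>i=1..M. \<Sum>n<M. (z i m * z i n) *\<^sub>R y n)"
      by (simp add: g_def scaleR_sum_right)
    also have "\<dots> = (\<Sum>n<M. (\<Sum>i=1..M. z i m * z i n) *\<^sub>R y n)"
      unfolding scaleR_sum_left by (rule sum.swap)
    also have "\<dots> = (\<Sum>n<M. if m = n then y n else 0)"
      using orthonormal_columns_imp_rows[OF orth m] by (intro sum.cong) auto
    also have "\<dots> = y m" using m by simp
    finally have "y m = (\<Sum>i=1..M. z i m *\<^sub>R g i)" by simp
    also have "\<dots> = (\<Sum>i=1..s. z i m *\<^sub>R g i)"
    proof (rule sum.mono_neutral_right)
      show "\<forall>i\<in>{1..M} - {1..s}. z i m *\<^sub>R g i = 0"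
      proof
        fix i assume i: "i \<in> {1..M} - {1..s}"
        then have "lam i = 0" using pos[of i] nonneg[of i] by auto
        then have "ip (g i) (g i) = 0" using gg[of i i] i by simp
        then show "z i m *\<^sub>R g i = 0" using ip_definite[OF g] by simp
      qed
    qed (use sM in auto)
    also have "\<dots> = (\<Sum>i=1..s. (sqrt (real M * lam i) * z i m) *\<^sub>R mode i)"
    proof (intro sum.cong refl)
      fix i assume i: "i \<in> {1..s}"
      then have "0 < lam i" using pos[of i] sM by auto
      then show "z i m *\<^sub>R g i = (sqrt (real M * lam i) * z i m) *\<^sub>R mode i"
        using M by (simp add: mode)
    qed
    finally show ?thesis .
  qed
qed

text \<open>\<open>R\<close> is any function satisfying the orthogonality relation, as in
  \<open>is_ritz_projection\<close>; its linearity on \<open>V\<close> has to be derived, by way of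
  uniqueness, from definiteness.\<close>

locale subspace_projection = inner_product_on V ip for V :: "'b::real_vector set" and ip +
  fixes X :: "'b set" and R :: "'b \<Rightarrow> 'b"
  assumes X: "subspace X" "X \<subseteq> V"
    and R: "w \<in> V \<Longrightarrow> R w \<in> X" "w \<in> V \<Longrightarrow> v \<in> X \<Longrightarrow> ip (w - R w) v = 0"
begin

lemma R_in_V: "w \<in> V \<Longrightarrow> R w \<in> V"
  using R(1) X(2) by blast

lemma R_eqI:
  assumes "w \<in> V" "p \<in> X" and orth: "\<And>v. v \<in> X \<Longrightarrow> ip (w - p) v = 0"
  shows "R w = p"
proof -
  have p: "p \<in> V" using assms(2) X(2) by blast
  have d: "R w - p \<in> X" by (rule subspace_diff[OF X(1) R(1)[OF assms(1)] assms(2)])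
  have "ip (R w - p) (R w - p) = ip (w - p) (R w - p) - ip (w - R w) (R w - p)"
    using p R_in_V[OF assms(1)] assms(1) by (simp add: ip_diff_left)
  also have "\<dots> = 0" using orth[OF d] R(2)[OF assms(1) d] by simp
  finally have "ip (R w - p) (R w - p) = 0" .
  moreover have "R w - p \<in> V" using d X(2) by blast
  ultimately have "R w - p = 0" by (rule ip_definite[rotated])
  then show ?thesis by simp
qed

lemma R_id: "w \<in> X \<Longrightarrow> R w = w"
  using X(2) by (intro R_eqI) auto

lemma R_sum:
  assumes w: "\<And>i. i \<in> I \<Longrightarrow> w i \<in> V"
  shows "R (\<Sum>i\<in>I. c i *\<^sub>R w i) = (\<Sum>i\<in>I. c i *\<^sub>R R (w i))"
proof (rule R_eqI)
  show "(\<Sum>i\<in>I. c i *\<^sub>R R (w i)) \<in> X"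
    using w by (intro subspace_sum subspace_scale X(1) R(1))
  fix v assume v: "v \<in> X"
  then have vV: "v \<in> V" using X(2) by blast
  have "(\<Sum>i\<in>I. c i *\<^sub>R w i) - (\<Sum>i\<in>I. c i *\<^sub>R R (w i)) = (\<Sum>i\<in>I. c i *\<^sub>R (w i - R (w i)))"
    by (simp add: sum_subtractf scaleR_diff_right)
  also have "ip \<dots> v = (\<Sum>i\<in>I. ip (c i *\<^sub>R (w i - R (w i))) v)"
    using w R_in_V vV by (intro ip_sum_left) auto
  also have "\<dots> = 0"
    using w R_in_V vV R(2) v by (intro sum.neutral) (auto simp: ip_scale_left)
  finally show "ip ((\<Sum>i\<in>I. c i *\<^sub>R w i) - (\<Sum>i\<in>I. c i *\<^sub>R R (w i))) v = 0" .
qed (use w in auto)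

lemma R_scale_diff:
  assumes "u \<in> V" "v \<in> V"
  shows "R (c *\<^sub>R (u - v)) = c *\<^sub>R (R u - R v)"
proof -
  \<comment> \<open>The difference is written as a combination over two indices so that
    \<open>R_sum\<close> applies to it.\<close>
  have "R (\<Sum>i\<in>{True, False}. (if i then c else - c) *\<^sub>R (if i then u else v))
      = (\<Sum>i\<in>{True, False}. (if i then c else - c) *\<^sub>R R (if i then u else v))"
    by (rule R_sum) (use assms in auto)
  then show ?thesis by (simp add: scaleR_diff_right)
qed

text \<open>The first r modes lie in \<open>X\<close> and are reproduced by \<open>R\<close>, so by
  linearity only the later modes contribute.\<close>

lemma pod_projection_error:
  fixes mode :: "nat \<Rightarrow> 'b"
  assumes rep: "y = (\<Sum>i=1..s. c i *\<^sub>R mode i)" and mode: "\<And>i. mode i \<in> V"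
    and X_eq: "X = span (mode ` {1..r})" and r: "r \<le> s"
  shows "y - R y = (\<Sum>i=r+1..s. c i *\<^sub>R (mode i - R (mode i)))"
proof -
  have "y - R y = (\<Sum>i=1..s. c i *\<^sub>R (mode i - R (mode i)))"
    unfolding rep by (subst R_sum) (auto simp: mode sum_subtractf scaleR_diff_right)
  also have "\<dots> = (\<Sum>i=r+1..s. c i *\<^sub>R (mode i - R (mode i)))"
  proof (rule sum.mono_neutral_right)
    show "\<forall>i\<in>{1..s} - {r + 1..s}. c i *\<^sub>R (mode i - R (mode i)) = 0"
    proof
      fix i assume "i \<in> {1..s} - {r + 1..s}"
      then have "mode i \<in> X" unfolding X_eq by (intro span_base imageI) auto
      then show "c i *\<^sub>R (mode i - R (mode i)) = 0" by (simp add: R_id)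
    qed
  qed (use r in auto)
  finally show ?thesis .
qed

end

text \<open>With the difference quotient d as test vector, \<open>a\<close> of the average and d is
  the increment of the energy divided by 2 dt, which telescopes. Young's inequality in the form q .
  d \<le> d . d + (norm q)^2 / 4 absorbs d . d completely; this gives the factor dt / (2 \<nu>) and
  no growth with k.\<close>

lemma crank_nicolson_energy:
  fixes p q :: "nat \<Rightarrow> 'b::real_inner"
  assumes "inner_product_on V a" and X: "subspace X" "X \<subseteq> V"
    and p: "\<And>n. n \<le> N \<Longrightarrow> p n \<in> X" and pos: "0 < dt" "0 < \<nu>"
    and eq: "\<And>n v. n < N \<Longrightarrow> v \<in> X \<Longrightarrow>
      ((p (Suc n) - p n) /\<^sub>R dt) \<bullet> v + \<nu> * a ((1 / 2) *\<^sub>R (p (Suc n) + p n)) v = q n \<bullet> v"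
    and k: "k \<le> N"
  shows "a (p k) (p k) \<le> a (p 0) (p 0) + dt / (2 * \<nu>) * (\<Sum>n<k. (norm (q n))\<^sup>2)"
  using k
proof (induction k)
  case (Suc k)
  interpret inner_product_on V a by fact
  have pX: "p k \<in> X" "p (Suc k) \<in> X" using p Suc.prems by auto
  then have pV: "p k \<in> V" "p (Suc k) \<in> V" using X by auto
  define d where "d = (p (Suc k) - p k) /\<^sub>R dt"
  have "d \<in> X" unfolding d_def using pX by (intro subspace_scale subspace_diff X(1))
  then have e1: "d \<bullet> d + \<nu> * a ((1 / 2) *\<^sub>R (p (Suc k) + p k)) d = q k \<bullet> d"
    using eq[of k d] Suc.prems by (simp add: d_def)
  have e2: "a ((1 / 2) *\<^sub>R (p (Suc k) + p k)) d = (a (p (Suc k)) (p (Suc k)) - a (p k) (p k)) / (2 * dt)"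
  proof -
    have "a ((1 / 2) *\<^sub>R (p (Suc k) + p k)) d
        = (1 / 2) * (inverse dt * (a (p (Suc k)) (p (Suc k)) - a (p (Suc k)) (p k)
            + (a (p k) (p (Suc k)) - a (p k) (p k))))"
      using pV by (simp add: d_def ip_scale_left ip_scale_right ip_add_left ip_diff_right add_divide_distrib)
    then show ?thesis using ip_commute[OF pV] by (simp add: inverse_eq_divide)
  qed
  have "q k \<bullet> d \<le> d \<bullet> d + (norm (q k))\<^sup>2 / 4"
  proof -
    have "0 \<le> (norm (d - (1 / 2) *\<^sub>R q k))\<^sup>2" by simp
    also have "\<dots> = d \<bullet> d - q k \<bullet> d + (norm (q k))\<^sup>2 / 4"
      by (simp add: power2_norm_eq_inner inner_diff_left inner_diff_right inner_commute)
    finally show ?thesis by simp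
  qed
  then have "\<nu> * ((a (p (Suc k)) (p (Suc k)) - a (p k) (p k)) / (2 * dt)) \<le> (norm (q k))\<^sup>2 / 4"
    using e1 unfolding e2 by linarith
  then have "a (p (Suc k)) (p (Suc k)) - a (p k) (p k) \<le> dt / (2 * \<nu>) * (norm (q k))\<^sup>2"
    using pos by (simp add: field_simps)
  then show ?case using Suc by (simp add: distrib_left)
qed simp

text \<open>The difference quotients make the averaged bound over the snapshots a pointwise one.\<close>

lemma difference_quotient_pointwise_bound:
  fixes W :: "nat \<Rightarrow> 'b::real_normed_vector"
  assumes T: "0 < T" and N: "1 \<le> N" and k: "k \<le> N"
    and dq: "\<And>l. 1 \<le> l \<Longrightarrow> l \<le> N \<Longrightarrow> W l - W (l - 1) = (T / real N) *\<^sub>R W (N + l)"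
  shows "(norm (W k))\<^sup>2 \<le> (4 + 6 * T\<^sup>2) * ((\<Sum>m<2 * N + 1. (norm (W m))\<^sup>2) / real (2 * N + 1))"
proof -
  define S where "S = (\<Sum>m<2 * N + 1. (norm (W m))\<^sup>2)"
  define Q where "Q = (\<Sum>l=1..N. (norm (W (N + l)))\<^sup>2)"
  have split: "S = (\<Sum>j\<le>N. (norm (W j))\<^sup>2) + Q"
  proof -
    have "{..<2 * N + 1} = {..N} \<union> {N + 1..N + N}" by auto
    then have "S = (\<Sum>j\<le>N. (norm (W j))\<^sup>2) + (\<Sum>m=N+1..N+N. (norm (W m))\<^sup>2)"
      unfolding S_def by (simp only:) (subst sum.union_disjoint, auto)
    also have "(\<Sum>m=N+1..N+N. (norm (W m))\<^sup>2) = Q"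
      unfolding Q_def using sum.shift_bounds_cl_nat_ivl[of "\<lambda>m. (norm (W m))\<^sup>2" 1 N N] by (simp add: add.commute)
    finally show ?thesis .
  qed
  have incr: "norm (W k - W j) \<le> T / real N * (\<Sum>l=1..N. norm (W (N + l)))" if "j \<le> k" "k \<le> N" for j k
  proof -
    have "W k - W j = (\<Sum>l=j+1..k. W l - W (l - 1))"
      using sum_telescope''[OF that(1), of W] by simp
    also have "norm \<dots> \<le> (\<Sum>l=j+1..k. norm (W l - W (l - 1)))" by (rule norm_sum)
    also have "\<dots> = (\<Sum>l=j+1..k. T / real N * norm (W (N + l)))"
    proof (intro sum.cong refl)
      fix l assume "l \<in> {j + 1..k}"
      then have "W l - W (l - 1) = (T / real N) *\<^sub>R W (N + l)" using that by (intro dq) auto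
      then show "norm (W l - W (l - 1)) = T / real N * norm (W (N + l))" using T by simp
    qed
    also have "\<dots> \<le> (\<Sum>l=1..N. T / real N * norm (W (N + l)))"
      using that T by (intro sum_mono2) auto
    finally show ?thesis by (simp add: sum_distrib_left)
  qed
  \<comment> \<open>At most N increments, each weighted by T / N, separate two nodes, so
    Cauchy-Schwarz bounds the squared distance by T^2 / N times Q.\<close>
  have "(\<Sum>l=1..N. norm (W (N + l)))\<^sup>2 \<le> real N * Q"
    using Cauchy_Schwarz_ineq_sum[of "\<lambda>_. 1" "\<lambda>l. norm (W (N + l))" "{1..N}"]
    by (simp add: Q_def)
  then have incr2: "(norm (W k - W j))\<^sup>2 \<le> T\<^sup>2 / real N * Q" if j: "j \<le> N" for j
  proof -
    have "norm (W k - W j) \<le> T / real N * (\<Sum>l=1..N. norm (W (N + l)))"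
      using incr[of j k] incr[of k j] j k by (cases "j \<le> k") (auto simp: norm_minus_commute)
    then have "(norm (W k - W j))\<^sup>2 \<le> (T / real N * (\<Sum>l=1..N. norm (W (N + l))))\<^sup>2"
      by (intro power_mono) auto
    also have "\<dots> \<le> (T / real N)\<^sup>2 * (real N * Q)"
      unfolding power_mult_distrib by (intro mult_left_mono) (use \<open>_ \<le> real N * Q\<close> in auto)
    also have "\<dots> = T\<^sup>2 / real N * Q" using N by (simp add: power2_eq_square)
    finally show ?thesis .
  qed
  have tri: "(norm (W k))\<^sup>2 \<le> 2 * (norm (W j))\<^sup>2 + 2 * (T\<^sup>2 / real N * Q)" if "j \<le> N" for j
  proof -
    have "norm (W k) \<le> norm (W j) + norm (W k - W j)"
      using norm_triangle_ineq[of "W j" "W k - W j"] by simp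
    then have "(norm (W k))\<^sup>2 \<le> (norm (W j) + norm (W k - W j))\<^sup>2" by (intro power_mono) auto
    also have "\<dots> \<le> 2 * (norm (W j))\<^sup>2 + 2 * (norm (W k - W j))\<^sup>2"
      using sum_squares_bound[of "norm (W j)" "norm (W k - W j)"] by (simp add: power2_sum)
    finally show ?thesis using incr2[OF that] by linarith
  qed
  \<comment> \<open>Averaging over all nodes j replaces the unknown value at a single node by a mean
    square.\<close>
  have "(\<Sum>j\<le>N. (norm (W k))\<^sup>2) \<le> (\<Sum>j\<le>N. 2 * (norm (W j))\<^sup>2 + 2 * (T\<^sup>2 / real N * Q))"
    by (intro sum_mono tri) simp
  then have avg: "real (N + 1) * (norm (W k))\<^sup>2
      \<le> 2 * (\<Sum>j\<le>N. (norm (W j))\<^sup>2) + real (N + 1) * (2 * (T\<^sup>2 / real N * Q))"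
    by (simp add: sum.distrib flip: sum_distrib_left)
  have QS: "0 \<le> Q" "Q \<le> S" "(\<Sum>j\<le>N. (norm (W j))\<^sup>2) \<le> S" "0 \<le> S"
    using split by (auto simp: Q_def S_def sum_nonneg)
  have "real (N + 1) * (norm (W k))\<^sup>2 \<le> real (N + 1) * (2 * S / real (N + 1) + 2 * (T\<^sup>2 / real N * S))"
  proof -
    have "T\<^sup>2 / real N * Q \<le> T\<^sup>2 / real N * S" using QS by (intro mult_left_mono) auto
    then have "2 * (T\<^sup>2 / real N * Q) \<le> 2 * (T\<^sup>2 / real N * S)" by linarith
    then have "real (N + 1) * (2 * (T\<^sup>2 / real N * Q)) \<le> real (N + 1) * (2 * (T\<^sup>2 / real N * S))"
      by (rule mult_left_mono) simp
    moreover have "real (N + 1) * (2 * S / real (N + 1)) = 2 * S" by simp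
    ultimately show ?thesis using avg QS(3) unfolding distrib_left[of "real (N + 1)" "2 * S / real (N + 1)"] by linarith
  qed
  then have "(norm (W k))\<^sup>2 \<le> 2 * S / real (N + 1) + 2 * (T\<^sup>2 / real N * S)"
    by (rule mult_left_le_imp_le) simp
  \<comment> \<open>The constants 4 and 6 come from 2 / (N + 1) \<le> 4 / (2 N + 1) and, for N \<ge>
    1, from 2 / N \<le> 6 / (2 N + 1).\<close>
  also have "2 * S / real (N + 1) \<le> 4 * (S / real (2 * N + 1))"
    using QS(4) by (simp add: field_simps mult_left_mono)
  also have "2 * (T\<^sup>2 / real N * S) \<le> 6 * T\<^sup>2 * (S / real (2 * N + 1))"
  proof -
    have "1 / real N \<le> 3 / real (2 * N + 1)" using N by (simp add: field_simps)
    then have "(2 * T\<^sup>2 * S) * (1 / real N) \<le> (2 * T\<^sup>2 * S) * (3 / real (2 * N + 1))"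
      using QS(4) by (intro mult_left_mono) auto
    then show ?thesis by simp
  qed
  finally show ?thesis unfolding S_def[symmetric] by (simp only: distrib_right)
qed


section \<open>The error estimate\<close>

lemma H10_weak_grad_sum:
  assumes \<Omega>: "open \<Omega>" and b: "b \<in> Basis" and w: "\<And>i. i \<in> I \<Longrightarrow> w i \<in> H10 \<Omega>"
  shows "weak_grad \<Omega> b (\<Sum>i\<in>I. c i *\<^sub>R w i) = (\<Sum>i\<in>I. c i *\<^sub>R weak_grad \<Omega> b (w i))"
proof -
  have 0: "0 \<in> H10 \<Omega>" by (rule subspace_0[OF subspace_H10[OF \<Omega>]])
  have "weak_grad \<Omega> b 0 = 0"
    using H1_weak_grad_linear(2)[OF \<Omega> _ _ b, of 0 0 1] 0 H10_subset_H1 by auto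
  then show ?thesis
    using w
  proof (induction I rule: infinite_finite_induct)
    case (insert i I)
    have "w i \<in> H1 \<Omega>" using insert.prems H10_subset_H1 by auto
    moreover have "(\<Sum>i\<in>I. c i *\<^sub>R w i) \<in> H10 \<Omega>"
      using insert.prems by (intro subspace_sum subspace_scale subspace_H10[OF \<Omega>]) auto
    then have "(\<Sum>i\<in>I. c i *\<^sub>R w i) \<in> H1 \<Omega>" using H10_subset_H1 by auto
    ultimately show ?case
      using insert by (simp add: H1_weak_grad_linear(2)[OF \<Omega> _ _ b])
  qed simp_all
qed

lemma time_grid_mem: "0 < T \<Longrightarrow> 1 \<le> N \<Longrightarrow> n \<le> N \<Longrightarrow> time_grid T N n \<in> {0..T}"
  by (auto simp: time_grid_def field_simps)

lemma dq_snapshots_quotient: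
  "1 \<le> l \<Longrightarrow> dq_snapshots T N u (N + l) = (u (time_grid T N l) - u (time_grid T N (l - 1))) /\<^sub>R (T / real N)"
  by (simp add: dq_snapshots_def)

lemma (in inner_product_on) dq_pod_modes:
  assumes u: "\<And>n. n \<le> N \<Longrightarrow> u (time_grid T N n) \<in> V"
    and eig: "ordered_eigensystem (2 * N + 1) (pod_matrix T N ip u) lam z"
  defines "s \<equiv> num_positive (2 * N + 1) lam" and "\<phi> \<equiv> pod_mode T N u lam z"
  shows "m < 2 * N + 1 \<Longrightarrow> dq_snapshots T N u m \<in> V" "\<phi> i \<in> V"
    "i \<in> {1..s} \<Longrightarrow> j \<in> {1..s} \<Longrightarrow> ip (\<phi> i) (\<phi> j) = (if i = j then 1 else 0)"
    "m < 2 * N + 1 \<Longrightarrow> dq_snapshots T N u m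
      = (\<Sum>i=1..s. (sqrt (real (2 * N + 1) * lam i) * z i m) *\<^sub>R \<phi> i)"
proof -
  define y where "y = dq_snapshots T N u"
  define M where "M = 2 * N + 1"
  have M: "0 < M" by (simp add: M_def)
  have y: "y m \<in> V" if "m < M" for m
    using that u by (auto simp: y_def dq_snapshots_def M_def)
  have "pod_matrix T N ip u = (\<lambda>m n. ip (y m) (y n) / real M)"
    by (simp add: pod_matrix_def[abs_def] y_def M_def)
  with eig have eig': "ordered_eigensystem M (\<lambda>m n. ip (y m) (y n) / real M) lam z"
    by (simp add: M_def)
  have \<phi>: "\<phi> i = (1 / sqrt (lam i)) *\<^sub>R (1 / sqrt (real M)) *\<^sub>R (\<Sum>m<M. z i m *\<^sub>R y m)" for i
    unfolding \<phi>_def pod_mode_def y_def M_def by (simp add: lessThan_Suc_atMost)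
  show "dq_snapshots T N u m \<in> V" if "m < 2 * N + 1"
    using y[of m] that by (simp add: y_def M_def)
  show "\<phi> i \<in> V"
    unfolding \<phi> by (rule pod_modes(1)[OF M _ eig']) (rule y)
  show "ip (\<phi> i) (\<phi> j) = (if i = j then 1 else 0)" if "i \<in> {1..s}" "j \<in> {1..s}"
    unfolding \<phi> by (rule pod_modes(2)[OF M _ eig']) (use y that in \<open>auto simp: s_def M_def\<close>)
  show "dq_snapshots T N u m = (\<Sum>i=1..s. (sqrt (real (2 * N + 1) * lam i) * z i m) *\<^sub>R \<phi> i)"
    if "m < 2 * N + 1"
    unfolding s_def \<phi> M_def[symmetric] y_def[symmetric]
    by (rule pod_modes(3)[OF M _ eig' that[folded M_def]]) (rule y)
qed

text \<open>\<open>ip\<close> enters only through the expansion of the snapshots in the modes, and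
  \<open>R\<close> is the gradient projection in either case, so both bases are covered, with the
  tail of the \<open>L\<^sup>2\<close> estimate.\<close>

lemma pod_rom_error_bound:
  fixes \<Omega> :: "'a::euclidean_space set" and u f :: "real \<Rightarrow> 'a l2"
  assumes \<Omega>: "open \<Omega>" "bounded \<Omega>" and pos: "\<nu> > 0" "T > 0" and N: "1 \<le> N"
    and u_reg: "H_time 3 T W u du" and heat: "heat_weak_solution \<Omega> \<nu> T f u (du 1)"
    and ip: "inner_product_on (H10 \<Omega>) ip"
    and eig: "ordered_eigensystem (2 * N + 1) (pod_matrix T N ip u) lam z"
  defines "s \<equiv> num_positive (2 * N + 1) lam" and "\<phi> \<equiv> pod_mode T N u lam z"
    and "C \<equiv> 10 + 12 * T\<^sup>2 + 6 * T / \<nu> + 8 / \<nu>"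
  assumes r: "r \<in> {1..s}" and ritz: "is_ritz_projection \<Omega> (pod_space T N u lam z r) R"
    and rom: "cn_pod_g_rom \<Omega> \<nu> T N f (pod_space T N u lam z r) ur"
    and k: "k \<in> {1..N}"
  shows "(grad_norm \<Omega> (u (time_grid T N k) - ur k))\<^sup>2
    \<le> C * ((\<Sum>i=r+1..s. lam i * ((norm (\<phi> i - R (\<phi> i)))\<^sup>2 + (grad_norm \<Omega> (\<phi> i - R (\<phi> i)))\<^sup>2))
        + (grad_norm \<Omega> (ur 0 - R (u (time_grid T N 0))))\<^sup>2
        + (T / real N) ^ 4 * (L2_time_norm T (du 3))\<^sup>2)"
proof -
  interpret P: inner_product_on "H10 \<Omega>" ip by (rule ip)
  interpret G: inner_product_on "H10 \<Omega>" "grad_inner \<Omega>"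
    by (rule inner_product_on_grad_inner[OF \<Omega>])
  define M where "M = 2 * N + 1"
  define dt where "dt = T / real N"
  define t where "t = time_grid T N"
  define y where "y = dq_snapshots T N u"
  define X where "X = pod_space T N u lam z r"
  have dt: "0 < dt" using pos N by (simp add: dt_def)
  have t: "t n \<in> {0..T}" if "n \<le> N" for n
    unfolding t_def using that pos N by (intro time_grid_mem) auto
  have uV: "u (t n) \<in> H10 \<Omega>" if "n \<le> N" for n
    using heat t[OF that] by (simp add: heat_weak_solution_def)
  have yV: "y m \<in> H10 \<Omega>" if "m < M" for m
    unfolding y_def by (rule P.dq_pod_modes(1)[OF uV[unfolded t_def] eig that[unfolded M_def]])
  have y_node: "y n = u (t n)" if "n \<le> N" for n
    using that by (simp add: y_def dq_snapshots_def t_def)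
  have y_dq: "y (N + l) = (y l - y (l - 1)) /\<^sub>R dt" if "1 \<le> l" "l \<le> N" for l
    using dq_snapshots_quotient[OF that(1), of T N u] that by (simp add: y_node) (simp add: y_def t_def dt_def)
  have \<phi>V: "\<phi> i \<in> H10 \<Omega>" for i
    unfolding \<phi>_def by (rule P.dq_pod_modes(2)[OF uV[unfolded t_def] eig])
  have y_rep: "y m = (\<Sum>i=1..s. (sqrt (real M * lam i) * z i m) *\<^sub>R \<phi> i)" if "m < M" for m
    unfolding y_def \<phi>_def s_def M_def
    by (rule P.dq_pod_modes(4)[OF uV[unfolded t_def] eig that[unfolded M_def]])
  have X_eq: "X = span (\<phi> ` {1..r})" by (simp add: X_def pod_space_def \<phi>_def)
  have XV: "X \<subseteq> H10 \<Omega>" unfolding X_eq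
    by (rule span_minimal[OF _ G.subspace]) (use \<phi>V in auto)
  have sX: "subspace X" by (simp add: X_eq)
  interpret R: subspace_projection "H10 \<Omega>" "grad_inner \<Omega>" X R
    using ritz sX XV by unfold_locales (auto simp: is_ritz_projection_def X_def)
  define \<eta> where "\<eta> m = y m - R (y m)" for m
  have \<eta>V: "\<eta> m \<in> H10 \<Omega>" if "m < M" for m
    unfolding \<eta>_def using yV[OF that] R.R_in_V by simp
  define \<rho> where "\<rho> i = \<phi> i - R (\<phi> i)" for i
  have \<rho>V: "\<rho> i \<in> H10 \<Omega>" for i
    unfolding \<rho>_def using \<phi>V R.R_in_V by simp
  have \<eta>_rep: "\<eta> m = (\<Sum>i\<in>{r+1..s}. (sqrt (real M * lam i) * z i m) *\<^sub>R \<rho> i)" if "m < M" for m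
    unfolding \<eta>_def \<rho>_def
    by (rule R.pod_projection_error[OF y_rep[OF that] \<phi>V X_eq]) (use r in auto)
  have sM: "s \<le> M" unfolding s_def M_def by (rule num_positive_le)
  have orth: "(\<Sum>m<M. z i m * z j m) = (if i = j then 1 else 0)" if "i \<in> {r+1..s}" "j \<in> {r+1..s}" for i j
    using eig that sM unfolding ordered_eigensystem_def M_def by auto
  have lam: "0 \<le> lam i" if "i \<in> {r+1..s}" for i
    using eig that sM unfolding ordered_eigensystem_def M_def by auto
  have c2: "(sqrt (real M * lam i))\<^sup>2 = real M * lam i" if "i \<in> {r+1..s}" for i
    using lam[OF that] by simp
  define \<Lambda>0 where "\<Lambda>0 = (\<Sum>i=r+1..s. lam i * (norm (\<rho> i))\<^sup>2)"
  define \<Lambda>1 where "\<Lambda>1 = (\<Sum>i=r+1..s. lam i * (grad_norm \<Omega> (\<rho> i))\<^sup>2)"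
  \<comment> \<open>Used with \<rho> for the \<open>L\<^sup>2\<close> tail and with each weak
    partial derivative of \<rho> for the gradient tail.\<close>
  have combination: "(\<Sum>m<M. (norm (\<Sum>i\<in>{r+1..s}. (sqrt (real M * lam i) * z i m) *\<^sub>R w i))\<^sup>2)
      = (\<Sum>i=r+1..s. real M * lam i * (norm (w i))\<^sup>2)" for w :: "nat \<Rightarrow> 'a l2"
    by (subst sum_norm_orthonormal_combination[OF orth]) (simp_all only: finite_atLeastAtMost c2 cong: sum.cong)
  have S0: "(\<Sum>m<M. (norm (\<eta> m))\<^sup>2) = real M * \<Lambda>0"
  proof -
    have "(\<Sum>m<M. (norm (\<eta> m))\<^sup>2)
        = (\<Sum>m<M. (norm (\<Sum>i\<in>{r+1..s}. (sqrt (real M * lam i) * z i m) *\<^sub>R \<rho> i))\<^sup>2)"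
      by (intro sum.cong refl) (simp only: \<eta>_rep lessThan_iff)
    also have "\<dots> = real M * \<Lambda>0"
      unfolding combination \<Lambda>0_def sum_distrib_left by (simp only: mult.assoc)
    finally show ?thesis .
  qed
  have S1: "(\<Sum>m<M. (norm (weak_grad \<Omega> b (\<eta> m)))\<^sup>2)
      = (\<Sum>i=r+1..s. real M * lam i * (norm (weak_grad \<Omega> b (\<rho> i)))\<^sup>2)" if b: "b \<in> Basis" for b
  proof -
    have "weak_grad \<Omega> b (\<eta> m)
        = (\<Sum>i\<in>{r+1..s}. (sqrt (real M * lam i) * z i m) *\<^sub>R weak_grad \<Omega> b (\<rho> i))" if "m < M" for m
      unfolding \<eta>_rep[OF that] by (rule H10_weak_grad_sum[OF \<Omega>(1) b \<rho>V])
    then have "(\<Sum>m<M. (norm (weak_grad \<Omega> b (\<eta> m)))\<^sup>2)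
        = (\<Sum>m<M. (norm (\<Sum>i\<in>{r+1..s}. (sqrt (real M * lam i) * z i m) *\<^sub>R weak_grad \<Omega> b (\<rho> i)))\<^sup>2)"
      by (intro sum.cong refl) (simp only: lessThan_iff)
    then show ?thesis unfolding combination .
  qed
  have \<eta>_dq: "\<eta> l - \<eta> (l - 1) = dt *\<^sub>R \<eta> (N + l)" if l: "1 \<le> l" "l \<le> N" for l
  proof -
    have V: "y l \<in> H10 \<Omega>" "y (l - 1) \<in> H10 \<Omega>" using l by (auto intro!: yV simp: M_def)
    show ?thesis
      using dt unfolding \<eta>_def y_dq[OF l] R.R_scale_diff[OF V] by (simp add: scaleR_diff_right)
  qed
  \<comment> \<open>The pointwise bound is applied to each weak partial derivative, a vector of
    \<open>l2\<close>, and then summed over the basis directions.\<close>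
  have grad_eta: "(grad_norm \<Omega> (\<eta> k))\<^sup>2 \<le> (4 + 6 * T\<^sup>2) * \<Lambda>1"
  proof -
    have "(norm (weak_grad \<Omega> b (\<eta> k)))\<^sup>2
        \<le> (4 + 6 * T\<^sup>2) * (\<Sum>i=r+1..s. lam i * (norm (weak_grad \<Omega> b (\<rho> i)))\<^sup>2)" if b: "b \<in> Basis" for b
    proof -
      have "(norm (weak_grad \<Omega> b (\<eta> k)))\<^sup>2
          \<le> (4 + 6 * T\<^sup>2) * ((\<Sum>m<2 * N + 1. (norm (weak_grad \<Omega> b (\<eta> m)))\<^sup>2) / real (2 * N + 1))"
      proof (rule difference_quotient_pointwise_bound[OF pos(2) N])
        fix l assume l: "1 \<le> l" "l \<le> N"
        have H1: "\<eta> l \<in> H1 \<Omega>" "\<eta> (l - 1) \<in> H1 \<Omega>" "\<eta> (N + l) \<in> H1 \<Omega>"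
          using l by (auto intro!: subsetD[OF H10_subset_H1] \<eta>V simp: M_def)
        have "\<eta> l = dt *\<^sub>R \<eta> (N + l) + \<eta> (l - 1)" using \<eta>_dq[OF l] by (simp add: algebra_simps)
        then have "weak_grad \<Omega> b (\<eta> l) = dt *\<^sub>R weak_grad \<Omega> b (\<eta> (N + l)) + weak_grad \<Omega> b (\<eta> (l - 1))"
          using H1_weak_grad_linear(2)[OF \<Omega>(1) H1(3,2) b, of dt] by simp
        then show "weak_grad \<Omega> b (\<eta> l) - weak_grad \<Omega> b (\<eta> (l - 1)) = (T / real N) *\<^sub>R weak_grad \<Omega> b (\<eta> (N + l))"
          by (simp add: dt_def)
      qed (use k in auto)
      also have "(\<Sum>m<2 * N + 1. (norm (weak_grad \<Omega> b (\<eta> m)))\<^sup>2) / real (2 * N + 1)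
          = (\<Sum>i=r+1..s. lam i * (norm (weak_grad \<Omega> b (\<rho> i)))\<^sup>2)"
        unfolding S1[OF b, unfolded M_def] by (simp add: mult.assoc flip: sum_distrib_left)
      finally show ?thesis .
    qed
    then have "(\<Sum>b\<in>Basis. (norm (weak_grad \<Omega> b (\<eta> k)))\<^sup>2)
        \<le> (\<Sum>b\<in>Basis. (4 + 6 * T\<^sup>2) * (\<Sum>i=r+1..s. lam i * (norm (weak_grad \<Omega> b (\<rho> i)))\<^sup>2))"
      by (rule sum_mono)
    also have "\<dots> = (4 + 6 * T\<^sup>2) * \<Lambda>1"
      unfolding \<Lambda>1_def grad_norm_power2 sum_distrib_left[symmetric]
      by (subst sum.swap) (simp add: sum_distrib_left)
    finally show ?thesis by (simp add: grad_norm_power2)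
  qed
  define p where "p n = ur n - R (u (t n))" for n
  define \<tau> where "\<tau> n = (1 / 2) *\<^sub>R (du 1 (t (Suc n)) + du 1 (t n)) - (u (t (Suc n)) - u (t n)) /\<^sub>R dt" for n
  have urX: "ur n \<in> X" if "n \<le> N" for n
    using rom that by (simp add: cn_pod_g_rom_def X_def)
  have pX: "p n \<in> X" if "n \<le> N" for n
    unfolding p_def by (intro subspace_diff sX urX R.R(1) uV that)
  \<comment> \<open>\<open>\<eta> (N + Suc n)\<close> is the projection error of a difference
    quotient snapshot and, \<open>R\<close> being linear, the difference quotient of \<eta> over
    step n.\<close>
  have energy: "grad_inner \<Omega> (p k) (p k)
      \<le> grad_inner \<Omega> (p 0) (p 0) + dt / (2 * \<nu>) * (\<Sum>n<k. (norm (\<tau> n + \<eta> (N + Suc n)))\<^sup>2)"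
  proof (rule crank_nicolson_energy[OF G.inner_product_on_axioms sX XV pX dt pos(1)])
    fix n v assume n: "n < N" and v: "v \<in> X"
    have vV: "v \<in> H10 \<Omega>" using v XV by blast
    have V: "u (t (Suc n)) \<in> H10 \<Omega>" "u (t n) \<in> H10 \<Omega>" "ur (Suc n) \<in> H10 \<Omega>" "ur n \<in> H10 \<Omega>"
      "R (u (t (Suc n))) \<in> H10 \<Omega>" "R (u (t n)) \<in> H10 \<Omega>"
      using n uV[of "Suc n"] uV[of n] urX[of "Suc n"] urX[of n] XV R.R_in_V by auto
    have rom_eq: "((ur (Suc n) - ur n) /\<^sub>R dt) \<bullet> v + \<nu> * grad_inner \<Omega> ((1 / 2) *\<^sub>R (ur (Suc n) + ur n)) v
        = ((1 / 2) *\<^sub>R (f (t (Suc n)) + f (t n))) \<bullet> v"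
      using rom n v by (simp add: cn_pod_g_rom_def X_def t_def dt_def)
    have heat_eq: "du 1 (t m) \<bullet> v + \<nu> * grad_inner \<Omega> (u (t m)) v = f (t m) \<bullet> v" if "m \<le> N" for m
      using heat t[OF that] vV by (simp add: heat_weak_solution_def)
    have ritz_eq: "grad_inner \<Omega> (R (u (t m))) v = grad_inner \<Omega> (u (t m)) v" if "m \<le> N" for m
      using R.R(2)[OF uV[OF that] v] uV[OF that] R.R_in_V vV by (simp add: G.ip_diff_left)
    have \<eta>_eq: "\<eta> (N + Suc n) = (u (t (Suc n)) - u (t n)) /\<^sub>R dt - (R (u (t (Suc n))) - R (u (t n))) /\<^sub>R dt"
      using n V y_dq[of "Suc n"] by (simp add: \<eta>_def y_node R.R_scale_diff)
    have a: "grad_inner \<Omega> ((1 / 2) *\<^sub>R (p (Suc n) + p n)) v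
        = grad_inner \<Omega> ((1 / 2) *\<^sub>R (ur (Suc n) + ur n)) v
          - (1 / 2) * (grad_inner \<Omega> (u (t (Suc n))) v + grad_inner \<Omega> (u (t n)) v)"
      using V vV n by (simp add: p_def G.ip_scale_left G.ip_add_left G.ip_diff_left ritz_eq algebra_simps)
    have d: "((p (Suc n) - p n) /\<^sub>R dt) \<bullet> v
        = ((ur (Suc n) - ur n) /\<^sub>R dt) \<bullet> v - ((R (u (t (Suc n))) - R (u (t n))) /\<^sub>R dt) \<bullet> v"
      by (simp add: p_def inner_diff_left algebra_simps)
    have "\<nu> * ((1 / 2) * (grad_inner \<Omega> (u (t (Suc n))) v + grad_inner \<Omega> (u (t n)) v))
        = ((1 / 2) *\<^sub>R (f (t (Suc n)) + f (t n))) \<bullet> v - ((1 / 2) *\<^sub>R (du 1 (t (Suc n)) + du 1 (t n))) \<bullet> v"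
      using heat_eq[of "Suc n"] heat_eq[of n] n by (simp add: inner_add_left distrib_left)
    then show "((p (Suc n) - p n) /\<^sub>R dt) \<bullet> v + \<nu> * grad_inner \<Omega> ((1 / 2) *\<^sub>R (p (Suc n) + p n)) v
        = (\<tau> n + \<eta> (N + Suc n)) \<bullet> v"
      using rom_eq unfolding a d \<tau>_def \<eta>_eq inner_add_left inner_diff_left right_diff_distrib by linarith
  qed (use k in auto)
  define U where "U = (L2_time_norm T (du 3))\<^sup>2"
  have "(\<Sum>n<k. (norm (\<tau> n + \<eta> (N + Suc n)))\<^sup>2) \<le> (\<Sum>n<N. (norm (\<tau> n + \<eta> (N + Suc n)))\<^sup>2)"
    using k by (intro sum_mono2) auto
  also have "\<dots> \<le> (\<Sum>n<N. 2 * (norm (\<tau> n))\<^sup>2 + 2 * (norm (\<eta> (N + Suc n)))\<^sup>2)"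
  proof (rule sum_mono)
    fix n
    have "(norm (\<tau> n + \<eta> (N + Suc n)))\<^sup>2 \<le> (norm (\<tau> n) + norm (\<eta> (N + Suc n)))\<^sup>2"
      by (intro power_mono norm_triangle_ineq) simp
    then show "(norm (\<tau> n + \<eta> (N + Suc n)))\<^sup>2 \<le> 2 * (norm (\<tau> n))\<^sup>2 + 2 * (norm (\<eta> (N + Suc n)))\<^sup>2"
      using sum_squares_bound[of "norm (\<tau> n)" "norm (\<eta> (N + Suc n))"] by (simp add: power2_sum)
  qed
  also have "\<dots> = 2 * (\<Sum>n<N. (norm (\<tau> n))\<^sup>2) + 2 * (\<Sum>n<N. (norm (\<eta> (N + Suc n)))\<^sup>2)"
    by (simp add: sum.distrib sum_distrib_left)
  also have "(\<Sum>n<N. (norm (\<tau> n))\<^sup>2) \<le> 4 * dt ^ 3 * U"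
    using trapezoid_error_sum[OF u_reg pos(2) N] by (simp add: \<tau>_def dt_def t_def U_def)
  \<comment> \<open>Adding the errors at the nodes completes the sum to all 2 N + 1 snapshots, for
    which \<open>S0\<close> is an identity.\<close>
  also have "(\<Sum>n<N. (norm (\<eta> (N + Suc n)))\<^sup>2) \<le> (\<Sum>m<M. (norm (\<eta> m))\<^sup>2)"
  proof -
    have "(\<Sum>n<N. (norm (\<eta> (N + Suc n)))\<^sup>2) = (\<Sum>m\<in>(\<lambda>n. N + Suc n) ` {..<N}. (norm (\<eta> m))\<^sup>2)"
      by (subst sum.reindex) (auto simp: inj_on_def)
    also have "\<dots> \<le> (\<Sum>m<M. (norm (\<eta> m))\<^sup>2)"
      by (rule sum_mono2) (auto simp: M_def)
    finally show ?thesis .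
  qed
  finally have "(\<Sum>n<k. (norm (\<tau> n + \<eta> (N + Suc n)))\<^sup>2) \<le> 8 * dt ^ 3 * U + 2 * (real M * \<Lambda>0)"
    unfolding S0 by simp
  then have "dt / (2 * \<nu>) * (\<Sum>n<k. (norm (\<tau> n + \<eta> (N + Suc n)))\<^sup>2)
      \<le> dt / (2 * \<nu>) * (8 * dt ^ 3 * U + 2 * (real M * \<Lambda>0))"
    using dt pos by (intro mult_left_mono) auto
  also have "\<dots> = 4 / \<nu> * (dt ^ 4 * U) + (dt * real M) / \<nu> * \<Lambda>0"
    using pos by (simp add: field_simps power_numeral_reduce)
  \<comment> \<open>Here dt M = T (2 N + 1) / N \<le> 3 T: the time step compensates the number of
    snapshots.\<close>
  also have "(dt * real M) / \<nu> * \<Lambda>0 \<le> 3 * T / \<nu> * \<Lambda>0"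
  proof -
    have "dt * real M \<le> 3 * T" using N pos by (simp add: dt_def M_def field_simps)
    moreover have "0 \<le> \<Lambda>0" unfolding \<Lambda>0_def using lam by (intro sum_nonneg) auto
    ultimately show ?thesis using pos by (intro mult_right_mono divide_right_mono) auto
  qed
  finally have p_bound: "grad_inner \<Omega> (p k) (p k)
      \<le> grad_inner \<Omega> (p 0) (p 0) + (4 / \<nu> * (dt ^ 4 * U) + 3 * T / \<nu> * \<Lambda>0)"
    using energy by linarith
  have gn: "(grad_norm \<Omega> w)\<^sup>2 = grad_inner \<Omega> w w" for w
    by (simp add: grad_norm_def grad_inner_def sum_nonneg)
  have "u (t k) - ur k = \<eta> k - p k" using k by (simp add: \<eta>_def p_def y_node)
  then have "(grad_norm \<Omega> (u (t k) - ur k))\<^sup>2 \<le> 2 * (grad_norm \<Omega> (\<eta> k))\<^sup>2 + 2 * grad_inner \<Omega> (p k) (p k)"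
    using G.ip_diff_bound[of "\<eta> k" "p k"] \<eta>V[of k] pX[of k] XV k by (auto simp: gn M_def subset_iff)
  also have "\<dots> \<le> 2 * ((4 + 6 * T\<^sup>2) * \<Lambda>1)
      + 2 * (grad_inner \<Omega> (p 0) (p 0) + (4 / \<nu> * (dt ^ 4 * U) + 3 * T / \<nu> * \<Lambda>0))"
    by (intro add_mono mult_left_mono grad_eta p_bound) simp_all
  also have "\<dots> = (8 + 12 * T\<^sup>2) * \<Lambda>1 + 6 * T / \<nu> * \<Lambda>0 + 2 * grad_inner \<Omega> (p 0) (p 0) + 8 / \<nu> * (dt ^ 4 * U)"
    by (simp add: algebra_simps)
  \<comment> \<open>\<open>C\<close> is the sum of the four coefficients 8 + 12 T^2, 6 T / \<nu>, 2
    and 8 / \<nu>, so it dominates each of them.\<close>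
  also have "\<dots> \<le> C * \<Lambda>1 + C * \<Lambda>0 + C * grad_inner \<Omega> (p 0) (p 0) + C * (dt ^ 4 * U)"
  proof -
    have "0 \<le> \<Lambda>0" "0 \<le> \<Lambda>1" unfolding \<Lambda>0_def \<Lambda>1_def using lam by (auto intro!: sum_nonneg)
    moreover have "0 \<le> grad_inner \<Omega> (p 0) (p 0)" by (simp add: grad_inner_def sum_nonneg)
    moreover have "0 \<le> dt ^ 4 * U" using dt by (simp add: U_def)
    moreover have "8 + 12 * T\<^sup>2 \<le> C" "6 * T / \<nu> \<le> C" "2 \<le> C" "8 / \<nu> \<le> C"
      using pos by (auto simp: C_def)
    ultimately show ?thesis by (intro add_mono mult_right_mono) auto
  qed
  also have "\<dots> = C * ((\<Lambda>0 + \<Lambda>1) + grad_inner \<Omega> (p 0) (p 0) + dt ^ 4 * U)"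
    by (simp add: distrib_left)
  also have "\<Lambda>0 + \<Lambda>1 = (\<Sum>i=r+1..s. lam i * ((norm (\<rho> i))\<^sup>2 + (grad_norm \<Omega> (\<rho> i))\<^sup>2))"
    unfolding \<Lambda>0_def \<Lambda>1_def by (simp add: distrib_left sum.distrib)
  finally show ?thesis
    unfolding gn[symmetric] p_def U_def \<rho>_def dt_def t_def .
qed

text \<open>Orthonormality for \<open>grad_inner\<close> makes each mode beyond r orthogonal to the
  reduced space, and uniqueness of the projection does the rest. These values turn the summand of
  the general tail into 1 + norm^2.\<close>

lemma grad_pod_modes:
  fixes u :: "real \<Rightarrow> 'a::euclidean_space l2"
  assumes \<Omega>: "open \<Omega>" "bounded \<Omega>" and u: "\<And>n. n \<le> N \<Longrightarrow> u (time_grid T N n) \<in> H10 \<Omega>"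
    and eig: "ordered_eigensystem (2 * N + 1) (pod_matrix T N (grad_inner \<Omega>) u) lam z"
    and ritz: "is_ritz_projection \<Omega> (pod_space T N u lam z r) R"
    and i: "i \<in> {r+1..num_positive (2 * N + 1) lam}"
  shows "R (pod_mode T N u lam z i) = 0" "(grad_norm \<Omega> (pod_mode T N u lam z i))\<^sup>2 = 1"
proof -
  interpret inner_product_on "H10 \<Omega>" "grad_inner \<Omega>"
    by (rule inner_product_on_grad_inner[OF \<Omega>])
  define \<phi> where "\<phi> = pod_mode T N u lam z"
  have \<phi>V: "\<phi> j \<in> H10 \<Omega>" for j
    unfolding \<phi>_def by (rule dq_pod_modes(2)[OF u eig])
  have orth: "grad_inner \<Omega> (\<phi> i) (\<phi> j) = (if i = j then 1 else 0)"
    if "j \<in> {1..num_positive (2 * N + 1) lam}" for j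
    unfolding \<phi>_def using i that by (intro dq_pod_modes(3)[OF u eig]) auto
  define X where "X = pod_space T N u lam z r"
  have X_eq: "X = span (\<phi> ` {1..r})" by (simp add: X_def pod_space_def \<phi>_def)
  have XV: "X \<subseteq> H10 \<Omega>"
    unfolding X_eq by (rule span_minimal[OF _ subspace]) (use \<phi>V in auto)
  have sX: "subspace X" by (simp add: X_eq)
  interpret subspace_projection "H10 \<Omega>" "grad_inner \<Omega>" X R
    using ritz sX XV by unfold_locales (auto simp: is_ritz_projection_def X_def)
  have "X \<subseteq> {v \<in> H10 \<Omega>. grad_inner \<Omega> (\<phi> i) v = 0}"
    unfolding X_eq
  proof (rule span_minimal)
    show "\<phi> ` {1..r} \<subseteq> {v \<in> H10 \<Omega>. grad_inner \<Omega> (\<phi> i) v = 0}"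
      using \<phi>V orth i by auto
    show "subspace {v \<in> H10 \<Omega>. grad_inner \<Omega> (\<phi> i) v = 0}"
      using \<phi>V by (auto simp: subspace_def ip_add_right ip_scale_right)
  qed
  then have "R (\<phi> i) = 0"
    using \<phi>V subspace_0[OF sX] by (intro R_eqI) auto
  then show "R (pod_mode T N u lam z i) = 0" by (simp add: \<phi>_def)
  have "(grad_norm \<Omega> (\<phi> i))\<^sup>2 = grad_inner \<Omega> (\<phi> i) (\<phi> i)"
    using ip_nonneg[OF \<phi>V] by (simp add: grad_norm_def)
  also have "\<dots> = 1" using orth[of i] i by simp
  finally show "(grad_norm \<Omega> (pod_mode T N u lam z i))\<^sup>2 = 1" by (simp add: \<phi>_def)
qed


theorem lemma4p5:
  fixes \<Omega> :: "'a::euclidean_space set"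
    and \<nu> T :: real
    and u f Lu :: "real \<Rightarrow> 'a l2"
    and du df dLu :: "nat \<Rightarrow> real \<Rightarrow> 'a l2"
  assumes dim: "DIM('a) \<in> {1, 2, 3}"
    and domain: "lipschitz_domain \<Omega>"
    and pos: "\<nu> > 0" "T > 0"
    and u_reg: "H_time 3 T (L2 \<Omega>) u du"
    and laplace: "\<forall>t\<in>{0..T}. weak_laplacian \<Omega> (u t) (Lu t)"
    and Lu_reg: "H_time 2 T (L2 \<Omega>) Lu dLu"
    and f_reg: "H_time 2 T (L2 \<Omega>) f df"
    and heat: "heat_weak_solution \<Omega> \<nu> T f u (du 1)"
  shows "\<exists>C>0. \<forall>N\<ge>1.
    (\<forall>lam z. ordered_eigensystem (2 * N + 1) (pod_matrix T N inner u) lam z \<longrightarrow>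
      (let s = num_positive (2 * N + 1) lam; \<phi> = pod_mode T N u lam z in
       \<forall>r R ur.
         r \<in> {1..s} \<and> is_ritz_projection \<Omega> (pod_space T N u lam z r) R \<and>
         cn_pod_g_rom \<Omega> \<nu> T N f (pod_space T N u lam z r) ur \<longrightarrow>
         (MAX k\<in>{1..N}. (grad_norm \<Omega> (u (time_grid T N k) - ur k))\<^sup>2)
         \<le> C * ((\<Sum>i=r+1..s. lam i * ((norm (\<phi> i - R (\<phi> i)))\<^sup>2 + (grad_norm \<Omega> (\<phi> i - R (\<phi> i)))\<^sup>2))
                + (grad_norm \<Omega> (ur 0 - R (u (time_grid T N 0))))\<^sup>2
                + (T / real N) ^ 4 * data_functional T (du 3) (dLu 2) (df 2)))) \<and>
    (\<forall>lam z. ordered_eigensystem (2 * N + 1) (pod_matrix T N (grad_inner \<Omega>) u) lam z \<longrightarrow>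
      (let s = num_positive (2 * N + 1) lam; \<phi> = pod_mode T N u lam z in
       \<forall>r R ur.
         r \<in> {1..s} \<and> is_ritz_projection \<Omega> (pod_space T N u lam z r) R \<and>
         cn_pod_g_rom \<Omega> \<nu> T N f (pod_space T N u lam z r) ur \<longrightarrow>
         (MAX k\<in>{1..N}. (grad_norm \<Omega> (u (time_grid T N k) - ur k))\<^sup>2)
         \<le> C * ((\<Sum>i=r+1..s. lam i * (1 + (norm (\<phi> i))\<^sup>2))
                + (grad_norm \<Omega> (ur 0 - R (u (time_grid T N 0))))\<^sup>2
                + (T / real N) ^ 4 * data_functional T (du 3) (dLu 2) (df 2))))"
proof -
  have \<Omega>: "open \<Omega>" "bounded \<Omega>" using domain by (auto simp: lipschitz_domain_def)
  define C where "C = 10 + 12 * T\<^sup>2 + 6 * T / \<nu> + 8 / \<nu>"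
  have C: "0 < C" using pos by (simp add: C_def add_pos_nonneg)
  have data: "(L2_time_norm T (du 3))\<^sup>2 \<le> data_functional T (du 3) (dLu 2) (df 2)"
    by (simp add: data_functional_def)
  have V: "u (time_grid T N n) \<in> H10 \<Omega>" if "1 \<le> N" "n \<le> N" for N n
    using heat time_grid_mem[OF pos(2) that] by (simp add: heat_weak_solution_def)
  \<comment> \<open>Stated for an arbitrary \<open>ip\<close> so that it can be used once for each
    basis with the same \<open>C\<close>.\<close>
  have bound: "(MAX k\<in>{1..N}. (grad_norm \<Omega> (u (time_grid T N k) - ur k))\<^sup>2)
      \<le> C * ((\<Sum>i=r+1..num_positive (2 * N + 1) lam. lam i *
              ((norm (pod_mode T N u lam z i - R (pod_mode T N u lam z i)))\<^sup>2
                + (grad_norm \<Omega> (pod_mode T N u lam z i - R (pod_mode T N u lam z i)))\<^sup>2))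
            + (grad_norm \<Omega> (ur 0 - R (u (time_grid T N 0))))\<^sup>2
            + (T / real N) ^ 4 * data_functional T (du 3) (dLu 2) (df 2))"
    if N: "1 \<le> N" and "inner_product_on (H10 \<Omega>) ip"
      and "ordered_eigensystem (2 * N + 1) (pod_matrix T N ip u) lam z"
      and "r \<in> {1..num_positive (2 * N + 1) lam}"
      and "is_ritz_projection \<Omega> (pod_space T N u lam z r) R"
      and "cn_pod_g_rom \<Omega> \<nu> T N f (pod_space T N u lam z r) ur"
    for N ip lam z r R ur
  proof (rule Max.boundedI)
    fix a assume "a \<in> (\<lambda>k. (grad_norm \<Omega> (u (time_grid T N k) - ur k))\<^sup>2) ` {1..N}"
    then obtain k where k: "k \<in> {1..N}" and a: "a = (grad_norm \<Omega> (u (time_grid T N k) - ur k))\<^sup>2"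
      by blast
    show "a \<le> C * ((\<Sum>i=r+1..num_positive (2 * N + 1) lam. lam i *
              ((norm (pod_mode T N u lam z i - R (pod_mode T N u lam z i)))\<^sup>2
                + (grad_norm \<Omega> (pod_mode T N u lam z i - R (pod_mode T N u lam z i)))\<^sup>2))
            + (grad_norm \<Omega> (ur 0 - R (u (time_grid T N 0))))\<^sup>2
            + (T / real N) ^ 4 * data_functional T (du 3) (dLu 2) (df 2))"
      unfolding a C_def
      by (intro order_trans[OF pod_rom_error_bound[OF \<Omega> pos N u_reg heat that(2-6) k]]
          mult_left_mono add_mono) (use C pos data in \<open>auto simp: C_def\<close>)
  qed (use N in auto)
  show ?thesis
  proof (intro exI[of _ C] conjI allI impI C; unfold Let_def; intro allI impI; elim conjE)
    fix N lam z r R ur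
    assume N: "1 \<le> N" and eig: "ordered_eigensystem (2 * N + 1) (pod_matrix T N inner u) lam z"
      and r: "r \<in> {1..num_positive (2 * N + 1) lam}"
      and ritz: "is_ritz_projection \<Omega> (pod_space T N u lam z r) R"
      and rom: "cn_pod_g_rom \<Omega> \<nu> T N f (pod_space T N u lam z r) ur"
    show "(MAX k\<in>{1..N}. (grad_norm \<Omega> (u (time_grid T N k) - ur k))\<^sup>2)
      \<le> C * ((\<Sum>i=r+1..num_positive (2 * N + 1) lam. lam i *
              ((norm (pod_mode T N u lam z i - R (pod_mode T N u lam z i)))\<^sup>2
                + (grad_norm \<Omega> (pod_mode T N u lam z i - R (pod_mode T N u lam z i)))\<^sup>2))
            + (grad_norm \<Omega> (ur 0 - R (u (time_grid T N 0))))\<^sup>2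
            + (T / real N) ^ 4 * data_functional T (du 3) (dLu 2) (df 2))"
      by (rule bound[OF N inner_product_on_inner[OF subspace_H10[OF \<Omega>(1)]] eig r ritz rom])
  next
    fix N lam z r R ur
    assume N: "1 \<le> N"
      and eig: "ordered_eigensystem (2 * N + 1) (pod_matrix T N (grad_inner \<Omega>) u) lam z"
      and r: "r \<in> {1..num_positive (2 * N + 1) lam}"
      and ritz: "is_ritz_projection \<Omega> (pod_space T N u lam z r) R"
      and rom: "cn_pod_g_rom \<Omega> \<nu> T N f (pod_space T N u lam z r) ur"
    have eq: "(\<Sum>i=r+1..num_positive (2 * N + 1) lam. lam i *
          ((norm (pod_mode T N u lam z i - R (pod_mode T N u lam z i)))\<^sup>2
            + (grad_norm \<Omega> (pod_mode T N u lam z i - R (pod_mode T N u lam z i)))\<^sup>2))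
        = (\<Sum>i=r+1..num_positive (2 * N + 1) lam. lam i * (1 + (norm (pod_mode T N u lam z i))\<^sup>2))"
    proof (intro sum.cong refl)
      fix i assume i: "i \<in> {r+1..num_positive (2 * N + 1) lam}"
      have "R (pod_mode T N u lam z i) = 0"
        by (rule grad_pod_modes(1)[OF \<Omega> _ eig ritz i]) (rule V[OF N])
      moreover have "(grad_norm \<Omega> (pod_mode T N u lam z i))\<^sup>2 = 1"
        by (rule grad_pod_modes(2)[OF \<Omega> _ eig ritz i]) (rule V[OF N])
      ultimately show "lam i * ((norm (pod_mode T N u lam z i - R (pod_mode T N u lam z i)))\<^sup>2
            + (grad_norm \<Omega> (pod_mode T N u lam z i - R (pod_mode T N u lam z i)))\<^sup>2)
          = lam i * (1 + (norm (pod_mode T N u lam z i))\<^sup>2)"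
        by (simp only: diff_zero add.commute)
    qed
    show "(MAX k\<in>{1..N}. (grad_norm \<Omega> (u (time_grid T N k) - ur k))\<^sup>2)
      \<le> C * ((\<Sum>i=r+1..num_positive (2 * N + 1) lam. lam i * (1 + (norm (pod_mode T N u lam z i))\<^sup>2))
            + (grad_norm \<Omega> (ur 0 - R (u (time_grid T N 0))))\<^sup>2
            + (T / real N) ^ 4 * data_functional T (du 3) (dLu 2) (df 2))"
      using bound[OF N inner_product_on_grad_inner[OF \<Omega>] eig r ritz rom] unfolding eq .
  qed
qed

end
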